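(* Consider the triangular array $Y_{n,k}=\mu+\delta_n\mathbf{1}\{k>\tau_n\}+\sigma(k/n)\varepsilon_k$, $k=1,\dots,n$, and suppose Assumptions E and V (stated in the context) hold. Let $\varsigma^2=\int_0^1\sigma^2(t)\,dt$, $\eta(t)=\int_0^t\sigma^2(s)\,ds/\varsigma^2$, and $W_\eta(t)=W(\eta(t))$ for a standard Wiener process $W$. (i) Under the null hypothesis $\mathcal{H}_0$, or under local alternatives $\mathcal{H}_1$ with $\delta_n\to0$ as $n\to\infty$, $$\mathscr{Q}(V_n^\star)\xrightarrow{d}\mathscr{S}(W_\eta)\quad\text{and}\quad\mathscr{R}(V_n^\star)\xrightarrow{d}\mathscr{T}(W_\eta),\qquad n\to\infty,$$ almost surely conditionally on $\{Y_{n,k}\}_{n\ge1,k\le n}$. (ii) Under $\mathcal{H}_1$ with $\tau_n=[n\zeta]$ for some $\zeta\in(0,1)$ and $\delta_n\equiv\delta\neq0$ fixed, let $\{B(t),0\le t\le1\}$ be a standard Wiener process independent of $W$ and set $B_\zeta(t)=(1-\zeta)B(t)$ for $t\le\zeta$, $B_\zeta(t)=B(\zeta)-\zeta B(t)$ for $t>\zeta$. Then $$\mathscr{Q}(V_n^\star)\xrightarrow{d}\mathscr{S}\Big(W_\eta-\tfrac{\delta}{\varsigma}B_\zeta\Big)\quad\text{and}\quad\mathscr{R}(V_n^\star)\xrightarrow{d}\mathscr{T}\Big(W_\eta-\tfrac{\delta}{\varsigma}B_\zeta\Big),\qquad n\to\infty,$$ almost surely conditionally on $\{Y_{n,k}\}_{n\ge1,k\le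 n}$.
   Context: Model: $Y_{n,k}=\mu+\delta_n\mathbf{1}\{k>\tau_n\}+\sigma(k/n)\varepsilon_k$, $k=1,\dots,n$, with unknown $\mu,\delta_n\in\mathbb{R}$, $\tau_n\in\{1,\dots,n\}$, strictly stationary centered $\{\varepsilon_k\}$, deterministic $\sigma:[0,1]\to(0,\infty)$. $\mathcal{H}_0:\tau_n=n$; $\mathcal{H}_1:\tau_n<n,\ \delta_n\ne0$. $[x]$ is the integer part. Strong mixing coefficients: $\alpha(n)=\sup_k\sup_{A\in\sigma(\varepsilon_1,\dots,\varepsilon_k),B\in\sigma(\varepsilon_{k+n},\dots)}|P(A\cap B)-P(A)P(B)|$. Assumption E: $\{\varepsilon_n\}$ zero-mean strictly stationary $\alpha$-mixing, $\operatorname{Var}\varepsilon_n=1$, $E|\varepsilon_n|^p<\infty$ for some $p>2$, $\sum_n\alpha(n)^{2(1/r-1/p)}<\infty$ for some $r\in(2,4]$, $r\le p$, $\sum_nn\alpha(n)<\infty$, and $0<1+2\sum_{n\ge1}E\varepsilon_1\varepsilon_{n+1}<\infty$. Assumption V: $\sigma:[0,1]\to\mathbb{R}^+$ has finitely many discontinuity points and satisfies a first-order Lipschitz condition except at discontinuity points. Wild bootstrap: $Y^\star_{n,k}=(Y_{n,k}-\bar Y_{n,1:n})X_k$, $\bar Y_{n,1:n}=\frac1n\sum_{i=1}^nY_{n,i}$, where $\{X_k\}$ are i.i.d. $N(0,1)$, independent of $\{Y_{n,k}\}$. $V_n^\star(k)=\sum_{i=1}^kY^\star_{n,i}$, $\widetilde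 V^\star_n(k)=V^\star_n(n)-V^\star_n(k)$. For a sequence $V(k)$, $k=0..n$, with $\widetilde V(k)=V(n)-V(k)$: $\mathscr{Q}(V)=\max_{1\le k\le n}\left|\frac{V(k)-\frac knV(n)}{\max_{1\le i\le k}|V(i)-\frac ikV(k)|+\max_{k<i\le n}|\widetilde V(i)-\frac{n-i}{n-k}\widetilde V(k)|}\right|$, $\mathscr{R}(V)=\sum_{k=1}^n\frac{\{V(k)-\frac knV(n)\}^2}{\sum_{i=1}^k\{V(i)-\frac ikV(k)\}^2+\sum_{i=k+1}^n\{\widetilde V(i)-\frac{n-i}{n-k}\widetilde V(k)\}^2}$. Functionals on $f\in D[0,1]$, $\widetilde f(u)=f(1)-f(u)$: $\mathscr{S}(f)=\sup_{0\le t\le1}\left|\frac{f(t)-tf(1)}{\sup_{0\le s\le t}|f(s)-\frac stf(t)|+\sup_{t\le u\le1}|\widetilde f(u)-\frac{1-u}{1-t}\widetilde f(t)|}\right|$, $\mathscr{T}(f)=\int_0^1\frac{\{f(t)-tf(1)\}^2}{\int_0^t\{f(s)-\frac stf(t)\}^2ds+\int_t^1\{\widetilde f(u)-\frac{1-u}{1-t}\widetilde f(t)\}^2du}dt$. *)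

theory Defs
  imports "HOL-Probability.Probability"
begin

definition past_events :: "'a measure \<Rightarrow> (nat \<Rightarrow> 'a \<Rightarrow> real) \<Rightarrow> nat \<Rightarrow> 'a set set" where
  "past_events M X k = sigma_sets (space M)
     (\<Union>i\<in>{1..k}. {X i -` A \<inter> space M | A. A \<in> sets borel})"

definition future_events :: "'a measure \<Rightarrow> (nat \<Rightarrow> 'a \<Rightarrow> real) \<Rightarrow> nat \<Rightarrow> 'a set set" where
  "future_events M X m = sigma_sets (space M)
     (\<Union>i\<in>{m..}. {X i -` A \<inter> space M | A. A \<in> sets borel})"

definition alpha_mix :: "'a measure \<Rightarrow> (nat \<Rightarrow> 'a \<Rightarrow> real) \<Rightarrow> nat \<Rightarrow> real" where
  "alpha_mix M X n = Sup {\<bar>measure M (A \<inter> B) - measure M A * measure M B\<bar> | A B k.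
      1 \<le> k \<and> A \<in> past_events M X k \<and> B \<in> future_events M X (k + n)}"

definition strictly_stationary :: "'a measure \<Rightarrow> (nat \<Rightarrow> 'a \<Rightarrow> real) \<Rightarrow> bool" where
  "strictly_stationary M X \<longleftrightarrow>
     (\<forall>h m. distr M (Pi\<^sub>M {..<m} (\<lambda>_. borel)) (\<lambda>\<omega>. \<lambda>i\<in>{..<m}. X (i + 1 + h) \<omega>)
          = distr M (Pi\<^sub>M {..<m} (\<lambda>_. borel)) (\<lambda>\<omega>. \<lambda>i\<in>{..<m}. X (i + 1) \<omega>))"

text \<open>real power a^e for a >= 0 with the mathematical convention 0^0 = 1
  (Isabelle's powr has 0 powr 0 = 0).\<close>
definition rpow :: "real \<Rightarrow> real \<Rightarrow> real" where
  "rpow a e = (if a = 0 then (if e = 0 then 1 else 0) else a powr e)"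

definition assumption_E :: "'a measure \<Rightarrow> (nat \<Rightarrow> 'a \<Rightarrow> real) \<Rightarrow> bool" where
  "assumption_E M \<epsilon> \<longleftrightarrow>
     prob_space M \<and>
     (\<forall>k. \<epsilon> k \<in> borel_measurable M) \<and>
     strictly_stationary M \<epsilon> \<and>
     (\<forall>k\<ge>1. integrable M (\<epsilon> k) \<and> prob_space.expectation M (\<epsilon> k) = 0
             \<and> prob_space.variance M (\<epsilon> k) = 1) \<and>
     (\<exists>p>2. (\<forall>k\<ge>1. integrable M (\<lambda>\<omega>. \<bar>\<epsilon> k \<omega>\<bar> powr p)) \<and>
        (\<exists>r. 2 < r \<and> r \<le> 4 \<and> r \<le> p \<and>
             summable (\<lambda>n. rpow (alpha_mix M \<epsilon> n) (2 * (1 / r - 1 / p))))) \<and>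
     summable (\<lambda>n. real n * alpha_mix M \<epsilon> n) \<and>
     summable (\<lambda>n. prob_space.expectation M (\<lambda>\<omega>. \<epsilon> 1 \<omega> * \<epsilon> (n + 2) \<omega>)) \<and>
     0 < 1 + 2 * (\<Sum>n. prob_space.expectation M (\<lambda>\<omega>. \<epsilon> 1 \<omega> * \<epsilon> (n + 2) \<omega>))"

definition assumption_V :: "(real \<Rightarrow> real) \<Rightarrow> bool" where
  "assumption_V \<sigma> \<longleftrightarrow>
     (\<forall>t\<in>{0..1}. 0 < \<sigma> t) \<and>
     (\<exists>D L. finite D \<and>
        (\<forall>s t. 0 \<le> s \<and> s \<le> t \<and> t \<le> 1 \<and> {s..t} \<inter> D = {} \<longrightarrow>
               \<bar>\<sigma> t - \<sigma> s\<bar> \<le> L * (t - s)))"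

definition Yobs :: "real \<Rightarrow> (nat \<Rightarrow> real) \<Rightarrow> (nat \<Rightarrow> nat) \<Rightarrow> (real \<Rightarrow> real)
     \<Rightarrow> (nat \<Rightarrow> 'a \<Rightarrow> real) \<Rightarrow> nat \<Rightarrow> nat \<Rightarrow> 'a \<Rightarrow> real" where
  "Yobs \<mu> \<delta> \<tau> \<sigma> \<epsilon> n k \<omega> =
     \<mu> + (if k > \<tau> n then \<delta> n else 0) + \<sigma> (real k / real n) * \<epsilon> k \<omega>"

definition Vstar :: "real \<Rightarrow> (nat \<Rightarrow> real) \<Rightarrow> (nat \<Rightarrow> nat) \<Rightarrow> (real \<Rightarrow> real)
     \<Rightarrow> (nat \<Rightarrow> 'a \<Rightarrow> real) \<Rightarrow> nat \<Rightarrow> 'a \<Rightarrow> (nat \<Rightarrow> real) \<Rightarrow> nat \<Rightarrow> real" where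
  "Vstar \<mu> \<delta> \<tau> \<sigma> \<epsilon> n \<omega> x k =
     (\<Sum>i=1..k. (Yobs \<mu> \<delta> \<tau> \<sigma> \<epsilon> n i \<omega>
                 - (\<Sum>j=1..n. Yobs \<mu> \<delta> \<tau> \<sigma> \<epsilon> n j \<omega>) / real n) * x i)"

definition boot_law :: "nat \<Rightarrow> (nat \<Rightarrow> real) measure" where
  "boot_law n = Pi\<^sub>M {1..n} (\<lambda>_. density lborel std_normal_density)"

definition Qstat :: "nat \<Rightarrow> (nat \<Rightarrow> real) \<Rightarrow> real" where
  "Qstat n V = Max (insert 0 {\<bar>(V k - real k / real n * V n) /
       (Max (insert 0 {\<bar>V i - real i / real k * V k\<bar> | i. 1 \<le> i \<and> i \<le> k})
      + Max (insert 0 {\<bar>(V n - V i) - (real n - real i) / (real n - real k) * (V n - V k)\<bar>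
                       | i. k < i \<and> i \<le> n}))\<bar> | k. 1 \<le> k \<and> k \<le> n})"

definition Rstat :: "nat \<Rightarrow> (nat \<Rightarrow> real) \<Rightarrow> real" where
  "Rstat n V = (\<Sum>k=1..n. (V k - real k / real n * V n)\<^sup>2 /
       ((\<Sum>i=1..k. (V i - real i / real k * V k)\<^sup>2)
      + (\<Sum>i=k+1..n. ((V n - V i) - (real n - real i) / (real n - real k) * (V n - V k))\<^sup>2)))"

definition Sfun :: "(real \<Rightarrow> real) \<Rightarrow> real" where
  "Sfun f = (SUP t\<in>{0..1}. \<bar>(f t - t * f 1) /
       ((SUP s\<in>{0..t}. \<bar>f s - s / t * f t\<bar>)
      + (SUP u\<in>{t..1}. \<bar>(f 1 - f u) - (1 - u) / (1 - t) * (f 1 - f t)\<bar>))\<bar>)"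

definition Tfun :: "(real \<Rightarrow> real) \<Rightarrow> real" where
  "Tfun f = integral {0..1} (\<lambda>t. (f t - t * f 1)\<^sup>2 /
       (integral {0..t} (\<lambda>s. (f s - s / t * f t)\<^sup>2)
      + integral {t..1} (\<lambda>u. ((f 1 - f u) - (1 - u) / (1 - t) * (f 1 - f t))\<^sup>2)))"

definition wiener :: "'b measure \<Rightarrow> (real \<Rightarrow> 'b \<Rightarrow> real) \<Rightarrow> bool" where
  "wiener N W \<longleftrightarrow>
     prob_space N \<and>
     (\<forall>t. W t \<in> borel_measurable N) \<and>
     (\<forall>\<omega>\<in>space N. W 0 \<omega> = 0 \<and> continuous_on {0..1} (\<lambda>t. W t \<omega>)) \<and>
     (\<forall>s t. 0 \<le> s \<and> s < t \<and> t \<le> 1 \<longrightarrow>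
        distributed N lborel (\<lambda>\<omega>. W t \<omega> - W s \<omega>) (normal_density 0 (sqrt (t - s)))) \<and>
     (\<forall>(ts :: nat \<Rightarrow> real) m. 0 \<le> ts 0 \<and> ts m \<le> 1 \<and> (\<forall>i<m. ts i < ts (Suc i)) \<longrightarrow>
        prob_space.indep_vars N (\<lambda>_. borel) (\<lambda>i \<omega>. W (ts (Suc i)) \<omega> - W (ts i) \<omega>) {..<m})"

definition wpath :: "(real \<Rightarrow> 'b \<Rightarrow> real) \<Rightarrow> 'b \<Rightarrow> real \<Rightarrow> real" where
  "wpath W \<omega> = (\<lambda>t\<in>{0..1}. W t \<omega>)"

end

theory Submission
  imports Defs
begin

text \<open>Given the data, \<open>V\<^sup>\<star>\<close> is a Gaussian random walk whose increments have the squared residuals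
  as variances. Both statistics are invariant under scaling, so they have the same law as when they are evaluated at
  \<open>G(g(k))\<close>, where \<open>G\<close> is the limit process itself, on its own probability space, and the times \<open>g(k)\<close> are
  chosen so that the increments of \<open>G\<close> have the right variances up to a common factor. No functional central
  limit theorem is needed: it suffices that \<open>g(k) - k/n\<close> tends to \<open>0\<close> uniformly in \<open>k\<close>, since then the
  statistics converge along almost every path of \<open>G\<close>. This in turn says that the normalised partial sums of
  the squared residuals converge, which follows from the strong law for \<open>\<epsilon>\<^sub>i\<close> and \<open>\<epsilon>\<^sub>i\<^sup>2\<close> by Abel
  summation, because \<open>\<sigma>\<close> has bounded variation. The strong law holds for indicator functions by a variance
  bound from mixing along the sample sizes \<open>n = m\<^sup>2\<close>, and extends to \<open>L\<^sup>1\<close> by the maximal inequality for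
  stationary sequences.\<close>

section \<open>The strong law for stationary mixing sequences\<close>

text \<open>In case (ii) the squared residuals split into squared noise, the squared centred step
  and cross terms that average out. The sums of the squared step tend to a multiple of
  \<open>shift_var\<close>, which is also the variance clock of \<open>shift_path\<close>; its
  coefficients \<open>1 - \<zeta>\<close> and \<open>- \<zeta>\<close> act on disjoint time
  intervals, so the limit keeps independent increments. Both cases thus become one statement about a
  process with independent normal increments and a strictly increasing clock \<open>K\<close>, and
  the sampling times are values of the inverse of \<open>K\<close>. Two obstacles shape the rest.
  The statistics are ratios whose denominators vanish on paths that are linear on both sides of some
  point; almost every path avoids this, and then continuity in \<open>t\<close> keeps the
  denominators away from \<open>0\<close>. Moreover, comparing \<open>i / k\<close> with a
  continuous parameter costs \<open>1 / k\<close>, which is not small for small \<open>k\<close>;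
  the smallness of the path near \<open>0\<close> compensates. The limit functionals also need
  measurability proofs, as they involve an uncountable supremum and a gauge integral.\<close>

lemma (in prob_space) alpha_mix_ge:
  assumes "A \<in> sets borel" "B \<in> sets borel" "1 \<le> i"
  shows "\<bar>prob ((X i -` A \<inter> space M) \<inter> (X (i + n) -` B \<inter> space M))
           - prob (X i -` A \<inter> space M) * prob (X (i + n) -` B \<inter> space M)\<bar> \<le> alpha_mix M X n"
  unfolding alpha_mix_def
proof (rule cSup_upper)
  have "X i -` A \<inter> space M \<in> past_events M X i"
    unfolding past_events_def using assms by (intro sigma_sets.Basic UN_I[of i]) auto
  moreover have "X (i + n) -` B \<inter> space M \<in> future_events M X (i + n)"
    unfolding future_events_def using assms by (intro sigma_sets.Basic UN_I[of "i + n"]) auto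
  ultimately show "\<bar>prob ((X i -` A \<inter> space M) \<inter> (X (i + n) -` B \<inter> space M))
           - prob (X i -` A \<inter> space M) * prob (X (i + n) -` B \<inter> space M)\<bar>
       \<in> {\<bar>prob (A \<inter> B) - prob A * prob B\<bar> |A B k.
           1 \<le> k \<and> A \<in> past_events M X k \<and> B \<in> future_events M X (k + n)}"
    using assms(3) by blast
  \<comment> \<open>Membership bounds an element by \<open>Sup\<close> only if the set is bounded
    above; here every element is at most \<open>1\<close>.\<close>
  show "bdd_above {\<bar>prob (A \<inter> B) - prob A * prob B\<bar> |A B k.
           1 \<le> k \<and> A \<in> past_events M X k \<and> B \<in> future_events M X (k + n)}"
  proof (rule bdd_aboveI[of _ 1], clarify)
    fix A B
    have "0 \<le> prob A * prob B" "prob A * prob B \<le> 1"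
      by (auto intro: mult_le_one)
    then show "\<bar>prob (A \<inter> B) - prob A * prob B\<bar> \<le> 1"
      using prob_le_1[of "A \<inter> B"] measure_nonneg[of M "A \<inter> B"] by linarith
  qed
qed

lemma (in prob_space) alpha_mix_nonneg: "0 \<le> alpha_mix M X n"
  using alpha_mix_ge[of UNIV UNIV 1 X n] by auto

text \<open>Integrals depend only on the law, and stationarity equates the laws of shifted blocks.
  Functionals of a whole block, not only of one variable, are needed for the maximal
  inequality.\<close>

lemma (in prob_space) stationary_expectation:
  fixes F :: "(nat \<Rightarrow> real) \<Rightarrow> real"
  assumes X: "\<And>k. X k \<in> borel_measurable M"
    and stat: "strictly_stationary M X"
    and F: "F \<in> borel_measurable (Pi\<^sub>M {..<m} (\<lambda>_. borel))"
  shows "expectation (\<lambda>\<omega>. F (\<lambda>i\<in>{..<m}. X (i + 1 + h) \<omega>))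
       = expectation (\<lambda>\<omega>. F (\<lambda>i\<in>{..<m}. X (i + 1) \<omega>))"
    and "integrable M (\<lambda>\<omega>. F (\<lambda>i\<in>{..<m}. X (i + 1 + h) \<omega>))
       = integrable M (\<lambda>\<omega>. F (\<lambda>i\<in>{..<m}. X (i + 1) \<omega>))"
proof -
  have m1: "(\<lambda>\<omega>. \<lambda>i\<in>{..<m}. X (i + 1 + h) \<omega>) \<in> measurable M (Pi\<^sub>M {..<m} (\<lambda>_. borel))" for h
    using X by (intro measurable_restrict) auto
  have m2: "(\<lambda>\<omega>. \<lambda>i\<in>{..<m}. X (i + 1) \<omega>) \<in> measurable M (Pi\<^sub>M {..<m} (\<lambda>_. borel))"
    using X by (intro measurable_restrict) auto
  have eq: "distr M (Pi\<^sub>M {..<m} (\<lambda>_. borel)) (\<lambda>\<omega>. \<lambda>i\<in>{..<m}. X (i + 1 + h) \<omega>)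
      = distr M (Pi\<^sub>M {..<m} (\<lambda>_. borel)) (\<lambda>\<omega>. \<lambda>i\<in>{..<m}. X (i + 1) \<omega>)"
    using stat unfolding strictly_stationary_def by blast
  show "expectation (\<lambda>\<omega>. F (\<lambda>i\<in>{..<m}. X (i + 1 + h) \<omega>))
       = expectation (\<lambda>\<omega>. F (\<lambda>i\<in>{..<m}. X (i + 1) \<omega>))"
    using arg_cong[OF eq, of "\<lambda>D. integral\<^sup>L D F"] unfolding integral_distr[OF m1 F] integral_distr[OF m2 F] .
  show "integrable M (\<lambda>\<omega>. F (\<lambda>i\<in>{..<m}. X (i + 1 + h) \<omega>))
       = integrable M (\<lambda>\<omega>. F (\<lambda>i\<in>{..<m}. X (i + 1) \<omega>))"
    using arg_cong[OF eq, of "\<lambda>D. integrable D F"] unfolding integrable_distr_eq[OF m1 F] integrable_distr_eq[OF m2 F] .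
qed

lemma (in prob_space) stationary_expectation_1:
  fixes f :: "real \<Rightarrow> real"
  assumes X: "\<And>k. X k \<in> borel_measurable M"
    and stat: "strictly_stationary M X"
    and f: "f \<in> borel_measurable borel" and "1 \<le> i"
  shows "expectation (\<lambda>\<omega>. f (X i \<omega>)) = expectation (\<lambda>\<omega>. f (X 1 \<omega>))"
    and "integrable M (\<lambda>\<omega>. f (X i \<omega>)) = integrable M (\<lambda>\<omega>. f (X 1 \<omega>))"
proof -
  have F: "(\<lambda>x. f (x 0)) \<in> borel_measurable (Pi\<^sub>M {..<1::nat} (\<lambda>_. borel))"
    using f by measurable
  show "expectation (\<lambda>\<omega>. f (X i \<omega>)) = expectation (\<lambda>\<omega>. f (X 1 \<omega>))"
    "integrable M (\<lambda>\<omega>. f (X i \<omega>)) = integrable M (\<lambda>\<omega>. f (X 1 \<omega>))"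
    using stationary_expectation[OF X stat F, of "i - 1"] \<open>1 \<le> i\<close> by simp_all
qed

section \<open>Strong law for indicator functions\<close>

text \<open>For fixed \<open>i\<close> each lag occurs at most twice among the \<open>j\<close>,
  once on either side of \<open>i\<close>. This bounds the row sums of a covariance matrix dominated
  by \<open>a\<close>.\<close>

lemma sum_dist_summable_le:
  fixes a :: "nat \<Rightarrow> real"
  assumes "summable a" "\<And>k. 0 \<le> a k"
  shows "(\<Sum>j=1..n. a (if i \<le> j then j - i else i - j)) \<le> 2 * suminf a"
proof -
  have "(\<Sum>j=1..n. a (if i \<le> j then j - i else i - j))
      \<le> (\<Sum>j\<in>{j\<in>{1..n}. i \<le> j}. a (j - i)) + (\<Sum>j\<in>{j\<in>{1..n}. j < i}. a (i - j))"
  proof -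
    have "(\<Sum>j=1..n. a (if i \<le> j then j - i else i - j))
       = (\<Sum>j\<in>{1..n}. if i \<le> j then a (j - i) else a (i - j))"
      by (intro sum.cong) auto
    also have "\<dots> = (\<Sum>j\<in>{1..n} \<inter> {j. i \<le> j}. a (j - i)) + (\<Sum>j\<in>{1..n} \<inter> - {j. i \<le> j}. a (i - j))"
      by (rule sum.If_cases) auto
    also have "{1..n} \<inter> {j. i \<le> j} = {j\<in>{1..n}. i \<le> j}" by auto
    also have "{1..n} \<inter> - {j. i \<le> j} = {j\<in>{1..n}. j < i}" by auto
    finally show ?thesis by simp
  qed
  also have "(\<Sum>j\<in>{j\<in>{1..n}. i \<le> j}. a (j - i)) = sum a ((\<lambda>j. j - i) ` {j\<in>{1..n}. i \<le> j})"
    by (subst sum.reindex) (auto simp: inj_on_def)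
  also have "\<dots> \<le> suminf a"
    using assms by (intro sum_le_suminf) auto
  also have "(\<Sum>j\<in>{j\<in>{1..n}. j < i}. a (i - j)) = sum a ((\<lambda>j. i - j) ` {j\<in>{1..n}. j < i})"
    by (subst sum.reindex) (auto simp: inj_on_def)
  also have "\<dots> \<le> suminf a"
    using assms by (intro sum_le_suminf) auto
  finally show ?thesis by simp
qed

text \<open>Expand the square: the covariance at lag \<open>k\<close> is at most
  \<open>alpha_mix M X k\<close>, so each of the \<open>n\<close> rows contributes at most twice the
  sum of the coefficients.\<close>

lemma (in prob_space) empirical_second_moment:
  fixes X :: "nat \<Rightarrow> 'a \<Rightarrow> real"
  assumes X[measurable]: "\<And>k. X k \<in> borel_measurable M"
    and stat: "strictly_stationary M X"
    and sm: "summable (alpha_mix M X)"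
    and A[measurable]: "A \<in> sets borel"
  defines "p \<equiv> expectation (\<lambda>\<omega>. indicator A (X 1 \<omega>))"
  shows "expectation (\<lambda>\<omega>. (\<Sum>i=1..n. indicator A (X i \<omega>) - p)\<^sup>2) \<le> real n * (2 * suminf (alpha_mix M X))"
proof -
  have P: "prob (X i -` A \<inter> space M) = p" if "1 \<le> i" for i
  proof -
    have "prob (X i -` A \<inter> space M) = expectation (indicator (X i -` A \<inter> space M))"
      by simp
    also have "\<dots> = expectation (\<lambda>\<omega>. indicator A (X i \<omega>))"
      by (intro Bochner_Integration.integral_cong) (auto simp: indicator_def)
    finally show ?thesis
      using stationary_expectation_1(1)[OF X stat _ that, of "indicator A"] by (simp add: p_def)
  qed
  have I: "expectation (\<lambda>\<omega>. indicator A (X i \<omega>)) = p" if "1 \<le> i" for i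
    using stationary_expectation_1(1)[OF X stat _ that, of "indicator A"] by (simp add: p_def)
  have int: "integrable M (\<lambda>\<omega>. indicator A (X i \<omega>) :: real)" for i
    by (rule integrable_const_bound[of _ 1]) auto
  have int2: "integrable M (\<lambda>\<omega>. indicator A (X i \<omega>) * indicator A (X j \<omega>) :: real)" for i j
    by (rule integrable_const_bound[of _ 1]) (auto simp: indicator_def)
  have cov: "expectation (\<lambda>\<omega>. (indicator A (X i \<omega>) - p) * (indicator A (X j \<omega>) - p))
      = prob ((X i -` A \<inter> space M) \<inter> (X j -` A \<inter> space M)) - p * p" if "1 \<le> i" "1 \<le> j" for i j
  proof -
    have "expectation (\<lambda>\<omega>. (indicator A (X i \<omega>) - p) * (indicator A (X j \<omega>) - p))
       = expectation (\<lambda>\<omega>. indicator A (X i \<omega>) * indicator A (X j \<omega>) - p * indicator A (X j \<omega>)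
           - p * indicator A (X i \<omega>) + p * p)"
      by (simp add: algebra_simps)
    also have "\<dots> = expectation (\<lambda>\<omega>. indicator A (X i \<omega>) * indicator A (X j \<omega>)) - p * p"
      using int int2 I that by (simp add: prob_space)
    also have "expectation (\<lambda>\<omega>. indicator A (X i \<omega>) * indicator A (X j \<omega>) :: real) =
       expectation (indicator ((X i -` A \<inter> space M) \<inter> (X j -` A \<inter> space M)))"
      by (intro Bochner_Integration.integral_cong) (auto simp: indicator_def)
    also have "\<dots> = prob ((X i -` A \<inter> space M) \<inter> (X j -` A \<inter> space M))"
      by (simp add: Int_assoc)
    finally show ?thesis .
  qed
  \<comment> \<open>Lag \<open>0\<close> is covered too: an event of \<open>X i\<close> belongs both
    to the past up to \<open>i\<close> and to the future from \<open>i\<close>, so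
    \<open>alpha_mix M X 0\<close> bounds the variance.\<close>
  have le: "prob ((X i -` A \<inter> space M) \<inter> (X j -` A \<inter> space M)) - p * p
     \<le> alpha_mix M X (if i \<le> j then j - i else i - j)" if ij: "1 \<le> i" "1 \<le> j" for i j
  proof (cases "i \<le> j")
    case True
    then show ?thesis using alpha_mix_ge[of A A i X "j - i"] ij P by auto
  next
    case False
    then show ?thesis using alpha_mix_ge[of A A j X "i - j"] ij P by (auto simp: Int_commute)
  qed
  have int3: "integrable M (\<lambda>\<omega>. (indicator A (X i \<omega>) - p) * (indicator A (X j \<omega>) - p))" for i j
    using int int2 by (simp add: algebra_simps)
  have "expectation (\<lambda>\<omega>. (\<Sum>i=1..n. indicator A (X i \<omega>) - p)\<^sup>2)
     = (\<Sum>i=1..n. \<Sum>j=1..n. expectation (\<lambda>\<omega>. (indicator A (X i \<omega>) - p) * (indicator A (X j \<omega>) - p)))"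
    unfolding power2_eq_square sum_product using int3
    by (simp add: Bochner_Integration.integral_sum)
  also have "\<dots> \<le> (\<Sum>i=1..n. \<Sum>j=1..n. alpha_mix M X (if i \<le> j then j - i else i - j))"
    using cov le by (intro sum_mono) simp
  also have "\<dots> \<le> (\<Sum>i=1..n. 2 * suminf (alpha_mix M X))"
    by (intro sum_mono sum_dist_summable_le sm alpha_mix_nonneg)
  finally show ?thesis by simp
qed

text \<open>By monotone convergence the series of the \<open>f n\<close> has finite expectation, so
  it is finite almost everywhere and its terms tend to \<open>0\<close>. This takes the place of
  Chebyshev and Borel-Cantelli.\<close>

lemma (in prob_space) AE_tendsto_0_of_summable_expectation:
  fixes f :: "nat \<Rightarrow> 'a \<Rightarrow> real"
  assumes f[measurable]: "\<And>n. integrable M (f n)" and nn: "\<And>n \<omega>. 0 \<le> f n \<omega>"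
    and sm: "summable (\<lambda>n. expectation (f n))"
  shows "AE \<omega> in M. (\<lambda>n. f n \<omega>) \<longlonglongrightarrow> 0"
proof -
  have [measurable]: "f n \<in> borel_measurable M" for n using f by auto
  have "(\<integral>\<^sup>+\<omega>. (\<Sum>n. ennreal (f n \<omega>)) \<partial>M) = (\<Sum>n. \<integral>\<^sup>+\<omega>. ennreal (f n \<omega>) \<partial>M)"
    by (rule nn_integral_suminf) auto
  also have "\<dots> = (\<Sum>n. ennreal (expectation (f n)))"
    using f nn by (simp add: nn_integral_eq_integral)
  also have "\<dots> \<noteq> \<infinity>"
    using sm nn by (simp add: ennreal_suminf_neq_top)
  finally have "AE \<omega> in M. (\<Sum>n. ennreal (f n \<omega>)) \<noteq> \<infinity>"
    by (intro nn_integral_PInf_AE) auto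
  then show ?thesis
  proof eventually_elim
    fix \<omega> assume "(\<Sum>n. ennreal (f n \<omega>)) \<noteq> \<infinity>"
    then show "(\<lambda>n. f n \<omega>) \<longlonglongrightarrow> 0"
      using nn by (intro summable_LIMSEQ_zero summable_suminf_not_top) auto
  qed
qed

text \<open>Between consecutive squares there are at most \<open>2 * k\<close> further terms, each
  bounded by \<open>1\<close>; this is negligible against \<open>k\<^sup>2\<close>.\<close>

lemma tendsto_average_of_squares:
  fixes z :: "nat \<Rightarrow> real"
  assumes z: "\<And>i. \<bar>z i\<bar> \<le> 1"
    and lim: "(\<lambda>k. (\<Sum>i=1..k\<^sup>2. z i) / real (k\<^sup>2)) \<longlonglongrightarrow> 0"
  shows "(\<lambda>n. (\<Sum>i=1..n. z i) / real n) \<longlonglongrightarrow> 0"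
proof -
  have fl: "filterlim floor_sqrt at_top at_top"
    unfolding filterlim_at_top
  proof
    fix Z :: nat
    show "\<forall>\<^sub>F x in sequentially. Z \<le> floor_sqrt x"
      using eventually_ge_at_top[of "Z^2"] by eventually_elim (simp add: le_floor_sqrt_iff)
  qed
  have "\<bar>(\<Sum>i=1..n. z i) / real n\<bar>
      \<le> \<bar>(\<Sum>i=1..(floor_sqrt n)\<^sup>2. z i) / real ((floor_sqrt n)\<^sup>2)\<bar> + 2 * inverse (real (floor_sqrt n))"
    if "1 \<le> n" for n
  proof -
    define k where "k = floor_sqrt n"
    have k: "k\<^sup>2 \<le> n" "n < (Suc k)\<^sup>2" "1 \<le> k"
      using that by (auto simp: k_def Suc_floor_sqrt_power2_gt le_floor_sqrt_iff)
    have nk: "n - k\<^sup>2 \<le> 2 * k" using k(2) by (simp add: power2_eq_square)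
    have "{1..n} = {1..k\<^sup>2} \<union> {k\<^sup>2 + 1..n}" using k by auto
    then have "(\<Sum>i=1..n. z i) = (\<Sum>i=1..k\<^sup>2. z i) + (\<Sum>i=k\<^sup>2 + 1..n. z i)"
      by (simp add: sum.union_disjoint)
    moreover have "\<bar>\<Sum>i=k\<^sup>2 + 1..n. z i\<bar> \<le> 2 * real k"
    proof -
      have "\<bar>\<Sum>i=k\<^sup>2 + 1..n. z i\<bar> \<le> (\<Sum>i=k\<^sup>2 + 1..n. \<bar>z i\<bar>)" by (rule sum_abs)
      also have "\<dots> \<le> (\<Sum>i=k\<^sup>2 + 1..n. 1)" by (intro sum_mono z)
      also have "\<dots> \<le> 2 * real k" using nk by simp
      finally show ?thesis .
    qed
    ultimately have "\<bar>\<Sum>i=1..n. z i\<bar> \<le> \<bar>\<Sum>i=1..k\<^sup>2. z i\<bar> + 2 * real k" by linarith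
    then have "\<bar>(\<Sum>i=1..n. z i) / real n\<bar> \<le> (\<bar>\<Sum>i=1..k\<^sup>2. z i\<bar> + 2 * real k) / real n"
      by (simp add: divide_right_mono)
    also have "\<dots> \<le> (\<bar>\<Sum>i=1..k\<^sup>2. z i\<bar> + 2 * real k) / real (k\<^sup>2)"
    proof (rule divide_left_mono)
      show "real (k\<^sup>2) \<le> real n" using k(1) by (rule of_nat_mono)
      show "0 < real n * real (k\<^sup>2)" using k that by simp
    qed simp
    also have "\<dots> = \<bar>(\<Sum>i=1..k\<^sup>2. z i) / real (k\<^sup>2)\<bar> + 2 * inverse (real k)"
      using k by (simp add: add_divide_distrib power2_eq_square inverse_eq_divide)
    finally show ?thesis unfolding k_def .
  qed
  then have ev: "\<forall>\<^sub>F n in sequentially. norm ((\<Sum>i=1..n. z i) / real n)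
      \<le> \<bar>(\<Sum>i=1..(floor_sqrt n)\<^sup>2. z i) / real ((floor_sqrt n)\<^sup>2)\<bar> + 2 * inverse (real (floor_sqrt n))"
    unfolding eventually_sequentially real_norm_def by blast
  have "(\<lambda>k. \<bar>(\<Sum>i=1..k\<^sup>2. z i) / real (k\<^sup>2)\<bar> + 2 * inverse (real k)) \<longlonglongrightarrow> \<bar>0\<bar> + 2 * 0"
    by (intro tendsto_intros lim lim_inverse_n)
  then have "(\<lambda>k. \<bar>(\<Sum>i=1..k\<^sup>2. z i) / real (k\<^sup>2)\<bar> + 2 * inverse (real k)) \<longlonglongrightarrow> 0"
    by simp
  from filterlim_compose[OF this fl] show ?thesis
    by (rule Lim_null_comparison[OF ev])
qed

lemma (in prob_space) slln_indicator:
  fixes X :: "nat \<Rightarrow> 'a \<Rightarrow> real"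
  assumes X[measurable]: "\<And>k. X k \<in> borel_measurable M"
    and stat: "strictly_stationary M X"
    and sm: "summable (alpha_mix M X)"
    and A[measurable]: "A \<in> sets borel"
  shows "AE \<omega> in M. (\<lambda>n. (\<Sum>i=1..n. indicator A (X i \<omega>)) / real n)
            \<longlonglongrightarrow> expectation (\<lambda>\<omega>. indicator A (X 1 \<omega>))"
proof -
  define p where "p = expectation (\<lambda>\<omega>. indicator A (X 1 \<omega>) :: real)"
  define C where "C = 2 * suminf (alpha_mix M X)"
  have p: "0 \<le> p" "p \<le> 1"
    unfolding p_def by (auto intro!: integral_le_const integrable_const_bound[of _ 1])
  have z: "\<bar>indicator A x - p\<bar> \<le> 1" for x using p by (auto simp: indicator_def)
  define f where "f n \<omega> = ((\<Sum>i=1..n\<^sup>2. indicator A (X i \<omega>) - p) / real (n\<^sup>2))\<^sup>2" for n \<omega>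
  have int: "integrable M (\<lambda>\<omega>. (\<Sum>i=1..n. indicator A (X i \<omega>) - p)\<^sup>2)" for n
  proof (rule integrable_const_bound[of _ "(real n)\<^sup>2"])
    show "AE \<omega> in M. norm ((\<Sum>i=1..n. indicator A (X i \<omega>) - p)\<^sup>2) \<le> (real n)\<^sup>2"
    proof (rule AE_I2)
      fix \<omega>
      have "\<bar>\<Sum>i=1..n. indicator A (X i \<omega>) - p\<bar> \<le> (\<Sum>i=1..n. \<bar>indicator A (X i \<omega>) - p\<bar>)"
        by (rule sum_abs)
      also have "\<dots> \<le> (\<Sum>i=1..n. 1)" by (intro sum_mono z)
      finally have "\<bar>\<Sum>i=1..n. indicator A (X i \<omega>) - p\<bar> \<le> \<bar>real n\<bar>" by simp
      then show "norm ((\<Sum>i=1..n. indicator A (X i \<omega>) - p)\<^sup>2) \<le> (real n)\<^sup>2"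
        unfolding abs_le_square_iff by (simp del: sum_subtractf)
    qed
  qed measurable
  have "AE \<omega> in M. (\<lambda>n. f n \<omega>) \<longlonglongrightarrow> 0"
  proof (rule AE_tendsto_0_of_summable_expectation)
    show "integrable M (f n)" for n
      using int[of "n^2"] unfolding f_def power_divide by (rule integrable_divide)
    show "0 \<le> f n \<omega>" for n \<omega> by (simp add: f_def)
    \<comment> \<open>The second moment of an average of \<open>N\<close> terms is at most
      \<open>C / N\<close>, which is not summable in \<open>N\<close>; along
      \<open>N = n\<^sup>2\<close> it is.\<close>
    have le: "norm (expectation (f n)) \<le> C * inverse ((real n)\<^sup>2)" for n
    proof -
      have "expectation (f n) = expectation (\<lambda>\<omega>. (\<Sum>i=1..n\<^sup>2. indicator A (X i \<omega>) - p)\<^sup>2) / (real (n\<^sup>2))\<^sup>2"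
        unfolding f_def power_divide by simp
      also have "\<dots> \<le> (real (n\<^sup>2) * C) / (real (n\<^sup>2))\<^sup>2"
        unfolding p_def C_def
        by (intro divide_right_mono empirical_second_moment[OF X stat sm A]) auto
      also have "\<dots> = C * inverse ((real n)\<^sup>2)"
        by (cases "n = 0") (auto simp: field_simps power2_eq_square)
      finally show ?thesis
        by (simp add: f_def)
    qed
    have "summable (\<lambda>n. inverse ((real n)\<^sup>2))"
      by (rule inverse_power_summable) simp
    then have "summable (\<lambda>n. C * inverse ((real n)\<^sup>2))"
      by (rule summable_mult)
    then show "summable (\<lambda>n. expectation (f n))"
      by (rule summable_comparison_test'[where N = 0]) (rule le)
  qed
  then show ?thesis
  proof eventually_elim
    fix \<omega> assume "(\<lambda>n. f n \<omega>) \<longlonglongrightarrow> 0"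
    then have "(\<lambda>n. sqrt (f n \<omega>)) \<longlonglongrightarrow> sqrt 0" by (rule tendsto_real_sqrt)
    then have "(\<lambda>n. \<bar>(\<Sum>i=1..n\<^sup>2. indicator A (X i \<omega>) - p) / real (n\<^sup>2)\<bar>) \<longlonglongrightarrow> 0"
      unfolding f_def real_sqrt_abs by simp
    then have "(\<lambda>n. (\<Sum>i=1..n\<^sup>2. indicator A (X i \<omega>) - p) / real (n\<^sup>2)) \<longlonglongrightarrow> 0"
      by (rule tendsto_rabs_zero_cancel)
    from tendsto_average_of_squares[OF z this]
    have "(\<lambda>n. (\<Sum>i=1..n. indicator A (X i \<omega>) - p) / real n) \<longlonglongrightarrow> 0" .
    then have "(\<lambda>n. (\<Sum>i=1..n. indicator A (X i \<omega>) - p) / real n + p) \<longlonglongrightarrow> 0 + p"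
      by (intro tendsto_intros)
    moreover have "\<forall>\<^sub>F n in sequentially. (\<Sum>i=1..n. indicator A (X i \<omega>) - p) / real n + p
         = (\<Sum>i=1..n. indicator A (X i \<omega>)) / real n"
      using eventually_gt_at_top[of 0] 
      by eventually_elim (simp add: sum_subtractf field_simps)
    ultimately show "(\<lambda>n. (\<Sum>i=1..n. indicator A (X i \<omega>)) / real n)
            \<longlonglongrightarrow> expectation (\<lambda>\<omega>. indicator A (X 1 \<omega>))"
      unfolding p_def[symmetric] by (simp add: tendsto_cong)
  qed
qed


section \<open>Maximal inequality and extension to integrable functions\<close>

text \<open>Garsia's argument for the maximal ergodic lemma, with blocks of finite length in place
  of a measure-preserving shift: dropping the first summand turns partial sums of the sequence into
  partial sums of the shifted sequence, and stationarity cancels the two maxima in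
  expectation.\<close>

lemma (in prob_space) maximal_inequality_finite:
  fixes X :: "nat \<Rightarrow> 'a \<Rightarrow> real" and f :: "real \<Rightarrow> real"
  assumes X[measurable]: "\<And>k. X k \<in> borel_measurable M"
    and stat: "strictly_stationary M X"
    and f[measurable]: "f \<in> borel_measurable borel"
    and nn: "\<And>x. 0 \<le> f x" and int: "integrable M (\<lambda>\<omega>. f (X 1 \<omega>))" and c: "0 < c"
  shows "c * prob {\<omega>\<in>space M. \<exists>k\<le>n. c * real k < (\<Sum>i=1..k. f (X i \<omega>))}
      \<le> expectation (\<lambda>\<omega>. f (X 1 \<omega>))"
proof -
  \<comment> \<open>The empty sum \<open>k = 0\<close> is included, which makes \<open>F\<close>
    nonnegative and \<open>0 < F\<close> equivalent to the event in question.\<close>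
  define F where "F x = Max ((\<lambda>k. \<Sum>i<k. f (x i) - c) ` {..n})" for x :: "nat \<Rightarrow> real"
  have F[measurable]: "F \<in> borel_measurable (Pi\<^sub>M {..<n} (\<lambda>_. borel))"
    unfolding F_def
    by (intro borel_measurable_Max borel_measurable_sum) (auto intro!: measurable_compose[OF _ f] borel_measurable_diff)
  define v where "v h \<omega> = (\<lambda>i\<in>{..<n}. X (i + 1 + h) \<omega>)" for h \<omega>
  have v[measurable]: "v h \<in> measurable M (Pi\<^sub>M {..<n} (\<lambda>_. borel))" for h
    unfolding v_def using X by (intro measurable_restrict) auto
  have v0: "(\<Sum>i<k. f (v h \<omega> i) - c) = (\<Sum>i<k. f (X (i + 1 + h) \<omega>) - c)" if "k \<le> n" for k h \<omega>
    using that by (intro sum.cong) (auto simp: v_def)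
  have intX: "integrable M (\<lambda>\<omega>. f (X (i + 1) \<omega>))" for i
    using stationary_expectation_1(2)[OF X stat f, of "i + 1"] int by simp
  have F_le: "\<bar>F (v 0 \<omega>)\<bar> \<le> (\<Sum>i<n. f (X (i + 1) \<omega>) + c)" for \<omega>
  proof -
    have "\<bar>\<Sum>i<k. f (v 0 \<omega> i) - c\<bar> \<le> (\<Sum>i<n. f (X (i + 1) \<omega>) + c)" if "k \<le> n" for k
    proof -
      have "\<bar>\<Sum>i<k. f (v 0 \<omega> i) - c\<bar> \<le> (\<Sum>i<k. \<bar>f (X (i + 1) \<omega>) - c\<bar>)"
        unfolding v0[OF that] by (auto intro: sum_abs)
      also have "\<dots> \<le> (\<Sum>i<k. f (X (i + 1) \<omega>) + c)"
        using nn c by (intro sum_mono) (smt (verit) nn)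
      also have "\<dots> \<le> (\<Sum>i<n. f (X (i + 1) \<omega>) + c)"
        using nn c that by (intro sum_mono2) (auto intro: add_nonneg_nonneg)
      finally show ?thesis .
    qed
    moreover have "F (v 0 \<omega>) \<in> (\<lambda>k. \<Sum>i<k. f (v 0 \<omega> i) - c) ` {..n}"
      unfolding F_def by (rule Max_in) auto
    ultimately show ?thesis by auto
  qed
  have int0: "integrable M (\<lambda>\<omega>. F (v 0 \<omega>))"
  proof (rule Bochner_Integration.integrable_bound)
    show "integrable M (\<lambda>\<omega>. \<Sum>i<n. f (X (i + 1) \<omega>) + c)"
      using intX by (intro Bochner_Integration.integrable_sum Bochner_Integration.integrable_add) auto
    show "AE \<omega> in M. norm (F (v 0 \<omega>)) \<le> norm (\<Sum>i<n. f (X (i + 1) \<omega>) + c)"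
    proof (rule AE_I2)
      fix \<omega>
      show "norm (F (v 0 \<omega>)) \<le> norm (\<Sum>i<n. f (X (i + 1) \<omega>) + c)"
        using F_le[of \<omega>] unfolding real_norm_def by linarith
    qed
  qed measurable
  have int1: "integrable M (\<lambda>\<omega>. F (v 1 \<omega>))"
    using stationary_expectation(2)[OF X stat F, of 1] int0 by (simp add: v_def[abs_def])
  have E: "expectation (\<lambda>\<omega>. F (v 1 \<omega>)) = expectation (\<lambda>\<omega>. F (v 0 \<omega>))"
    using stationary_expectation(1)[OF X stat F, of 1] by (simp add: v_def[abs_def])
  have F_nn: "0 \<le> F x" for x
    unfolding F_def by (rule Max_ge) (auto intro!: image_eqI[of _ _ 0])
  have ev: "{\<omega>\<in>space M. \<exists>k\<le>n. c * real k < (\<Sum>i=1..k. f (X i \<omega>))} = {\<omega>\<in>space M. 0 < F (v 0 \<omega>)}"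
  proof -
    have "0 < F (v 0 \<omega>) \<longleftrightarrow> (\<exists>k\<le>n. c * real k < (\<Sum>i=1..k. f (X i \<omega>)))" for \<omega>
    proof -
      have "0 < F (v 0 \<omega>) \<longleftrightarrow> (\<exists>k\<le>n. 0 < (\<Sum>i<k. f (v 0 \<omega> i) - c))"
        unfolding F_def by (subst Max_gr_iff) auto
      also have "\<dots> \<longleftrightarrow> (\<exists>k\<le>n. 0 < (\<Sum>i<k. f (X (i + 1) \<omega>) - c))"
        using v0[of _ 0 \<omega>] by auto
      also have "\<dots> \<longleftrightarrow> (\<exists>k\<le>n. c * real k < (\<Sum>i=1..k. f (X i \<omega>)))"
      proof -
        have "(\<Sum>i<k. f (X (i + 1) \<omega>)) = (\<Sum>i=1..k. f (X i \<omega>))" for k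
          by (rule sum.reindex_bij_witness[of _ "\<lambda>i. i - 1" "\<lambda>i. i + 1"]) auto
        then show ?thesis by (simp add: sum_subtractf mult.commute)
      qed
      finally show ?thesis .
    qed
    then show ?thesis by auto
  qed
  \<comment> \<open>If \<open>0 < F (v 0 \<omega>)\<close>, the maximum is attained at some
    \<open>k \<ge> 1\<close>; after its first summand \<open>f (X 1 \<omega>) - c\<close> there
    remains a partial sum for the shifted block, which is at most \<open>F (v 1 \<omega>)\<close>.
    Otherwise the left side is at most \<open>0\<close>.\<close>
  have key: "F (v 0 \<omega>) - F (v 1 \<omega>) \<le> f (X 1 \<omega>) - c * indicator {\<omega>\<in>space M. 0 < F (v 0 \<omega>)} \<omega>"
    if "\<omega> \<in> space M" for \<omega>
  proof (cases "0 < F (v 0 \<omega>)")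
    case False
    then show ?thesis using F_nn[of "v 0 \<omega>"] F_nn[of "v 1 \<omega>"] nn[of "X 1 \<omega>"] by auto
  next
    case True
    have "F (v 0 \<omega>) \<in> (\<lambda>k. \<Sum>i<k. f (v 0 \<omega> i) - c) ` {..n}"
      unfolding F_def by (rule Max_in) auto
    then obtain k where k: "k \<le> n" "F (v 0 \<omega>) = (\<Sum>i<k. f (v 0 \<omega> i) - c)" by auto
    with True obtain j where j: "k = Suc j" by (cases k) auto
    have "F (v 0 \<omega>) = (\<Sum>i<Suc j. f (X (i + 1) \<omega>) - c)" using k v0[of k 0 \<omega>] j by simp
    also have "\<dots> = (f (X 1 \<omega>) - c) + (\<Sum>i<j. f (X (i + 1 + 1) \<omega>) - c)"
      by (subst sum.lessThan_Suc_shift) simp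
    also have "(\<Sum>i<j. f (X (i + 1 + 1) \<omega>) - c) = (\<Sum>i<j. f (v 1 \<omega> i) - c)"
      using v0[of j 1 \<omega>] k j by simp
    also have "\<dots> \<le> F (v 1 \<omega>)" unfolding F_def using k j by (intro Max_ge) auto
    finally show ?thesis using True that by simp
  qed
  have m[measurable]: "{\<omega>\<in>space M. 0 < F (v 0 \<omega>)} \<in> events" by measurable
  have "0 = expectation (\<lambda>\<omega>. F (v 0 \<omega>) - F (v 1 \<omega>))"
    using int0 int1 E by simp
  also have "\<dots> \<le> expectation (\<lambda>\<omega>. f (X 1 \<omega>) - c * indicator {\<omega>\<in>space M. 0 < F (v 0 \<omega>)} \<omega>)"
    using int0 int1 int m key
    by (intro integral_mono Bochner_Integration.integrable_diff integrable_mult_right) 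
       (auto simp: emeasure_eq_measure)
  also have "\<dots> = expectation (\<lambda>\<omega>. f (X 1 \<omega>)) - c * prob {\<omega>\<in>space M. 0 < F (v 0 \<omega>)}"
    using int m by (subst Bochner_Integration.integral_diff) (auto simp: emeasure_eq_measure)
  finally show ?thesis unfolding ev by simp
qed

lemma (in prob_space) maximal_inequality:
  fixes X :: "nat \<Rightarrow> 'a \<Rightarrow> real" and f :: "real \<Rightarrow> real"
  assumes X[measurable]: "\<And>k. X k \<in> borel_measurable M"
    and stat: "strictly_stationary M X"
    and f[measurable]: "f \<in> borel_measurable borel"
    and nn: "\<And>x. 0 \<le> f x" and int: "integrable M (\<lambda>\<omega>. f (X 1 \<omega>))" and c: "0 < c"
  shows "prob {\<omega>\<in>space M. \<exists>k. c * real k < (\<Sum>i=1..k. f (X i \<omega>))}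
      \<le> expectation (\<lambda>\<omega>. f (X 1 \<omega>)) / c"
proof -
  define A where "A n = {\<omega>\<in>space M. \<exists>k\<le>n. c * real k < (\<Sum>i=1..k. f (X i \<omega>))}" for n
  have "(\<lambda>n. prob (A n)) \<longlonglongrightarrow> prob (\<Union>n. A n)"
  proof (rule finite_Lim_measure_incseq)
    have "A n \<in> events" for n unfolding A_def by measurable
    then show "range A \<subseteq> events" by auto
    show "incseq A" unfolding A_def incseq_def by (auto intro: order_trans)
  qed
  moreover have "prob (A n) \<le> expectation (\<lambda>\<omega>. f (X 1 \<omega>)) / c" for n
    using maximal_inequality_finite[OF assms, of n] c by (simp add: A_def field_simps)
  ultimately have "prob (\<Union>n. A n) \<le> expectation (\<lambda>\<omega>. f (X 1 \<omega>)) / c"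
    using LIMSEQ_le_const2 by blast
  also have "(\<Union>n. A n) = {\<omega>\<in>space M. \<exists>k. c * real k < (\<Sum>i=1..k. f (X i \<omega>))}"
    unfolding A_def by auto
  finally show ?thesis .
qed

text \<open>By the maximal inequality, the functions that satisfy the strong law are closed under \<open>L\<^sup>1\<close> limits,
  so that it suffices to treat indicator functions; only for those mixing is used.\<close>

lemma (in prob_space) slln_limit:
  fixes X :: "nat \<Rightarrow> 'a \<Rightarrow> real" and f :: "real \<Rightarrow> real"
  assumes X[measurable]: "\<And>k. X k \<in> borel_measurable M"
    and stat: "strictly_stationary M X"
    and f[measurable]: "f \<in> borel_measurable borel" and s[measurable]: "\<And>k. s k \<in> borel_measurable borel"
    and int: "integrable M (\<lambda>\<omega>. f (X 1 \<omega>))" and ints: "\<And>k. integrable M (\<lambda>\<omega>. s k (X 1 \<omega>))"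
    and lim: "(\<lambda>k. expectation (\<lambda>\<omega>. \<bar>f (X 1 \<omega>) - s k (X 1 \<omega>)\<bar>)) \<longlonglongrightarrow> 0"
    and slln: "\<And>k. AE \<omega> in M. (\<lambda>n. (\<Sum>i=1..n. s k (X i \<omega>)) / real n) \<longlonglongrightarrow> expectation (\<lambda>\<omega>. s k (X 1 \<omega>))"
  shows "AE \<omega> in M. (\<lambda>n. (\<Sum>i=1..n. f (X i \<omega>)) / real n) \<longlonglongrightarrow> expectation (\<lambda>\<omega>. f (X 1 \<omega>))"
proof -
  define d where "d k = expectation (\<lambda>\<omega>. \<bar>f (X 1 \<omega>) - s k (X 1 \<omega>)\<bar>)" for k
  define B where "B c k = {\<omega>\<in>space M. \<exists>n. c * real n < (\<Sum>i=1..n. \<bar>f (X i \<omega>) - s k (X i \<omega>)\<bar>)}" for c k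
  have [measurable]: "B c k \<in> events" for c k unfolding B_def by measurable
  have PB: "prob (B c k) \<le> d k / c" if "0 < c" for c k
    unfolding B_def d_def
  proof (rule maximal_inequality[OF X stat _ _ _ that])
    show "integrable M (\<lambda>\<omega>. \<bar>f (X 1 \<omega>) - s k (X 1 \<omega>)\<bar>)"
      by (rule integrable_abs[OF Bochner_Integration.integrable_diff[OF int ints]])
  qed simp_all
  \<comment> \<open>The intersection over \<open>k \<ge> k0\<close> lies in each of these
    \<open>B c k\<close>, so its probability is at most \<open>d k / c\<close> for all of them and
    hence zero.\<close>
  have AEB: "AE \<omega> in M. \<exists>k\<ge>k0. \<omega> \<notin> B c k" if c: "0 < c" for c k0
  proof -
    have "prob (\<Inter>k\<in>{k0..}. B c k) \<le> d k / c" if "k0 \<le> k" for k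
    proof -
      have "prob (\<Inter>k\<in>{k0..}. B c k) \<le> prob (B c k)"
        using that by (intro finite_measure_mono) auto
      then show ?thesis using PB[OF c, of k] by linarith
    qed
    moreover have "(\<lambda>k. d k / c) \<longlonglongrightarrow> 0 / c"
      using lim c unfolding d_def by (intro tendsto_intros) auto
    ultimately have "prob (\<Inter>k\<in>{k0..}. B c k) \<le> 0"
      using LIMSEQ_le_const[of "\<lambda>k. d k / c" 0] by auto
    then have "prob (\<Inter>k\<in>{k0..}. B c k) = 0" by (simp add: measure_le_0_iff)
    moreover have "(\<Inter>k\<in>{k0..}. B c k) \<in> events"
      by (rule sets.countable_INT') auto
    ultimately have "AE \<omega> in M. \<omega> \<notin> (\<Inter>k\<in>{k0..}. B c k)"
      by (intro AE_not_in null_setsI) (auto simp: emeasure_eq_measure)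
    then show ?thesis by eventually_elim auto
  qed
  have "AE \<omega> in M. \<forall>m k0. \<exists>k\<ge>k0. \<omega> \<notin> B (inverse (real (Suc m))) k"
    unfolding AE_all_countable by (intro allI AEB) auto
  moreover have "AE \<omega> in M. \<forall>k. (\<lambda>n. (\<Sum>i=1..n. s k (X i \<omega>)) / real n) \<longlonglongrightarrow> expectation (\<lambda>\<omega>. s k (X 1 \<omega>))"
    unfolding AE_all_countable by (intro allI slln)
  ultimately show ?thesis using AE_space
  proof eventually_elim
    case (elim \<omega>)
    show ?case
    proof (rule LIMSEQ_I)
      fix r :: real assume r: "0 < r"
      obtain m where m: "inverse (real (Suc m)) < r / 4"
        using reals_Archimedean[of "r / 4"] r by auto
      have "\<forall>\<^sub>F k in sequentially. d k < r / 4"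
        using lim r unfolding d_def[symmetric] by (intro order_tendstoD(2)[of _ 0]) auto
      then obtain k0 where k0: "\<And>k. k0 \<le> k \<Longrightarrow> d k < r / 4"
        unfolding eventually_sequentially by auto
      \<comment> \<open>One approximant serves for all \<open>n\<close>: outside this
        \<open>B\<close> the averages of \<open>f\<close> and \<open>s k\<close> differ by less than
        \<open>r / 4\<close> for every positive \<open>n\<close>, so only the average of
        \<open>s k\<close> has to be controlled by taking \<open>n\<close> large.\<close>
      obtain k where k: "k0 \<le> k" "\<omega> \<notin> B (inverse (real (Suc m))) k" using elim(1) by blast
      have dk: "\<bar>expectation (\<lambda>\<omega>. s k (X 1 \<omega>)) - expectation (\<lambda>\<omega>. f (X 1 \<omega>))\<bar> < r / 4"
      proof -
        have "\<bar>expectation (\<lambda>\<omega>. f (X 1 \<omega>) - s k (X 1 \<omega>))\<bar> \<le> d k"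
          unfolding d_def by (rule integral_abs_bound)
        then show ?thesis using k0[OF k(1)] int ints by (simp add: abs_minus_commute)
      qed
      obtain n0 where n0: "\<And>n. n0 \<le> n \<Longrightarrow>
          \<bar>(\<Sum>i=1..n. s k (X i \<omega>)) / real n - expectation (\<lambda>\<omega>. s k (X 1 \<omega>))\<bar> < r / 4"
        using LIMSEQ_D[OF elim(2)[rule_format, of k], of "r / 4"] r by auto
      have "\<bar>(\<Sum>i=1..n. f (X i \<omega>)) / real n - expectation (\<lambda>\<omega>. f (X 1 \<omega>))\<bar> < r" if n: "Suc n0 \<le> n" for n
      proof -
        have "(\<Sum>i=1..n. \<bar>f (X i \<omega>) - s k (X i \<omega>)\<bar>) \<le> inverse (real (Suc m)) * real n"
          using k(2) elim(3) unfolding B_def by (auto simp: not_less)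
        then have "\<bar>(\<Sum>i=1..n. f (X i \<omega>) - s k (X i \<omega>))\<bar> \<le> inverse (real (Suc m)) * real n"
          by (rule order_trans[OF sum_abs])
        then have "\<bar>(\<Sum>i=1..n. f (X i \<omega>) - s k (X i \<omega>)) / real n\<bar> \<le> inverse (real (Suc m))"
          using n by (simp add: field_simps)
        then have "\<bar>(\<Sum>i=1..n. f (X i \<omega>)) / real n - (\<Sum>i=1..n. s k (X i \<omega>)) / real n\<bar> < r / 4"
          using m by (simp add: sum_subtractf diff_divide_distrib)
        then show ?thesis using n0[of n] dk n r by linarith
      qed
      then show "\<exists>no. \<forall>n\<ge>no. norm ((\<Sum>i=1..n. f (X i \<omega>)) / real n - expectation (\<lambda>\<omega>. f (X 1 \<omega>))) < r"
        by auto
    qed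
  qed
qed

text \<open>Induction over the functions integrable under the law of \<open>X 1\<close>: scaled
  indicators, sums, and limits of functions bounded by \<open>2 * \<bar>f\<bar>\<close>, for which
  dominated convergence supplies the convergence in mean that \<open>slln_limit\<close> asks
  for.\<close>

lemma (in prob_space) slln:
  fixes X :: "nat \<Rightarrow> 'a \<Rightarrow> real" and f :: "real \<Rightarrow> real"
  assumes X[measurable]: "\<And>k. X k \<in> borel_measurable M"
    and stat: "strictly_stationary M X"
    and sm: "summable (alpha_mix M X)"
    and f: "f \<in> borel_measurable borel" and int: "integrable M (\<lambda>\<omega>. f (X 1 \<omega>))"
  shows "AE \<omega> in M. (\<lambda>n. (\<Sum>i=1..n. f (X i \<omega>)) / real n) \<longlonglongrightarrow> expectation (\<lambda>\<omega>. f (X 1 \<omega>))"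
proof -
  define D where "D = distr M borel (X 1)"
  have iff: "integrable D g \<longleftrightarrow> integrable M (\<lambda>\<omega>. g (X 1 \<omega>))" if "g \<in> borel_measurable borel" for g :: "real \<Rightarrow> real"
    unfolding D_def using that by (simp add: integrable_distr_eq)
  have meas: "g \<in> borel_measurable borel" if "integrable D g" for g :: "real \<Rightarrow> real"
    using borel_measurable_integrable[OF that] by (simp add: D_def)
  have "integrable D f" using int iff[OF f] by simp
  then show ?thesis
  proof (induction f rule: integrable_induct)
    case (base A c)
    then have A: "A \<in> sets borel" by (simp add: D_def)
    show ?case
    proof (rule eventually_mono[OF slln_indicator[OF X stat sm A]])
      fix \<omega>
      assume elim: "(\<lambda>n. (\<Sum>i=1..n. indicat_real A (X i \<omega>)) / real n)
          \<longlonglongrightarrow> expectation (\<lambda>\<omega>. indicat_real A (X 1 \<omega>))"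
      have "(\<lambda>n. (\<Sum>i=1..n. indicator A (X i \<omega>)) / real n * c) \<longlonglongrightarrow> expectation (\<lambda>\<omega>. indicator A (X 1 \<omega>)) * c"
        by (intro tendsto_intros elim)
      then show "(\<lambda>n. (\<Sum>i=1..n. indicat_real A (X i \<omega>) *\<^sub>R c) / real n)
          \<longlonglongrightarrow> expectation (\<lambda>\<omega>. indicat_real A (X 1 \<omega>) *\<^sub>R c)"
        by (simp add: sum_distrib_right)
    qed
  next
    case (add f g)
    have int: "integrable M (\<lambda>\<omega>. f (X 1 \<omega>))" "integrable M (\<lambda>\<omega>. g (X 1 \<omega>))"
      using add.hyps iff[OF meas[OF add.hyps(1)]] iff[OF meas[OF add.hyps(2)]] by simp_all
    show ?case
    proof (rule eventually_mono[OF eventually_conj[OF add.IH]])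
      fix \<omega>
      assume "(\<lambda>n. (\<Sum>i=1..n. f (X i \<omega>)) / real n) \<longlonglongrightarrow> expectation (\<lambda>\<omega>. f (X 1 \<omega>)) \<and>
        (\<lambda>n. (\<Sum>i=1..n. g (X i \<omega>)) / real n) \<longlonglongrightarrow> expectation (\<lambda>\<omega>. g (X 1 \<omega>))"
      then show "(\<lambda>n. (\<Sum>i=1..n. f (X i \<omega>) + g (X i \<omega>)) / real n) \<longlonglongrightarrow> expectation (\<lambda>\<omega>. f (X 1 \<omega>) + g (X 1 \<omega>))"
        using int by (auto simp: sum.distrib add_divide_distrib intro!: tendsto_add)
    qed
  next
    case (lim f s)
    note [measurable] = meas[OF lim.hyps(1)] meas[OF lim.hyps(4)]
    have int: "integrable M (\<lambda>\<omega>. f (X 1 \<omega>))" "\<And>k. integrable M (\<lambda>\<omega>. s k (X 1 \<omega>))"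
      using lim.hyps(1,4) iff[OF meas[OF lim.hyps(1)]] iff[OF meas[OF lim.hyps(4)]] by simp_all
    have "(\<lambda>k. expectation (\<lambda>\<omega>. \<bar>f (X 1 \<omega>) - s k (X 1 \<omega>)\<bar>)) \<longlonglongrightarrow> expectation (\<lambda>\<omega>. 0)"
    proof (rule integral_dominated_convergence)
      show "integrable M (\<lambda>\<omega>. 3 * \<bar>f (X 1 \<omega>)\<bar>)" using int by auto
      show "AE \<omega> in M. (\<lambda>k. \<bar>f (X 1 \<omega>) - s k (X 1 \<omega>)\<bar>) \<longlonglongrightarrow> 0"
      proof (rule AE_I2)
        fix \<omega>
        have "(\<lambda>k. \<bar>f (X 1 \<omega>) - s k (X 1 \<omega>)\<bar>) \<longlonglongrightarrow> \<bar>f (X 1 \<omega>) - f (X 1 \<omega>)\<bar>"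
          by (intro tendsto_intros lim.hyps(2)) (simp add: D_def)
        then show "(\<lambda>k. \<bar>f (X 1 \<omega>) - s k (X 1 \<omega>)\<bar>) \<longlonglongrightarrow> 0" by simp
      qed
      show "AE \<omega> in M. norm \<bar>f (X 1 \<omega>) - s k (X 1 \<omega>)\<bar> \<le> 3 * \<bar>f (X 1 \<omega>)\<bar>" for k
      proof (rule AE_I2)
        fix \<omega>
        have "\<bar>s k (X 1 \<omega>)\<bar> \<le> 2 * \<bar>f (X 1 \<omega>)\<bar>"
          using lim.hyps(3)[of "X 1 \<omega>" k] by (simp add: D_def)
        then show "norm \<bar>f (X 1 \<omega>) - s k (X 1 \<omega>)\<bar> \<le> 3 * \<bar>f (X 1 \<omega>)\<bar>" by simp
      qed
    qed measurable
    then show ?case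
      using slln_limit[OF X stat _ _ int _ lim.IH] by simp
  qed
qed

lemma (in prob_space) summable_alpha_mix:
  assumes "summable (\<lambda>n. real n * alpha_mix M X n)"
  shows "summable (alpha_mix M X)"
proof (rule summable_comparison_test'[OF assms, of 1])
  fix n :: nat assume "1 \<le> n"
  then show "norm (alpha_mix M X n) \<le> real n * alpha_mix M X n"
    using alpha_mix_nonneg[of X n] mult_right_mono[of 1 "real n" "alpha_mix M X n"] by simp
qed

section \<open>Uniform convergence on grids\<close>

text \<open>Only values at the points \<open>k / n\<close> are compared, uniformly in
  \<open>k\<close>. This avoids interpolating discrete sequences and putting a topology on path
  space, and it is stable under the operations from which both statistics are built.\<close>

definition grid_conv :: "(nat \<Rightarrow> nat \<Rightarrow> real) \<Rightarrow> (real \<Rightarrow> real) \<Rightarrow> bool" where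
  "grid_conv a g \<longleftrightarrow> (\<forall>e>0. \<forall>\<^sub>F n in sequentially. \<forall>k\<le>n. \<bar>a n k - g (real k / real n)\<bar> < e)"

lemma grid_convD:
  assumes "grid_conv a g" "0 < e"
  shows "\<forall>\<^sub>F n in sequentially. \<forall>k\<le>n. \<bar>a n k - g (real k / real n)\<bar> < e"
  using assms unfolding grid_conv_def by blast

lemma grid_convI':
  assumes "\<And>e. 0 < e \<Longrightarrow> \<forall>\<^sub>F n in sequentially. \<forall>k\<le>n. \<bar>a n k - g (real k / real n)\<bar> \<le> c * e" "0 \<le> c"
  shows "grid_conv a g"
  unfolding grid_conv_def
proof (intro allI impI)
  fix e :: real assume e: "0 < e"
  have "c * (e / (c + 1)) < e"
    using e assms(2) by (simp add: field_simps)
  with assms(1)[of "e / (c + 1)"] e assms(2)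
  show "\<forall>\<^sub>F n in sequentially. \<forall>k\<le>n. \<bar>a n k - g (real k / real n)\<bar> < e"
    by (auto elim!: eventually_mono)
qed

lemma grid_conv_cong:
  assumes "grid_conv a g" "\<forall>\<^sub>F n in sequentially. \<forall>k\<le>n. b n k = a n k"
    "\<And>t. 0 \<le> t \<Longrightarrow> t \<le> 1 \<Longrightarrow> h t = g t"
  shows "grid_conv b h"
  unfolding grid_conv_def
proof (intro allI impI)
  fix e :: real assume e: "0 < e"
  from grid_convD[OF assms(1) e] assms(2)
  show "\<forall>\<^sub>F n in sequentially. \<forall>k\<le>n. \<bar>b n k - h (real k / real n)\<bar> < e"
  proof eventually_elim
    case (elim n)
    show ?case
    proof (intro allI impI)
      fix k assume k: "k \<le> n"
      then have "h (real k / real n) = g (real k / real n)"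
        by (intro assms(3)) (auto simp: divide_le_eq_1)
      then show "\<bar>b n k - h (real k / real n)\<bar> < e" using elim k by simp
    qed
  qed
qed

lemma grid_conv_add:
  assumes "grid_conv a g" "grid_conv b h"
  shows "grid_conv (\<lambda>n k. a n k + b n k) (\<lambda>t. g t + h t)"
proof (rule grid_convI')
  fix e :: real assume e: "0 < e"
  from grid_convD[OF assms(1) e] grid_convD[OF assms(2) e]
  show "\<forall>\<^sub>F n in sequentially. \<forall>k\<le>n. \<bar>a n k + b n k - (g (real k / real n) + h (real k / real n))\<bar> \<le> 2 * e"
  proof eventually_elim
    case (elim n)
    show ?case
    proof (intro allI impI)
      fix k assume "k \<le> n"
      with elim show "\<bar>a n k + b n k - (g (real k / real n) + h (real k / real n))\<bar> \<le> 2 * e"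
        by (smt (verit))
    qed
  qed
qed simp

lemma grid_conv_mult:
  assumes "grid_conv a g" "grid_conv b h"
    and g: "\<And>t. 0 \<le> t \<Longrightarrow> t \<le> 1 \<Longrightarrow> \<bar>g t\<bar> \<le> G" and h: "\<And>t. 0 \<le> t \<Longrightarrow> t \<le> 1 \<Longrightarrow> \<bar>h t\<bar> \<le> H"
  shows "grid_conv (\<lambda>n k. a n k * b n k) (\<lambda>t. g t * h t)"
proof (rule grid_convI')
  have GH: "0 \<le> G" "0 \<le> H" using g[of 0] h[of 0] by auto
  then show "0 \<le> G + H + 1" by simp
  fix e :: real assume e: "0 < e"
  \<comment> \<open>The cap at \<open>1\<close> makes the product of the two errors at most one
    error, so that the total stays linear in \<open>e\<close>.\<close>
  define d where "d = min e 1"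
  have d: "0 < d" "d \<le> 1" "d \<le> e" using e by (auto simp: d_def)
  from grid_convD[OF assms(1) d(1)] grid_convD[OF assms(2) d(1)]
  show "\<forall>\<^sub>F n in sequentially. \<forall>k\<le>n. \<bar>a n k * b n k - g (real k / real n) * h (real k / real n)\<bar> \<le> (G + H + 1) * e"
  proof eventually_elim
    case (elim n)
    show ?case
    proof (intro allI impI)
      fix k assume k: "k \<le> n"
      define t where "t = real k / real n"
      have t: "0 \<le> t" "t \<le> 1" using k by (auto simp: t_def divide_le_eq_1)
      have ab: "\<bar>a n k - g t\<bar> \<le> d" "\<bar>b n k - h t\<bar> \<le> d"
        using elim k by (auto simp: t_def less_imp_le)
      have "a n k * b n k - g t * h t = (a n k - g t) * (b n k - h t) + (a n k - g t) * h t + g t * (b n k - h t)"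
        by (simp add: algebra_simps)
      also have "\<bar>\<dots>\<bar> \<le> \<bar>a n k - g t\<bar> * \<bar>b n k - h t\<bar> + \<bar>a n k - g t\<bar> * \<bar>h t\<bar> + \<bar>g t\<bar> * \<bar>b n k - h t\<bar>"
        unfolding abs_mult[symmetric] by linarith
      also have "\<dots> \<le> d * 1 + d * H + G * d"
        using ab g[OF t] h[OF t] d GH by (intro add_mono mult_mono) auto
      also have "\<dots> = (G + H + 1) * d" by (simp add: algebra_simps)
      also have "\<dots> \<le> (G + H + 1) * e" using d GH by (intro mult_left_mono) auto
      finally show "\<bar>a n k * b n k - g (real k / real n) * h (real k / real n)\<bar> \<le> (G + H + 1) * e"
        by (simp add: t_def)
    qed
  qed
qed

lemma grid_conv_inverse:
  assumes "grid_conv a g" and g: "\<And>t. 0 \<le> t \<Longrightarrow> t \<le> 1 \<Longrightarrow> c \<le> g t" and c: "0 < c"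
  shows "grid_conv (\<lambda>n k. inverse (a n k)) (\<lambda>t. inverse (g t))"
proof (rule grid_convI')
  show "0 \<le> 2 / (c * c)" using c by simp
  fix e :: real assume e: "0 < e"
  \<comment> \<open>An error of at most \<open>c / 2\<close> keeps \<open>a n k\<close> above
    \<open>c / 2\<close>, whence the factor \<open>2 / (c * c)\<close>.\<close>
  define d where "d = min e (c / 2)"
  have d: "0 < d" "d \<le> c / 2" "d \<le> e" using e c by (auto simp: d_def)
  from grid_convD[OF assms(1) d(1)]
  show "\<forall>\<^sub>F n in sequentially. \<forall>k\<le>n. \<bar>inverse (a n k) - inverse (g (real k / real n))\<bar> \<le> (2 / (c * c)) * e"
  proof eventually_elim
    case (elim n)
    show ?case
    proof (intro allI impI)
      fix k assume k: "k \<le> n"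
      define t where "t = real k / real n"
      have t: "0 \<le> t" "t \<le> 1" using k by (auto simp: t_def divide_le_eq_1)
      have ab: "\<bar>a n k - g t\<bar> \<le> d"
        using elim k by (auto simp: t_def less_imp_le)
      have gt: "c \<le> g t" using g[OF t] .
      have at: "c / 2 \<le> a n k" using ab gt d by linarith
      have pos: "0 < a n k" "0 < g t" using at gt c by linarith+
      have "inverse (a n k) - inverse (g t) = - ((a n k - g t) / (a n k * g t))"
        using pos by (simp add: diff_divide_distrib inverse_eq_divide)
      then have "\<bar>inverse (a n k) - inverse (g t)\<bar> = \<bar>a n k - g t\<bar> / (a n k * g t)"
        using pos by (simp add: abs_divide)
      also have "\<dots> \<le> e / ((c / 2) * c)"
        using ab d at gt c by (intro frac_le mult_mono) auto
      also have "\<dots> = (2 / (c * c)) * e" by simp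
      finally show "\<bar>inverse (a n k) - inverse (g (real k / real n))\<bar> \<le> (2 / (c * c)) * e"
        by (simp add: t_def)
    qed
  qed
qed

lemma grid_conv_abs:
  assumes "grid_conv a g" shows "grid_conv (\<lambda>n k. \<bar>a n k\<bar>) (\<lambda>t. \<bar>g t\<bar>)"
  unfolding grid_conv_def
proof (intro allI impI)
  fix e :: real assume e: "0 < e"
  from grid_convD[OF assms e]
  show "\<forall>\<^sub>F n in sequentially. \<forall>k\<le>n. \<bar>\<bar>a n k\<bar> - \<bar>g (real k / real n)\<bar>\<bar> < e"
    by (auto elim!: eventually_mono intro: le_less_trans[OF abs_triangle_ineq3])
qed

lemma grid_conv_minus:
  assumes "grid_conv a g" shows "grid_conv (\<lambda>n k. - a n k) (\<lambda>t. - g t)"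
proof -
  have "\<bar>- x - - y\<bar> = \<bar>x - y\<bar>" for x y :: real by simp
  then show ?thesis using assms unfolding grid_conv_def by simp
qed

lemma grid_conv_diff:
  assumes "grid_conv a g" "grid_conv b h"
  shows "grid_conv (\<lambda>n k. a n k - b n k) (\<lambda>t. g t - h t)"
  using grid_conv_add[OF assms(1) grid_conv_minus[OF assms(2)]] by simp

lemma grid_conv_reflect:
  assumes "grid_conv a g" shows "grid_conv (\<lambda>n k. a n (n - k)) (\<lambda>t. g (1 - t))"
  unfolding grid_conv_def
proof (intro allI impI)
  fix e :: real assume e: "0 < e"
  from grid_convD[OF assms e] eventually_gt_at_top[of 0]
  show "\<forall>\<^sub>F n in sequentially. \<forall>k\<le>n. \<bar>a n (n - k) - g (1 - real k / real n)\<bar> < e"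
  proof eventually_elim
    case (elim n)
    show ?case
    proof (intro allI impI)
      fix k assume k: "k \<le> n"
      have "real (n - k) / real n = 1 - real k / real n" using k elim(2) by (simp add: of_nat_diff field_simps)
      then show "\<bar>a n (n - k) - g (1 - real k / real n)\<bar> < e"
        using elim(1)[rule_format, of "n - k"] by simp
    qed
  qed
qed

lemma grid_conv_last:
  assumes "grid_conv a g" shows "grid_conv (\<lambda>n k. a n n) (\<lambda>t. g 1)"
  unfolding grid_conv_def
proof (intro allI impI)
  fix e :: real assume e: "0 < e"
  from grid_convD[OF assms e] eventually_gt_at_top[of 0]
  show "\<forall>\<^sub>F n in sequentially. \<forall>k\<le>n. \<bar>a n n - g 1\<bar> < e"
    by eventually_elim (metis div_self of_nat_0_less_iff order_less_irrefl order_refl)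
qed

lemma grid_conv_grid: "grid_conv (\<lambda>n k. g (real k / real n)) g"
  unfolding grid_conv_def by simp

text \<open>By uniform continuity of \<open>f\<close> on the compact interval. The time change uses
  it twice, once for the inverse of the variance clock and once for the path itself.\<close>

lemma grid_conv_compose:
  assumes "grid_conv a g" and f: "continuous_on {0..1} f"
    and g: "\<And>t. 0 \<le> t \<Longrightarrow> t \<le> 1 \<Longrightarrow> g t \<in> {0..1}" and a: "\<And>n k. k \<le> n \<Longrightarrow> a n k \<in> {0..1}"
  shows "grid_conv (\<lambda>n k. f (a n k)) (\<lambda>t. f (g t))"
  unfolding grid_conv_def
proof (intro allI impI)
  fix e :: real assume e: "0 < e"
  have "uniformly_continuous_on {0..1} f" using f by (intro compact_uniformly_continuous) auto
  then obtain d where d: "0 < d" "\<And>x y. x \<in> {0..1} \<Longrightarrow> y \<in> {0..1} \<Longrightarrow> dist y x < d \<Longrightarrow> dist (f y) (f x) < e"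
    using e unfolding uniformly_continuous_on_def by metis
  from grid_convD[OF assms(1) d(1)]
  show "\<forall>\<^sub>F n in sequentially. \<forall>k\<le>n. \<bar>f (a n k) - f (g (real k / real n))\<bar> < e"
  proof eventually_elim
    case (elim n)
    show ?case
    proof (intro allI impI)
      fix k assume k: "k \<le> n"
      have "real k / real n \<le> 1" using k by (auto simp: divide_le_eq_1)
      then show "\<bar>f (a n k) - f (g (real k / real n))\<bar> < e"
        using d(2)[OF g[of "real k / real n"] a[OF k]] elim k by (simp add: dist_real_def)
    qed
  qed
qed

lemma continuous_on_interval_modulus:
  fixes f :: "real \<Rightarrow> real"
  assumes "continuous_on {0..1} f" "0 < e"
  shows "\<forall>\<^sub>F n in sequentially. \<forall>x\<in>{0..1}. \<forall>y\<in>{0..1}. \<bar>x - y\<bar> \<le> 1 / real n \<longrightarrow> \<bar>f x - f y\<bar> < e"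
proof -
  have "uniformly_continuous_on {0..1} f" using assms by (intro compact_uniformly_continuous) auto
  then obtain d where d: "0 < d" "\<And>x y. x \<in> {0..1} \<Longrightarrow> y \<in> {0..1} \<Longrightarrow> dist y x < d \<Longrightarrow> dist (f y) (f x) < e"
    using assms(2) unfolding uniformly_continuous_on_def by metis
  have "(\<lambda>n. 1 / real n) \<longlonglongrightarrow> 0" by (rule lim_1_over_n)
  then have "\<forall>\<^sub>F n in sequentially. 1 / real n < d" using d(1) by (rule order_tendstoD)
  then show ?thesis
  proof eventually_elim
    case (elim n)
    show ?case
    proof (intro ballI impI)
      fix x y :: real assume "x \<in> {0..1}" "y \<in> {0..1}" "\<bar>x - y\<bar> \<le> 1 / real n"
      then show "\<bar>f x - f y\<bar> < e" using d(2)[of y x] elim by (simp add: dist_real_def)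
    qed
  qed
qed

lemma continuous_on_interval_bounded:
  fixes f :: "real \<Rightarrow> real"
  assumes "continuous_on {0..1} f"
  obtains B where "0 < B" "\<And>t. 0 \<le> t \<Longrightarrow> t \<le> 1 \<Longrightarrow> \<bar>f t\<bar> \<le> B"
proof -
  have "bounded (f ` {0..1})"
    using assms by (intro compact_imp_bounded compact_continuous_image) auto
  then show ?thesis using that unfolding bounded_pos by auto
qed

text \<open>The error \<open>e i\<close> may depend on the cell, so that the few cells containing a
  jump of \<open>h\<close> can be charged a large error.\<close>

lemma riemann_sum_bound:
  fixes h :: "real \<Rightarrow> real"
  assumes int: "h integrable_on {0..1}" and n: "0 < n" and k: "k \<le> n"
    and e: "\<And>i s. 1 \<le> i \<Longrightarrow> i \<le> k \<Longrightarrow> s \<in> {(real i - 1) / real n..real i / real n} \<Longrightarrow> \<bar>h (real i / real n) - h s\<bar> \<le> e i"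
  shows "\<bar>(\<Sum>i=1..k. h (real i / real n)) / real n - integral {0..real k / real n} h\<bar> \<le> (\<Sum>i=1..k. e i) / real n"
  using k e
proof (induction k)
  case 0
  then show ?case by simp
next
  case (Suc k)
  let ?a = "real k / real n" and ?b = "real (Suc k) / real n"
  have ab: "0 \<le> ?a" "?a \<le> ?b" "?b \<le> 1" using Suc.prems(1) n by (auto simp: divide_right_mono divide_le_eq_1)
  have int_ab: "h integrable_on {?a..?b}"
    using ab by (intro integrable_on_subinterval[OF int]) auto
  have IH: "\<bar>(\<Sum>i=1..k. h (real i / real n)) / real n - integral {0..?a} h\<bar> \<le> (\<Sum>i=1..k. e i) / real n"
    using Suc.prems by (intro Suc.IH) auto
  have comb: "integral {0..?b} h = integral {0..?a} h + integral {?a..?b} h"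
    using ab by (intro Henstock_Kurzweil_Integration.integral_combine[symmetric] integrable_on_subinterval[OF int]) auto
  have len: "?b - ?a = 1 / real n" using n by (simp add: field_simps)
  have "\<bar>h ?b / real n - integral {?a..?b} h\<bar> \<le> e (Suc k) / real n"
  proof -
    have "integral {?a..?b} (\<lambda>s. h ?b - h s) = h ?b * (1 / real n) - integral {?a..?b} h"
      using int_ab ab len by (subst Henstock_Kurzweil_Integration.integral_diff) (auto simp: mult.commute)
    moreover have "norm (integral {?a..?b} (\<lambda>s. h ?b - h s)) \<le> integral {?a..?b} (\<lambda>s. e (Suc k))"
    proof (rule integral_norm_bound_integral)
      show "(\<lambda>s. h ?b - h s) integrable_on {?a..?b}"
        using int_ab by (intro integrable_diff) auto
      fix s assume "s \<in> {?a..?b}"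
      then show "norm (h ?b - h s) \<le> e (Suc k)"
        using Suc.prems(2)[of "Suc k" s] by simp
    qed auto
    moreover have "integral {?a..?b} (\<lambda>s. e (Suc k)) = e (Suc k) / real n"
      using ab len by simp
    ultimately show ?thesis by simp
  qed
  moreover have "(\<Sum>i=1..Suc k. h (real i / real n)) / real n = (\<Sum>i=1..k. h (real i / real n)) / real n + h ?b / real n"
    by (simp add: add_divide_distrib)
  moreover have "(\<Sum>i=1..Suc k. e i) / real n = (\<Sum>i=1..k. e i) / real n + e (Suc k) / real n"
    by (simp add: add_divide_distrib)
  ultimately show ?case using IH comb by linarith
qed

lemma grid_conv_sum_tendsto_integral:
  assumes a: "grid_conv a g" and g: "continuous_on {0..1} g"
  shows "(\<lambda>n. (\<Sum>k=1..n. a n k) / real n) \<longlonglongrightarrow> integral {0..1} g"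
proof (rule LIMSEQ_I)
  fix r :: real assume r: "0 < r"
  then have r3: "0 < r / 3" by simp
  from grid_convD[OF a r3] continuous_on_interval_modulus[OF g r3] eventually_gt_at_top[of 0]
  have "\<forall>\<^sub>F n in sequentially. norm ((\<Sum>k=1..n. a n k) / real n - integral {0..1} g) < r"
  proof eventually_elim
    case (elim n)
    have "\<bar>(\<Sum>i=1..n. g (real i / real n)) / real n - integral {0..real n / real n} g\<bar> \<le> (\<Sum>i=1..n. r / 3) / real n"
    proof (rule riemann_sum_bound)
      show "g integrable_on {0..1}" using g by (rule integrable_continuous_interval)
      fix i s assume i: "1 \<le> i" "i \<le> n" and s: "s \<in> {(real i - 1) / real n..real i / real n}"
      have "0 \<le> (real i - 1) / real n" "real i / real n \<le> 1" using i by (auto simp: divide_le_eq_1)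
      moreover have "real i / real n - s \<le> 1 / real n" using s by (auto simp: diff_divide_distrib)
      ultimately show "\<bar>g (real i / real n) - g s\<bar> \<le> r / 3"
        using elim(2)[rule_format, of "real i / real n" s] s by auto
    qed (use elim in auto)
    then have 1: "\<bar>(\<Sum>i=1..n. g (real i / real n)) / real n - integral {0..1} g\<bar> \<le> r / 3"
      using elim(3) by simp
    have "\<bar>(\<Sum>k=1..n. a n k) - (\<Sum>i=1..n. g (real i / real n))\<bar> \<le> (\<Sum>k=1..n. r / 3)"
      unfolding sum_subtractf[symmetric] using elim(1)
      by (intro order_trans[OF sum_abs sum_mono]) (auto simp: less_imp_le)
    then have "\<bar>(\<Sum>k=1..n. a n k) / real n - (\<Sum>i=1..n. g (real i / real n)) / real n\<bar> \<le> r / 3"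
      using elim(3) by (simp add: diff_divide_distrib[symmetric] field_simps)
    with 1 r show ?case unfolding real_norm_def by linarith
  qed
  then show "\<exists>no. \<forall>n\<ge>no. norm ((\<Sum>k=1..n. a n k) / real n - integral {0..1} g) < r"
    unfolding eventually_sequentially .
qed

text \<open>Every grid value is close to a value of \<open>g\<close>, and every \<open>t\<close> has
  a grid point within \<open>1 / n\<close>. The inserted \<open>0\<close> is harmless because
  \<open>g\<close> is nonnegative.\<close>

lemma grid_conv_Max_tendsto_SUP:
  assumes a: "grid_conv a g" and g: "continuous_on {0..1} g" and nn: "\<And>t. 0 \<le> t \<Longrightarrow> t \<le> 1 \<Longrightarrow> 0 \<le> g t"
  shows "(\<lambda>n. Max (insert 0 {a n k |k. 1 \<le> k \<and> k \<le> n})) \<longlonglongrightarrow> (SUP t\<in>{0..1}. g t)"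
proof (rule LIMSEQ_I)
  fix r :: real assume r: "0 < r"
  then have r3: "0 < r / 3" by simp
  obtain B where B: "\<And>t. 0 \<le> t \<Longrightarrow> t \<le> 1 \<Longrightarrow> \<bar>g t\<bar> \<le> B" using continuous_on_interval_bounded[OF g] by blast
  have bdd: "bdd_above (g ` {0..1})" using B by (intro bdd_aboveI2[of _ _ B]) (auto simp: abs_le_iff)
  have up: "g t \<le> (SUP t\<in>{0..1}. g t)" if "0 \<le> t" "t \<le> 1" for t
    using that by (intro cSUP_upper bdd) auto
  from grid_convD[OF a r3] continuous_on_interval_modulus[OF g r3] eventually_gt_at_top[of 0]
  have "\<forall>\<^sub>F n in sequentially. norm (Max (insert 0 {a n k |k. 1 \<le> k \<and> k \<le> n}) - (SUP t\<in>{0..1}. g t)) < r"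
  proof eventually_elim
    case (elim n)
    have fin: "finite (insert 0 {a n k |k. 1 \<le> k \<and> k \<le> n})" by simp
    have "Max (insert 0 {a n k |k. 1 \<le> k \<and> k \<le> n}) \<le> (SUP t\<in>{0..1}. g t) + r / 3"
    proof (rule Max.boundedI[OF fin])
      fix x assume "x \<in> insert 0 {a n k |k. 1 \<le> k \<and> k \<le> n}"
      then consider "x = 0" | k where "1 \<le> k" "k \<le> n" "x = a n k" by blast
      then show "x \<le> (SUP t\<in>{0..1}. g t) + r / 3"
      proof cases
        case 1 then show ?thesis using up[of 0] nn[of 0] r by linarith
      next
        case 2
        then have "real k / real n \<le> 1" by (simp add: divide_le_eq_1)
        moreover have "\<bar>a n k - g (real k / real n)\<bar> < r / 3" using elim(1) 2 by blast
        ultimately show ?thesis using up[of "real k / real n"] 2(3) by (smt (verit) divide_nonneg_nonneg of_nat_0_le_iff)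
      qed
    qed simp
    moreover have "(SUP t\<in>{0..1}. g t) \<le> Max (insert 0 {a n k |k. 1 \<le> k \<and> k \<le> n}) + 2 * (r / 3)"
    proof (rule cSUP_least)
      fix t :: real assume t: "t \<in> {0..1}"
      \<comment> \<open>The index \<open>0\<close> does not occur in the maximum;
        \<open>max 1\<close> replaces it by \<open>1\<close>, at a distance of at most
        \<open>1 / n\<close>.\<close>
      define k where "k = max 1 (nat \<lceil>t * real n\<rceil>)"
      have k: "1 \<le> k" "k \<le> n" "\<bar>t - real k / real n\<bar> \<le> 1 / real n"
      proof -
        show "1 \<le> k" by (simp add: k_def)
        have "t * real n \<le> real n" using t by (simp add: mult_left_le_one_le)
        then have "nat \<lceil>t * real n\<rceil> \<le> n" by linarith
        then show "k \<le> n" using elim(3) by (simp add: k_def)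
        have "0 \<le> t * real n" using t by simp
        then have "\<bar>t * real n - real k\<bar> \<le> 1" unfolding k_def by linarith
        then have "\<bar>t * real n - real k\<bar> / real n \<le> 1 / real n"
          by (rule divide_right_mono) simp
        moreover have "t - real k / real n = (t * real n - real k) / real n"
          using elim(3) by (simp add: field_simps)
        ultimately show "\<bar>t - real k / real n\<bar> \<le> 1 / real n" by simp
      qed
      have "real k / real n \<le> 1" using k by (simp add: divide_le_eq_1)
      then have "\<bar>g t - g (real k / real n)\<bar> < r / 3"
        using elim(2)[rule_format, of t "real k / real n"] t k(3) by simp
      moreover have "\<bar>a n k - g (real k / real n)\<bar> < r / 3" using elim(1) k by blast
      moreover have "a n k \<le> Max (insert 0 {a n k |k. 1 \<le> k \<and> k \<le> n})"
        by (rule Max_ge[OF fin]) (use k in auto)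
      ultimately show "g t \<le> Max (insert 0 {a n k |k. 1 \<le> k \<and> k \<le> n}) + 2 * (r / 3)" by linarith
    qed simp
    ultimately show ?case using r unfolding real_norm_def by linarith
  qed
  then show "\<exists>no. \<forall>n\<ge>no. norm (Max (insert 0 {a n k |k. 1 \<le> k \<and> k \<le> n}) - (SUP t\<in>{0..1}. g t)) < r"
    unfolding eventually_sequentially .
qed

section \<open>Convergence of the statistics along continuous paths\<close>

text \<open>The inner time \<open>s\<close> is written as \<open>v * t\<close> with a fraction
  \<open>v\<close>. Suprema and integrals then range over the fixed interval \<open>{0..1}\<close>,
  and no division by \<open>t\<close> is left.\<close>

definition bridge :: "(real \<Rightarrow> real) \<Rightarrow> real \<Rightarrow> real \<Rightarrow> real" where
  "bridge f t v = f (v * t) - v * f t"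

definition bridge_sup :: "(real \<Rightarrow> real) \<Rightarrow> real \<Rightarrow> real" where
  "bridge_sup f t = (SUP v\<in>{0..1}. \<bar>bridge f t v\<bar>)"

definition bridge_int :: "(real \<Rightarrow> real) \<Rightarrow> real \<Rightarrow> real" where
  "bridge_int f t = integral {0..t} (\<lambda>s. (f s - s / t * f t)\<^sup>2)"

text \<open>Running time backwards turns the right-hand part of a denominator into a left-hand part,
  so that only bridges on initial segments have to be analysed.\<close>

definition reversal :: "(real \<Rightarrow> real) \<Rightarrow> real \<Rightarrow> real" where
  "reversal f u = f 1 - f (1 - u)"

definition dbridge_max :: "(nat \<Rightarrow> real) \<Rightarrow> nat \<Rightarrow> real" where
  "dbridge_max V k = Max (insert 0 {\<bar>V i - real i / real k * V k\<bar> |i. 1 \<le> i \<and> i \<le> k})"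

definition dbridge_sq :: "(nat \<Rightarrow> real) \<Rightarrow> nat \<Rightarrow> real" where
  "dbridge_sq V k = (\<Sum>i=1..k. (V i - real i / real k * V k)\<^sup>2)"

lemma abs_mult_diff: "\<bar>c * x - c * y\<bar> = \<bar>c\<bar> * \<bar>x - y\<bar>" for c x y :: real
  by (simp add: abs_mult[symmetric] right_diff_distrib)

text \<open>Rounding to a fraction \<open>i / k\<close> costs \<open>1 / k\<close>, which is not
  small for small \<open>k\<close>. That cost is multiplied by the value of the path at
  \<open>k / n\<close>, and this bound cancels it.\<close>

lemma modulus_telescope:
  fixes f :: "real \<Rightarrow> real"
  assumes m: "\<forall>x\<in>{0..1}. \<forall>y\<in>{0..1}. \<bar>x - y\<bar> \<le> 1 / real n \<longrightarrow> \<bar>f x - f y\<bar> < e"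
    and f0: "f 0 = 0" and n: "0 < n" and k: "k \<le> n"
  shows "\<bar>f (real k / real n)\<bar> \<le> real k * e"
  using k
proof (induction k)
  case 0 then show ?case using f0 by simp
next
  case (Suc k)
  have "\<bar>f (real (Suc k) / real n) - f (real k / real n)\<bar> < e"
  proof -
    have "real (Suc k) / real n \<in> {0..1}" "real k / real n \<in> {0..1}"
      using Suc.prems n by (auto simp: divide_le_eq_1)
    moreover have "real (Suc k) / real n - real k / real n = 1 / real n" using n by (simp add: field_simps)
    ultimately show ?thesis using m by simp
  qed
  then show ?case using Suc by (simp add: algebra_simps)
qed

lemma reversal_0: "reversal f 0 = 0"
  by (simp add: reversal_def)

lemma continuous_on_reversal:
  assumes "continuous_on {0..1} f" shows "continuous_on {0..1} (reversal f)"
proof -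
  have "continuous_on {0..1} (\<lambda>u. f (1 - u))"
    by (rule continuous_on_compose2[OF assms]) (auto intro!: continuous_intros)
  then show ?thesis unfolding reversal_def[abs_def] by (intro continuous_intros)
qed

lemma bridge_bounded:
  assumes B: "\<And>t. 0 \<le> t \<Longrightarrow> t \<le> 1 \<Longrightarrow> \<bar>f t\<bar> \<le> B" and t: "0 \<le> t" "t \<le> 1" and v: "0 \<le> v" "v \<le> 1"
  shows "\<bar>bridge f t v\<bar> \<le> 2 * B"
proof -
  have "0 \<le> v * t" "v * t \<le> 1" using t v by (auto simp: mult_le_one)
  then have 1: "\<bar>f (v * t)\<bar> \<le> B" by (rule B)
  have 2: "\<bar>v * f t\<bar> \<le> B"
    using B[OF t] v mult_mono[of v 1 "\<bar>f t\<bar>" B] by (auto simp: abs_mult)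
  show ?thesis unfolding bridge_def using 1 2 by linarith
qed

lemma bridge_le_sup:
  assumes f: "continuous_on {0..1} f" and t: "0 \<le> t" "t \<le> 1" and v: "0 \<le> v" "v \<le> 1"
  shows "\<bar>bridge f t v\<bar> \<le> bridge_sup f t"
proof -
  obtain B where B: "\<And>t. 0 \<le> t \<Longrightarrow> t \<le> 1 \<Longrightarrow> \<bar>f t\<bar> \<le> B" using continuous_on_interval_bounded[OF f] by blast
  show ?thesis unfolding bridge_sup_def
    using bridge_bounded[OF B t] v by (intro cSUP_upper bdd_aboveI2[of _ _ "2 * B"]) auto
qed

lemma bridge_sup_nonneg:
  assumes f: "continuous_on {0..1} f" and t: "0 \<le> t" "t \<le> 1"
  shows "0 \<le> bridge_sup f t"
  using bridge_le_sup[OF assms, of 0] by (simp add: order_trans[OF abs_ge_zero])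

lemma bridge_sup_least:
  assumes "\<And>v. 0 \<le> v \<Longrightarrow> v \<le> 1 \<Longrightarrow> \<bar>bridge f t v\<bar> \<le> c"
  shows "bridge_sup f t \<le> c"
  unfolding bridge_sup_def by (rule cSUP_least) (use assms in auto)

lemma bridge_diff_le:
  assumes m: "\<And>x y. x \<in> {0..1} \<Longrightarrow> y \<in> {0..1} \<Longrightarrow> \<bar>x - y\<bar> \<le> d \<Longrightarrow> \<bar>f x - f y\<bar> \<le> e"
    and t: "t \<in> {0..1}" "t' \<in> {0..1}" "\<bar>t - t'\<bar> \<le> d" and v: "0 \<le> v" "v \<le> 1"
  shows "\<bar>bridge f t v - bridge f t' v\<bar> \<le> 2 * e"
proof -
  have "\<bar>v * t - v * t'\<bar> \<le> d"
    using v t(3) mult_mono[of v 1 "\<bar>t - t'\<bar>" d] by (auto simp: abs_mult right_diff_distrib[symmetric])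
  then have 1: "\<bar>f (v * t) - f (v * t')\<bar> \<le> e"
    using t v by (intro m) (auto simp: mult_le_one)
  have "\<bar>f t - f t'\<bar> \<le> e" by (rule m) (use t in auto)
  then have 2: "\<bar>v * f t - v * f t'\<bar> \<le> e"
    using v mult_mono[of v 1 "\<bar>f t - f t'\<bar>" e] by (auto simp: abs_mult right_diff_distrib[symmetric])
  show ?thesis unfolding bridge_def using 1 2 by linarith
qed

text \<open>The bound of \<open>bridge_diff_le\<close> is uniform in \<open>v\<close>, so it passes
  to the suprema.\<close>

lemma continuous_on_bridge_sup:
  assumes f: "continuous_on {0..1} f" shows "continuous_on {0..1} (bridge_sup f)"
  unfolding continuous_on_iff
proof (intro ballI allI impI)
  fix t e :: real assume t: "t \<in> {0..1}" and e: "0 < e"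
  have "uniformly_continuous_on {0..1} f" using f by (intro compact_uniformly_continuous) auto
  then obtain d where d: "0 < d" "\<And>x y. x \<in> {0..1} \<Longrightarrow> y \<in> {0..1} \<Longrightarrow> dist y x < d \<Longrightarrow> dist (f y) (f x) < e / 3"
    using e unfolding uniformly_continuous_on_def by (metis divide_pos_pos zero_less_numeral)
  have m: "\<bar>f x - f y\<bar> \<le> e / 3" if "x \<in> {0..1}" "y \<in> {0..1}" "\<bar>x - y\<bar> \<le> d / 2" for x y
    using d(2)[of y x] that d(1) by (auto simp: dist_real_def)
  have le: "bridge_sup f a \<le> bridge_sup f b + 2 * (e / 3)"
    if "a \<in> {0..1}" "b \<in> {0..1}" "\<bar>a - b\<bar> \<le> d / 2" for a b
  proof (rule bridge_sup_least)
    fix v :: real assume v: "0 \<le> v" "v \<le> 1"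
    have "\<bar>bridge f b v\<bar> \<le> bridge_sup f b" using bridge_le_sup[OF f _ _ v] that by auto
    then show "\<bar>bridge f a v\<bar> \<le> bridge_sup f b + 2 * (e / 3)"
      using bridge_diff_le[of "d / 2" f "e / 3", OF m that v] by linarith
  qed
  have "dist (bridge_sup f t') (bridge_sup f t) < e" if "t' \<in> {0..1}" "dist t' t < d / 2" for t'
  proof -
    have "\<bar>t' - t\<bar> \<le> d / 2" "\<bar>t - t'\<bar> \<le> d / 2" using that(2) unfolding dist_real_def by linarith+
    from le[OF that(1) t this(1)] le[OF t that(1) this(2)] show ?thesis
      using e unfolding dist_real_def by linarith
  qed
  then show "\<exists>d>0. \<forall>t'\<in>{0..1}. dist t' t < d \<longrightarrow> dist (bridge_sup f t') (bridge_sup f t) < e"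
    using d(1) by (intro exI[of _ "d / 2"]) auto
qed

text \<open>Substitute \<open>s = v * t\<close>. On the right the integrand is jointly continuous,
  which gives continuity in \<open>t\<close> up to \<open>t = 0\<close>.\<close>

lemma bridge_int_eq:
  assumes f: "continuous_on {0..1} f" and f0: "f 0 = 0" and t: "0 \<le> t" "t \<le> 1"
  shows "bridge_int f t = t * integral {0..1} (\<lambda>v. (bridge f t v)\<^sup>2)"
proof (cases "t = 0")
  case True then show ?thesis by (simp add: bridge_int_def)
next
  case False
  then have t: "0 < t" "t \<le> 1" using t by auto
  define h where "h s = (f s - s / t * f t)\<^sup>2" for s
  have "continuous_on {0..t} h"
    unfolding h_def using t by (intro continuous_intros continuous_on_subset[OF f]) auto
  then have "(h has_integral integral {0..t} h) (cbox 0 t)"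
    by (simp add: integrable_continuous_interval integrable_integral)
  from has_integral_affinity[OF this, of t 0] t
  have "((\<lambda>v. h (t * v)) has_integral (1 / t) * integral {0..t} h) ((\<lambda>x. x / t) ` {0..t})"
    by simp
  moreover have "(\<lambda>x. x / t) ` {0..t} = {0..1}"
    using t by (simp add: image_divide_atLeastAtMost)
  moreover have "h (t * v) = (bridge f t v)\<^sup>2" for v
    using t by (simp add: h_def bridge_def mult.commute)
  ultimately have "((\<lambda>v. (bridge f t v)\<^sup>2) has_integral (1 / t) * integral {0..t} h) {0..1}"
    by simp
  then have "integral {0..1} (\<lambda>v. (bridge f t v)\<^sup>2) = (1 / t) * integral {0..t} h"
    by (rule integral_unique)
  moreover have "integral {0..t} h = bridge_int f t" by (simp only: bridge_int_def h_def[abs_def])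
  ultimately show ?thesis using t by simp
qed

lemma continuous_on_bridge_int:
  assumes f: "continuous_on {0..1} f" and f0: "f 0 = 0"
  shows "continuous_on {0..1} (bridge_int f)"
proof -
  have "continuous_on ({0..1} \<times> cbox 0 1) (\<lambda>(t, v). (bridge f t v)\<^sup>2)"
  proof -
    have 1: "continuous_on ({0..1} \<times> {0..1}) (\<lambda>x. f (snd x * fst x))"
      by (rule continuous_on_compose2[OF f]) (auto intro!: continuous_intros simp: mult_le_one)
    have 2: "continuous_on ({0..1} \<times> {0..1}) (\<lambda>x. f (fst x))"
      by (rule continuous_on_compose2[OF f]) (auto intro!: continuous_intros)
    show ?thesis unfolding bridge_def case_prod_beta using 1 2 by (auto intro!: continuous_intros)
  qed
  then have "continuous_on {0..1} (\<lambda>t. integral (cbox 0 1) (\<lambda>v. (bridge f t v)\<^sup>2))"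
    by (rule integral_continuous_on_param)
  then have "continuous_on {0..1} (\<lambda>t. t * integral {0..1} (\<lambda>v. (bridge f t v)\<^sup>2))"
    by (auto intro!: continuous_intros)
  then show ?thesis
    by (subst continuous_on_cong[OF refl bridge_int_eq[OF f f0]]) auto
qed

lemma bridge_int_nonneg:
  assumes f: "continuous_on {0..1} f" and t: "0 \<le> t" "t \<le> 1"
  shows "0 \<le> bridge_int f t"
proof (cases "t = 0")
  case False
  then show ?thesis unfolding bridge_int_def
    by (intro Henstock_Kurzweil_Integration.integral_nonneg integrable_continuous_interval 
        continuous_intros continuous_on_subset[OF f]) (use t in auto)
qed (simp add: bridge_int_def)

text \<open>The discrete bridge at \<open>i\<close> is compared with the continuous one at
  \<open>v = i / k\<close>. One direction needs only this, the other also rounds an arbitrary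
  \<open>v\<close> down to such a fraction; either step costs \<open>2 * e\<close>, hence
  \<open>4 * e\<close>.\<close>

lemma grid_conv_dbridge_max:
  assumes V: "grid_conv V f" and f: "continuous_on {0..1} f" and f0: "f 0 = 0" and V0: "\<And>n. V n 0 = 0"
  shows "grid_conv (\<lambda>n k. dbridge_max (V n) k) (bridge_sup f)"
proof (rule grid_convI')
  fix e :: real assume e: "0 < e"
  from grid_convD[OF V e] continuous_on_interval_modulus[OF f e] eventually_gt_at_top[of 0]
  show "\<forall>\<^sub>F n in sequentially. \<forall>k\<le>n. \<bar>dbridge_max (V n) k - bridge_sup f (real k / real n)\<bar> \<le> 4 * e"
  proof eventually_elim
    case (elim n)
    show ?case
    proof (intro allI impI)
      fix k assume k: "k \<le> n"
      define t where "t = real k / real n"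
      have t: "0 \<le> t" "t \<le> 1" using k by (auto simp: t_def divide_le_eq_1)
      show "\<bar>dbridge_max (V n) k - bridge_sup f (real k / real n)\<bar> \<le> 4 * e"
      proof (cases "k = 0")
        case True
        have "(SUP v\<in>{0..1::real}. \<bar>bridge f 0 v\<bar>) = 0" by (simp add: bridge_def f0)
        then show ?thesis using True e by (simp add: dbridge_max_def bridge_sup_def)
      next
        case False
        have close: "\<bar>(V n i - real i / real k * V n k) - bridge f t (real i / real k)\<bar> \<le> 2 * e" if "i \<le> k" for i
        proof -
          have "\<bar>V n i - f (real i / real n)\<bar> \<le> e" "\<bar>V n k - f t\<bar> \<le> e"
            using elim(1) that k by (auto simp: t_def less_imp_le)
          moreover have "real i / real k * t = real i / real n" using False by (simp add: t_def)
          moreover have "\<bar>real i / real k * V n k - real i / real k * f t\<bar> \<le> e"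
          proof -
            have "real i / real k \<le> 1" using that by (auto simp: divide_le_eq_1)
            then have "\<bar>real i / real k\<bar> * \<bar>V n k - f t\<bar> \<le> 1 * e"
              using \<open>\<bar>V n k - f t\<bar> \<le> e\<close> by (intro mult_mono) auto
            then show ?thesis unfolding abs_mult_diff by simp
          qed
          ultimately show ?thesis unfolding bridge_def by (simp add: abs_le_iff)
        qed
        let ?S = "insert 0 {\<bar>V n i - real i / real k * V n k\<bar> |i. 1 \<le> i \<and> i \<le> k}"
        have fin: "finite ?S" by simp
        \<comment> \<open>Rounding may produce \<open>i = 0\<close>. Its term is
          \<open>\<bar>V n 0\<bar> = 0\<close>, which is present through
          \<open>insert 0\<close>.\<close>
        have mem: "\<bar>V n i - real i / real k * V n k\<bar> \<in> ?S" if "i \<le> k" for i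
          using that V0 by (cases "i = 0") auto
        have "dbridge_max (V n) k \<le> bridge_sup f t + 2 * e"
          unfolding dbridge_max_def
        proof (rule Max.boundedI[OF fin])
          fix x assume "x \<in> ?S"
          then consider "x = 0" | i where "i \<le> k" "x = \<bar>V n i - real i / real k * V n k\<bar>" by blast
          then show "x \<le> bridge_sup f t + 2 * e"
          proof cases
            case 1 then show ?thesis using bridge_sup_nonneg[OF f t] e by simp
          next
            case 2
            then have "real i / real k \<le> 1" by (auto simp: divide_le_eq_1)
            then have "\<bar>bridge f t (real i / real k)\<bar> \<le> bridge_sup f t"
              by (intro bridge_le_sup[OF f t]) auto
            then show ?thesis using close[OF 2(1)] 2(2) by linarith
          qed
        qed simp
        moreover have "bridge_sup f t \<le> dbridge_max (V n) k + 4 * e"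
        proof (rule bridge_sup_least)
          fix v :: real assume v: "0 \<le> v" "v \<le> 1"
          define i where "i = nat \<lfloor>v * real k\<rfloor>"
          have i: "real i \<le> v * real k" "v * real k \<le> real i + 1"
            using v unfolding i_def by (auto simp: of_nat_nat)
          have "v * real k \<le> real k" using v by (simp add: mult_left_le_one_le)
          then have ik: "i \<le> k" using i(1) by linarith
          have "\<bar>bridge f t v - bridge f t (real i / real k)\<bar> \<le> 2 * e"
          proof -
            have 1: "v * t = v * real k / real n" "real i / real k * t = real i / real n"
              using False by (auto simp: t_def)
            have "\<bar>v * real k / real n - real i / real n\<bar> \<le> 1 / real n"
              unfolding diff_divide_distrib[symmetric] abs_divide using i
              by (auto intro!: divide_right_mono)
            moreover have "v * t \<in> {0..1}" using v t by (auto simp: mult_le_one)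
            moreover have "real i / real n \<in> {0..1}" using ik k by (auto simp: divide_le_eq_1)
            ultimately have A: "\<bar>f (v * t) - f (real i / real k * t)\<bar> < e"
              using elim(2) unfolding 1 by auto
            have "\<bar>v - real i / real k\<bar> \<le> 1 / real k"
            proof -
              have "v - real i / real k = (v * real k - real i) / real k" using False by (simp add: field_simps)
              then show ?thesis using i by (simp add: divide_right_mono)
            qed
            \<comment> \<open>The factor \<open>1 / real k\<close> meets \<open>real k * e\<close>
              from \<open>modulus_telescope\<close>; this makes the bound uniform in
              \<open>k\<close>.\<close>
            then have "\<bar>v - real i / real k\<bar> * \<bar>f t\<bar> \<le> (1 / real k) * (real k * e)"
              using modulus_telescope[OF elim(2) f0 elim(3) k] e unfolding t_def by (intro mult_mono) auto
            then have "\<bar>(v - real i / real k) * f t\<bar> \<le> e" using False by (simp add: abs_mult)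
            moreover have "bridge f t v - bridge f t (real i / real k)
                = (f (v * t) - f (real i / real k * t)) - (v - real i / real k) * f t"
              by (simp add: bridge_def algebra_simps)
            ultimately show ?thesis
              using A abs_triangle_ineq4[of "f (v * t) - f (real i / real k * t)" "(v - real i / real k) * f t"]
              by (smt (verit))
          qed
          moreover have "\<bar>V n i - real i / real k * V n k\<bar> \<le> dbridge_max (V n) k"
            unfolding dbridge_max_def by (rule Max_ge[OF fin mem[OF ik]])
          ultimately show "\<bar>bridge f t v\<bar> \<le> dbridge_max (V n) k + 4 * e"
            using close[OF ik] by (smt (verit))
        qed
        ultimately show ?thesis using e unfolding t_def[symmetric] by linarith
      qed
    qed
  qed
qed simp

text \<open>A Riemann sum for the squared bridge, with two perturbations of size
  \<open>2 * e\<close>: one from the values of \<open>V\<close>, one from the oscillation of the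
  bridge over a cell.\<close>

lemma grid_conv_dbridge_sq:
  assumes V: "grid_conv V f" and f: "continuous_on {0..1} f" and f0: "f 0 = 0"
  shows "grid_conv (\<lambda>n k. dbridge_sq (V n) k / real n) (bridge_int f)"
proof -
  obtain B where B: "0 < B" "\<And>t. 0 \<le> t \<Longrightarrow> t \<le> 1 \<Longrightarrow> \<bar>f t\<bar> \<le> B" using continuous_on_interval_bounded[OF f] by blast
  \<comment> \<open>A bridge of \<open>f\<close> is bounded by \<open>2 * B\<close>, and a discrete
    bridge deviates from it by at most \<open>2 * e \<le> 2\<close>. The sum of the two bounds is
    the Lipschitz factor of squaring.\<close>
  have sq: "\<bar>x\<^sup>2 - y\<^sup>2\<bar> \<le> d * (4 * B + 2)"
    if "\<bar>x - y\<bar> \<le> d" "\<bar>x\<bar> \<le> 2 * B + 2" "\<bar>y\<bar> \<le> 2 * B" "0 \<le> d" for x y d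
  proof -
    have "\<bar>x\<^sup>2 - y\<^sup>2\<bar> = \<bar>x - y\<bar> * \<bar>x + y\<bar>" by (simp add: abs_mult[symmetric] power2_eq_square algebra_simps)
    also have "\<dots> \<le> d * (4 * B + 2)" using that by (intro mult_mono) auto
    finally show ?thesis .
  qed
  show ?thesis
  proof (rule grid_convI')
    show "0 \<le> 4 * (4 * B + 2)" using B by simp
    fix e' :: real assume e': "0 < e'"
    define e where "e = min e' 1"
    have e: "0 < e" "e \<le> 1" "e \<le> e'" using e' by (auto simp: e_def)
    from grid_convD[OF V e(1)] continuous_on_interval_modulus[OF f e(1)] eventually_gt_at_top[of 0]
    show "\<forall>\<^sub>F n in sequentially. \<forall>k\<le>n. \<bar>dbridge_sq (V n) k / real n - bridge_int f (real k / real n)\<bar> \<le> 4 * (4 * B + 2) * e'"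
    proof eventually_elim
      case (elim n)
      show ?case
      proof (intro allI impI)
        fix k assume k: "k \<le> n"
        show "\<bar>dbridge_sq (V n) k / real n - bridge_int f (real k / real n)\<bar> \<le> 4 * (4 * B + 2) * e'"
        proof (cases "k = 0")
          case True
          then show ?thesis using e' B by (simp add: dbridge_sq_def bridge_int_def)
        next
          case False
          define t where "t = real k / real n"
          have t: "0 < t" "t \<le> 1" using k False by (auto simp: t_def divide_le_eq_1)
          define g where "g s = f s - s / t * f t" for s
          have gB: "\<bar>g s\<bar> \<le> 2 * B" if "0 \<le> s" "s \<le> t" for s
            using bridge_bounded[OF B(2), where t = t and v = "s / t"] that t by (auto simp: g_def bridge_def divide_le_eq_1)
          have gt: "g (real i / real n) = f (real i / real n) - real i / real k * f t" for i
            using elim(3) by (simp add: g_def t_def)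
          \<comment> \<open>The linear term changes by at most \<open>\<bar>f t\<bar> / k\<close>
            over one cell, which \<open>modulus_telescope\<close> bounds by
            \<open>e\<close>.\<close>
          have osc: "\<bar>g x - g y\<bar> \<le> 2 * e" if xy: "x \<in> {0..1}" "y \<in> {0..1}" "\<bar>x - y\<bar> \<le> 1 / real n" for x y
          proof -
            have "\<bar>f x - f y\<bar> < e" using elim(2) xy by blast
            moreover have "\<bar>(x - y) / t * f t\<bar> \<le> e"
            proof -
              have "\<bar>x - y\<bar> / t \<le> (1 / real n) / t" using xy t by (intro divide_right_mono) auto
              also have "\<dots> = 1 / real k" using elim(3) by (simp add: t_def)
              finally have "\<bar>x - y\<bar> / t * \<bar>f t\<bar> \<le> (1 / real k) * (real k * e)"
                using modulus_telescope[OF elim(2) f0 elim(3) k] e unfolding t_def by (intro mult_mono) auto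
              then show ?thesis using False t by (simp add: abs_mult)
            qed
            moreover have "g x - g y = (f x - f y) - (x - y) / t * f t"
              by (simp add: g_def diff_divide_distrib algebra_simps)
            ultimately show ?thesis
              using abs_triangle_ineq4[of "f x - f y" "(x - y) / t * f t"] by (smt (verit))
          qed
          have "\<bar>(\<Sum>i=1..k. (g (real i / real n))\<^sup>2) / real n - integral {0..real k / real n} (\<lambda>s. (g s)\<^sup>2)\<bar>
             \<le> (\<Sum>i=1..k. 2 * e * (4 * B + 2)) / real n"
          proof (rule riemann_sum_bound)
            show "(\<lambda>s. (g s)\<^sup>2) integrable_on {0..1}"
              unfolding g_def using t by (intro integrable_continuous_interval continuous_intros f) auto
            fix i s assume i: "1 \<le> i" "i \<le> k" and s: "s \<in> {(real i - 1) / real n..real i / real n}"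
            have "0 \<le> (real i - 1) / real n" "real i / real n \<le> t" using i by (auto simp: t_def divide_right_mono)
            moreover have "real i / real n - s \<le> 1 / real n" using s by (auto simp: diff_divide_distrib)
            ultimately show "\<bar>(g (real i / real n))\<^sup>2 - (g s)\<^sup>2\<bar> \<le> 2 * e * (4 * B + 2)"
              using s t e gB[of "real i / real n"] gB[of s] osc[of "real i / real n" s]
              by (intro sq) auto
          qed (use elim k in auto)
          also have "\<dots> \<le> 2 * e * (4 * B + 2)"
          proof -
            have "real k / real n * (2 * e * (4 * B + 2)) \<le> 1 * (2 * e * (4 * B + 2))"
              using t B e unfolding t_def by (intro mult_right_mono) auto
            then show ?thesis by simp
          qed
          finally have 1: "\<bar>(\<Sum>i=1..k. (g (real i / real n))\<^sup>2) / real n - bridge_int f t\<bar> \<le> 2 * e * (4 * B + 2)"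
            unfolding bridge_int_def g_def t_def .
          have 2: "\<bar>dbridge_sq (V n) k / real n - (\<Sum>i=1..k. (g (real i / real n))\<^sup>2) / real n\<bar> \<le> 2 * e * (4 * B + 2)"
          proof -
            have "\<bar>(V n i - real i / real k * V n k)\<^sup>2 - (g (real i / real n))\<^sup>2\<bar> \<le> 2 * e * (4 * B + 2)"
              if "i \<in> {1..k}" for i
            proof (rule sq)
              have V1: "\<bar>V n i - f (real i / real n)\<bar> \<le> e" "\<bar>V n k - f t\<bar> \<le> e"
                using elim(1) that k by (auto simp: t_def less_imp_le)
              have "real i / real k \<le> 1" using that by (auto simp: divide_le_eq_1)
              then have "\<bar>real i / real k\<bar> * \<bar>V n k - f t\<bar> \<le> 1 * e"
                using V1(2) by (intro mult_mono) auto
              then have "\<bar>real i / real k * V n k - real i / real k * f t\<bar> \<le> e"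
                unfolding abs_mult_diff by simp
              then show *: "\<bar>(V n i - real i / real k * V n k) - g (real i / real n)\<bar> \<le> 2 * e"
                using V1(1) unfolding gt by (simp add: abs_le_iff)
              show **: "\<bar>g (real i / real n)\<bar> \<le> 2 * B" using that by (intro gB) (auto simp: t_def divide_right_mono)
              show "\<bar>V n i - real i / real k * V n k\<bar> \<le> 2 * B + 2" using * ** e by linarith
            qed (use e in auto)
            then have "\<bar>dbridge_sq (V n) k - (\<Sum>i=1..k. (g (real i / real n))\<^sup>2)\<bar> \<le> (\<Sum>i=1..k. 2 * e * (4 * B + 2))"
              unfolding dbridge_sq_def sum_subtractf[symmetric] by (intro order_trans[OF sum_abs sum_mono])
            also have "\<dots> \<le> real n * (2 * e * (4 * B + 2))"
              using k e B by (simp add: mult_right_mono)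
            finally show ?thesis using elim(3)
              unfolding diff_divide_distrib[symmetric] abs_divide by (simp add: divide_le_eq mult.commute)
          qed
          have "4 * (4 * B + 2) * e \<le> 4 * (4 * B + 2) * e'" using e B by (intro mult_left_mono) auto
          moreover have "2 * e * (4 * B + 2) + 2 * e * (4 * B + 2) = 4 * (4 * B + 2) * e" by (simp add: algebra_simps)
          ultimately show ?thesis using 1 2 unfolding t_def by linarith
        qed
      qed
    qed
  qed
qed

section \<open>Time reversal in the statistics and the functionals\<close>

definition rev_seq :: "nat \<Rightarrow> (nat \<Rightarrow> real) \<Rightarrow> nat \<Rightarrow> real" where
  "rev_seq n V j = V n - V (n - j)"

text \<open>Put \<open>j = n - i\<close>. The resulting range \<open>0 \<le> j < n - k\<close> and
  the range \<open>1 \<le> j \<le> n - k\<close> of \<open>dbridge_max\<close> differ by their end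
  points, where the bridge is \<open>0\<close>; \<open>insert 0\<close> makes the two maxima
  agree.\<close>

lemma Qstat_alt:
  assumes V0: "V 0 = 0"
  shows "Qstat n V = Max (insert 0 {\<bar>(V k - real k / real n * V n) /
      (dbridge_max V k + dbridge_max (rev_seq n V) (n - k))\<bar> |k. 1 \<le> k \<and> k \<le> n})"
proof -
  have "Max (insert 0 {\<bar>(V n - V i) - (real n - real i) / (real n - real k) * (V n - V k)\<bar> |i. k < i \<and> i \<le> n})
      = dbridge_max (rev_seq n V) (n - k)" if k: "1 \<le> k" "k \<le> n" for k
  proof -
    let ?R = "rev_seq n V"
    have eq: "{\<bar>(V n - V i) - (real n - real i) / (real n - real k) * (V n - V k)\<bar> |i. k < i \<and> i \<le> n}
        = (\<lambda>j. \<bar>?R j - real j / real (n - k) * ?R (n - k)\<bar>) ` {..<n - k}"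
    proof (rule set_eqI, rule iffI)
      fix x assume "x \<in> {\<bar>(V n - V i) - (real n - real i) / (real n - real k) * (V n - V k)\<bar> |i. k < i \<and> i \<le> n}"
      then obtain i where i: "k < i" "i \<le> n" "x = \<bar>(V n - V i) - (real n - real i) / (real n - real k) * (V n - V k)\<bar>"
        by blast
      then show "x \<in> (\<lambda>j. \<bar>?R j - real j / real (n - k) * ?R (n - k)\<bar>) ` {..<n - k}"
        using k by (intro image_eqI[of _ _ "n - i"]) (auto simp: rev_seq_def of_nat_diff)
    next
      fix x assume "x \<in> (\<lambda>j. \<bar>?R j - real j / real (n - k) * ?R (n - k)\<bar>) ` {..<n - k}"
      then obtain j where j: "j < n - k" "x = \<bar>?R j - real j / real (n - k) * ?R (n - k)\<bar>" by blast
      then show "x \<in> {\<bar>(V n - V i) - (real n - real i) / (real n - real k) * (V n - V k)\<bar> |i. k < i \<and> i \<le> n}"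
        using k by (intro CollectI exI[of _ "n - j"]) (auto simp: rev_seq_def of_nat_diff)
    qed
    have "insert 0 ((\<lambda>j. \<bar>?R j - real j / real (n - k) * ?R (n - k)\<bar>) ` {..<n - k})
        = insert 0 {\<bar>?R i - real i / real (n - k) * ?R (n - k)\<bar> |i. 1 \<le> i \<and> i \<le> n - k}"
    proof (rule set_eqI, rule iffI)
      fix x assume "x \<in> insert 0 ((\<lambda>j. \<bar>?R j - real j / real (n - k) * ?R (n - k)\<bar>) ` {..<n - k})"
      then consider "x = 0" | j where "j < n - k" "x = \<bar>?R j - real j / real (n - k) * ?R (n - k)\<bar>" by blast
      then show "x \<in> insert 0 {\<bar>?R i - real i / real (n - k) * ?R (n - k)\<bar> |i. 1 \<le> i \<and> i \<le> n - k}"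
      proof cases
        case 2
        then show ?thesis by (cases "j = 0") (auto simp: rev_seq_def)
      qed simp
    next
      fix x assume "x \<in> insert 0 {\<bar>?R i - real i / real (n - k) * ?R (n - k)\<bar> |i. 1 \<le> i \<and> i \<le> n - k}"
      then consider "x = 0" | j where "1 \<le> j" "j \<le> n - k" "x = \<bar>?R j - real j / real (n - k) * ?R (n - k)\<bar>" by blast
      then show "x \<in> insert 0 ((\<lambda>j. \<bar>?R j - real j / real (n - k) * ?R (n - k)\<bar>) ` {..<n - k})"
      proof cases
        case 2
        then show ?thesis by (cases "j = n - k") auto
      qed simp
    qed
    then show ?thesis unfolding eq dbridge_max_def by simp
  qed
  note key = this
  have "{\<bar>(V k - real k / real n * V n) /
       (Max (insert 0 {\<bar>V i - real i / real k * V k\<bar> | i. 1 \<le> i \<and> i \<le> k})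
      + Max (insert 0 {\<bar>(V n - V i) - (real n - real i) / (real n - real k) * (V n - V k)\<bar>
                       | i. k < i \<and> i \<le> n}))\<bar> | k. 1 \<le> k \<and> k \<le> n}
    = {\<bar>(V k - real k / real n * V n) /
      (dbridge_max V k + dbridge_max (rev_seq n V) (n - k))\<bar> |k. 1 \<le> k \<and> k \<le> n}"
    unfolding dbridge_max_def[of V, symmetric] by (intro Collect_cong ex_cong1 rev_conj_cong refl) (simp only: key)
  then show ?thesis unfolding Qstat_def by simp
qed

text \<open>As for \<open>Qstat\<close>, the two ranges of summation differ only by vanishing
  terms.\<close>

lemma Rstat_alt:
  assumes V0: "V 0 = 0"
  shows "Rstat n V = (\<Sum>k=1..n. (V k - real k / real n * V n)\<^sup>2 /
      (dbridge_sq V k + dbridge_sq (rev_seq n V) (n - k)))"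
proof -
  have "(\<Sum>i=k+1..n. ((V n - V i) - (real n - real i) / (real n - real k) * (V n - V k))\<^sup>2)
      = dbridge_sq (rev_seq n V) (n - k)" if k: "1 \<le> k" "k \<le> n" for k
  proof -
    let ?R = "rev_seq n V"
    have "(\<Sum>i=k+1..n. ((V n - V i) - (real n - real i) / (real n - real k) * (V n - V k))\<^sup>2)
       = (\<Sum>j<n - k. (?R j - real j / real (n - k) * ?R (n - k))\<^sup>2)"
      using k by (intro sum.reindex_bij_witness[of _ "\<lambda>j. n - j" "\<lambda>i. n - i"]) (auto simp: rev_seq_def of_nat_diff)
    also have "\<dots> = (\<Sum>j\<in>{..n - k}. (?R j - real j / real (n - k) * ?R (n - k))\<^sup>2)"
    proof (rule sum.mono_neutral_left)
      show "\<forall>i\<in>{..n - k} - {..<n - k}. (?R i - real i / real (n - k) * ?R (n - k))\<^sup>2 = 0"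
      proof
        fix i assume "i \<in> {..n - k} - {..<n - k}"
        then have "i = n - k" by auto
        then show "(?R i - real i / real (n - k) * ?R (n - k))\<^sup>2 = 0"
          by (cases "n - k = 0") (simp_all add: rev_seq_def)
      qed
    qed auto
    also have "\<dots> = dbridge_sq ?R (n - k)"
      unfolding dbridge_sq_def
      by (intro sum.mono_neutral_right) (auto simp: rev_seq_def not_less_eq_eq)
    finally show ?thesis .
  qed
  then show ?thesis unfolding Rstat_def dbridge_sq_def[of V] by (intro sum.cong) auto
qed

text \<open>Affine substitutions in the suprema. At \<open>t = 0\<close> and \<open>t = 1\<close>
  the quotients \<open>s / t\<close> and \<open>(1 - u) / (1 - t)\<close> are
  \<open>0 / 0 = 0\<close>, and the respective supremum is \<open>0\<close> on both sides, at
  \<open>t = 0\<close> because of \<open>f 0 = 0\<close>.\<close>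

lemma Sfun_alt:
  assumes f0: "f 0 = 0"
  shows "Sfun f = (SUP t\<in>{0..1}. \<bar>(f t - t * f 1) / (bridge_sup f t + bridge_sup (reversal f) (1 - t))\<bar>)"
proof -
  have L: "(SUP s\<in>{0..t}. \<bar>f s - s / t * f t\<bar>) = bridge_sup f t" if t: "0 \<le> t" for t
  proof -
    have "(\<lambda>s. \<bar>f s - s / t * f t\<bar>) ` {0..t} = (\<lambda>v. \<bar>bridge f t v\<bar>) ` {0..1}"
    proof (cases "t = 0")
      case True
      then show ?thesis using f0 by (auto simp: bridge_def image_constant_conv)
    next
      case False
      then have "{0..t} = (\<lambda>v. t * v) ` {0..1}" using t image_mult_atLeastAtMost[of t 0 1] by simp
      then show ?thesis using False by (simp add: image_image bridge_def mult.commute)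
    qed
    then show ?thesis unfolding bridge_sup_def by simp
  qed
  have R: "(SUP u\<in>{t..1}. \<bar>(f 1 - f u) - (1 - u) / (1 - t) * (f 1 - f t)\<bar>) = bridge_sup (reversal f) (1 - t)"
    if t: "t \<le> 1" for t
  proof -
    have "(\<lambda>u. \<bar>(f 1 - f u) - (1 - u) / (1 - t) * (f 1 - f t)\<bar>) ` {t..1} = (\<lambda>v. \<bar>bridge (reversal f) (1 - t) v\<bar>) ` {0..1}"
    proof (cases "t = 1")
      case True
      then show ?thesis by (auto simp: bridge_def reversal_def image_constant_conv)
    next
      case False
      have "{t..1} = (\<lambda>v. 1 - v * (1 - t)) ` {0..1}"
      proof -
        have "(\<lambda>v. 1 - v * (1 - t)) ` {0..1} = (\<lambda>x. 1 - x) ` (\<lambda>v. v * (1 - t)) ` {0..1}" by (simp add: image_image)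
        also have "(\<lambda>v. v * (1 - t)) ` {0..1} = {0..1 - t}"
          using t False image_mult_atLeastAtMost[of "1 - t" 0 1] by (simp add: mult.commute)
        also have "(\<lambda>x. 1 - x) ` {0..1 - t} = {t..1}" by (simp add: image_diff_atLeastAtMost)
        finally show ?thesis by simp
      qed
      then show ?thesis using False by (auto simp: image_image bridge_def reversal_def)
    qed
    then show ?thesis unfolding bridge_sup_def by simp
  qed
  show ?thesis unfolding Sfun_def using L R by (intro SUP_cong) auto
qed

lemma Tfun_alt:
  assumes f: "continuous_on {0..1} f"
  shows "Tfun f = integral {0..1} (\<lambda>t. (f t - t * f 1)\<^sup>2 / (bridge_int f t + bridge_int (reversal f) (1 - t)))"
proof -
  have R: "integral {t..1} (\<lambda>u. ((f 1 - f u) - (1 - u) / (1 - t) * (f 1 - f t))\<^sup>2) = bridge_int (reversal f) (1 - t)"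
    if t: "0 \<le> t" "t \<le> 1" for t
  proof (cases "t = 1")
    case True then show ?thesis by (simp add: bridge_int_def)
  next
    case False
    define h where "h u = ((f 1 - f u) - (1 - u) / (1 - t) * (f 1 - f t))\<^sup>2" for u
    have "continuous_on {t..1} h"
      unfolding h_def using t False by (intro continuous_intros continuous_on_subset[OF f]) auto
    then have "(h has_integral integral {t..1} h) (cbox t 1)"
      by (simp add: integrable_continuous_interval integrable_integral)
    from has_integral_affinity[OF this, of "-1" 1]
    have "((\<lambda>v. h (1 - v)) has_integral integral {t..1} h) ((\<lambda>x. 1 - x) ` {t..1})"
      by simp
    moreover have "(\<lambda>x. 1 - x) ` {t..1} = {0..1 - t}"
      by (simp add: image_diff_atLeastAtMost)
    ultimately have "integral {0..1 - t} (\<lambda>v. h (1 - v)) = integral {t..1} h"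
      by (simp add: integral_unique)
    moreover have "integral {0..1 - t} (\<lambda>v. h (1 - v)) = bridge_int (reversal f) (1 - t)"
      by (simp add: bridge_int_def h_def reversal_def)
    ultimately show ?thesis by (simp only: h_def[abs_def])
  qed
  show ?thesis unfolding Tfun_def bridge_int_def[of f, symmetric]
  proof (rule Henstock_Kurzweil_Integration.integral_cong)
    fix t :: real assume "t \<in> {0..1}"
    then have t: "0 \<le> t" "t \<le> 1" by simp_all
    show "(f t - t * f 1)\<^sup>2 / (bridge_int f t
        + integral {t..1} (\<lambda>u. ((f 1 - f u) - (1 - u) / (1 - t) * (f 1 - f t))\<^sup>2))
      = (f t - t * f 1)\<^sup>2 / (bridge_int f t + bridge_int (reversal f) (1 - t))"
      by (simp only: R[OF t])
  qed
qed

text \<open>A path that is linear to the left and to the right of some point is linear on \<open>[0,1/2]\<close> or on \<open>[1/2,1]\<close>;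
  the following condition excludes this, so that the denominators of both functionals do not vanish.\<close>

definition nonlinear_halves :: "(real \<Rightarrow> real) \<Rightarrow> bool" where
  "nonlinear_halves f \<longleftrightarrow> f (1/4) - f 0 \<noteq> f (1/2) - f (1/4) \<and> f (3/4) - f (1/2) \<noteq> f 1 - f (3/4)"

lemma nonlinear_halves_reversal: "nonlinear_halves f \<Longrightarrow> nonlinear_halves (reversal f)"
  by (auto simp: nonlinear_halves_def reversal_def)

text \<open>A bridge that vanishes on \<open>{0..t}\<close> makes \<open>f\<close> linear there,
  hence on \<open>{0..1/2}\<close>; the values at \<open>1/4\<close> and \<open>1/2\<close> rule
  this out.\<close>

lemma bridge_nonzero:
  assumes "nonlinear_halves f" "f 0 = 0" "1/2 \<le> t"
  shows "\<exists>s. 0 \<le> s \<and> s \<le> t \<and> f s - s / t * f t \<noteq> 0"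
proof (rule ccontr)
  assume "\<not> ?thesis"
  then have *: "f s - s / t * f t = 0" if "0 \<le> s" "s \<le> t" for s using that by blast
  have "f (1/4) = (1/4) / t * f t" using *[of "1/4"] assms(3) by simp
  moreover have "f (1/2) = (1/2) / t * f t" using *[of "1/2"] assms(3) by simp
  ultimately have "f (1/2) = 2 * f (1/4)" by simp
  then show False using assms(1,2) by (simp add: nonlinear_halves_def)
qed

lemma bridge_sup_pos:
  assumes f: "continuous_on {0..1} f" and "nonlinear_halves f" "f 0 = 0" and t: "1/2 \<le> t" "t \<le> 1"
  shows "0 < bridge_sup f t"
proof -
  obtain s where s: "0 \<le> s" "s \<le> t" "f s - s / t * f t \<noteq> 0"
    using bridge_nonzero[OF assms(2,3) t(1)] by blast
  then have "0 < \<bar>bridge f t (s / t)\<bar>" using t by (simp add: bridge_def)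
  also have "\<dots> \<le> bridge_sup f t" using s t by (intro bridge_le_sup[OF f]) auto
  finally show ?thesis .
qed

lemma bridge_int_pos:
  assumes f: "continuous_on {0..1} f" and "nonlinear_halves f" "f 0 = 0" and t: "1/2 \<le> t" "t \<le> 1"
  shows "0 < bridge_int f t"
proof -
  obtain s where s: "0 \<le> s" "s \<le> t" "f s - s / t * f t \<noteq> 0"
    using bridge_nonzero[OF assms(2,3) t(1)] by blast
  have "integral {0..t} (\<lambda>s. (f s - s / t * f t)\<^sup>2) = 0 \<longleftrightarrow> (\<forall>s\<in>{0..t}. (f s - s / t * f t)\<^sup>2 = 0)"
    using t by (intro integral_eq_0_iff continuous_intros continuous_on_subset[OF f]) auto
  then have "bridge_int f t = 0 \<longleftrightarrow> (\<forall>s\<in>{0..t}. (f s - s / t * f t)\<^sup>2 = 0)"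
    by (simp only: bridge_int_def)
  moreover have "(f s - s / t * f t)\<^sup>2 \<noteq> 0" using s(3) by (simp only: zero_eq_power2 simp_thms)
  ultimately have "bridge_int f t \<noteq> 0" using s(1,2) by (meson atLeastAtMost_iff)
  then show ?thesis using bridge_int_nonneg[OF f, of t] t by auto
qed

text \<open>One of \<open>t\<close> and \<open>1 - t\<close> is at least \<open>1/2\<close>, so one
  of the two summands is positive; the condition on the path is symmetric under reversal.\<close>

lemma denominators_pos:
  assumes f: "continuous_on {0..1} f" and nl: "nonlinear_halves f" and f0: "f 0 = 0" and t: "0 \<le> t" "t \<le> 1"
  shows "0 < bridge_sup f t + bridge_sup (reversal f) (1 - t)"
    and "0 < bridge_int f t + bridge_int (reversal f) (1 - t)"
proof -
  note r = continuous_on_reversal[OF f] nonlinear_halves_reversal[OF nl] reversal_0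
  have nn: "0 \<le> bridge_sup f t" "0 \<le> bridge_sup (reversal f) (1 - t)"
     "0 \<le> bridge_int f t" "0 \<le> bridge_int (reversal f) (1 - t)"
    using t by (auto intro!: bridge_sup_nonneg bridge_int_nonneg f r)
  show "0 < bridge_sup f t + bridge_sup (reversal f) (1 - t)"
    using bridge_sup_pos[OF f nl f0, of t] bridge_sup_pos[OF r, of "1 - t"] nn t
    by (cases "1/2 \<le> t") auto
  show "0 < bridge_int f t + bridge_int (reversal f) (1 - t)"
    using bridge_int_pos[OF f nl f0, of t] bridge_int_pos[OF r, of "1 - t"] nn t
    by (cases "1/2 \<le> t") auto
qed

lemma continuous_on_flip:
  assumes "continuous_on {0..1::real} g" shows "continuous_on {0..1} (\<lambda>t. g (1 - t))"
  by (rule continuous_on_compose2[OF assms]) (auto intro!: continuous_intros)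

lemma continuous_on_denominators:
  assumes f: "continuous_on {0..1} f" and f0: "f 0 = 0"
  shows "continuous_on {0..1} (\<lambda>t. bridge_sup f t + bridge_sup (reversal f) (1 - t))"
    and "continuous_on {0..1} (\<lambda>t. bridge_int f t + bridge_int (reversal f) (1 - t))"
  by (intro continuous_on_add continuous_on_flip continuous_on_bridge_sup continuous_on_bridge_int
      continuous_on_reversal f f0 reversal_0)+

lemma grid_conv_rev_seq:
  assumes "grid_conv V f"
  shows "grid_conv (\<lambda>n. rev_seq n (V n)) (reversal f)"
  unfolding rev_seq_def reversal_def[abs_def]
  by (intro grid_conv_diff grid_conv_last grid_conv_reflect assms)

lemma grid_conv_numerator:
  assumes V: "grid_conv V f"
  shows "grid_conv (\<lambda>n k. V n k - real k / real n * V n n) (\<lambda>t. f t - t * f 1)"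
  by (intro grid_conv_diff V grid_conv_mult[of _ _ _ _ 1 "\<bar>f 1\<bar>"] grid_conv_grid grid_conv_last) auto

lemma grid_conv_denominators:
  assumes V: "grid_conv V f" and f: "continuous_on {0..1} f" and f0: "f 0 = 0" and V0: "\<And>n. V n 0 = 0"
  shows "grid_conv (\<lambda>n k. dbridge_max (V n) k + dbridge_max (rev_seq n (V n)) (n - k))
      (\<lambda>t. bridge_sup f t + bridge_sup (reversal f) (1 - t))"
    and "grid_conv (\<lambda>n k. dbridge_sq (V n) k / real n + dbridge_sq (rev_seq n (V n)) (n - k) / real n)
      (\<lambda>t. bridge_int f t + bridge_int (reversal f) (1 - t))"
proof -
  note r = grid_conv_rev_seq[OF V] continuous_on_reversal[OF f] reversal_0
  have "grid_conv (\<lambda>n k. dbridge_max (rev_seq n (V n)) k) (bridge_sup (reversal f))"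
    by (rule grid_conv_dbridge_max[OF r]) (simp add: rev_seq_def)
  then show "grid_conv (\<lambda>n k. dbridge_max (V n) k + dbridge_max (rev_seq n (V n)) (n - k))
      (\<lambda>t. bridge_sup f t + bridge_sup (reversal f) (1 - t))"
    by (intro grid_conv_add grid_conv_dbridge_max[OF V f f0 V0] grid_conv_reflect)
  have "grid_conv (\<lambda>n k. dbridge_sq (rev_seq n (V n)) k / real n) (bridge_int (reversal f))"
    by (rule grid_conv_dbridge_sq[OF r])
  from grid_conv_reflect[OF this]
  show "grid_conv (\<lambda>n k. dbridge_sq (V n) k / real n + dbridge_sq (rev_seq n (V n)) (n - k) / real n)
      (\<lambda>t. bridge_int f t + bridge_int (reversal f) (1 - t))"
    by (intro grid_conv_add grid_conv_dbridge_sq[OF V f f0])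
qed

lemma grid_conv_divide:
  assumes a: "grid_conv a g" and b: "grid_conv b h" and g: "continuous_on {0..1} g" and h: "continuous_on {0..1} h"
    and pos: "\<And>t. 0 \<le> t \<Longrightarrow> t \<le> 1 \<Longrightarrow> 0 < h t"
  shows "grid_conv (\<lambda>n k. a n k / b n k) (\<lambda>t. g t / h t)"
proof -
  obtain B where B: "\<And>t. 0 \<le> t \<Longrightarrow> t \<le> 1 \<Longrightarrow> \<bar>g t\<bar> \<le> B" using continuous_on_interval_bounded[OF g] by blast
  have "\<exists>x\<in>{0..1}. \<forall>y\<in>{0..1}. h x \<le> h y"
    by (rule continuous_attains_inf[OF _ _ h]) auto
  then obtain x where x: "x \<in> {0..1}" "\<And>y. y \<in> {0..1} \<Longrightarrow> h x \<le> h y" by blast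
  have "\<bar>inverse (h t)\<bar> \<le> inverse (h x)" if "0 \<le> t" "t \<le> 1" for t
    using x(2)[of t] pos[of x] x(1) that by (auto intro!: le_imp_inverse_le)
  then show ?thesis unfolding divide_inverse
    using x pos[of x] by (intro grid_conv_mult[OF a _ B] grid_conv_inverse[OF b, of "h x"]) auto
qed

theorem Qstat_tendsto_Sfun:
  assumes V: "grid_conv V f" and f: "continuous_on {0..1} f" and f0: "f 0 = 0" and V0: "\<And>n. V n 0 = 0"
    and nl: "nonlinear_halves f"
  shows "(\<lambda>n. Qstat n (V n)) \<longlonglongrightarrow> Sfun f"
proof -
  have num: "continuous_on {0..1} (\<lambda>t. f t - t * f 1)" by (intro continuous_intros f)
  note den = continuous_on_denominators(1)[OF f f0]
  note pos = denominators_pos(1)[OF f nl f0]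
  have "grid_conv (\<lambda>n k. \<bar>(V n k - real k / real n * V n n) / (dbridge_max (V n) k + dbridge_max (rev_seq n (V n)) (n - k))\<bar>)
      (\<lambda>t. \<bar>(f t - t * f 1) / (bridge_sup f t + bridge_sup (reversal f) (1 - t))\<bar>)"
    by (intro grid_conv_abs grid_conv_divide grid_conv_numerator grid_conv_denominators V f f0 V0 num den pos)
  moreover have "continuous_on {0..1} (\<lambda>t. \<bar>(f t - t * f 1) / (bridge_sup f t + bridge_sup (reversal f) (1 - t))\<bar>)"
    using pos by (intro continuous_on_rabs continuous_on_divide num den) (auto simp: less_imp_neq[THEN not_sym])
  ultimately have "(\<lambda>n. Max (insert 0 {\<bar>(V n k - real k / real n * V n n) / (dbridge_max (V n) k + dbridge_max (rev_seq n (V n)) (n - k))\<bar>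
        |k. 1 \<le> k \<and> k \<le> n}))
      \<longlonglongrightarrow> (SUP t\<in>{0..1}. \<bar>(f t - t * f 1) / (bridge_sup f t + bridge_sup (reversal f) (1 - t))\<bar>)"
    by (rule grid_conv_Max_tendsto_SUP) simp
  moreover have "Qstat n (V n) = Max (insert 0 {\<bar>(V n k - real k / real n * V n n) /
      (dbridge_max (V n) k + dbridge_max (rev_seq n (V n)) (n - k))\<bar> |k. 1 \<le> k \<and> k \<le> n})" for n
    by (rule Qstat_alt) (rule V0)
  ultimately show ?thesis using Sfun_alt[of f, OF f0] by simp
qed

theorem Rstat_tendsto_Tfun:
  assumes V: "grid_conv V f" and f: "continuous_on {0..1} f" and f0: "f 0 = 0" and V0: "\<And>n. V n 0 = 0"
    and nl: "nonlinear_halves f"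
  shows "(\<lambda>n. Rstat n (V n)) \<longlonglongrightarrow> Tfun f"
proof -
  have num: "continuous_on {0..1} (\<lambda>t. f t - t * f 1)" by (intro continuous_intros f)
  then have num2: "continuous_on {0..1} (\<lambda>t. (f t - t * f 1)\<^sup>2)" by (intro continuous_intros f)
  note den = continuous_on_denominators(2)[OF f f0]
  note pos = denominators_pos(2)[OF f nl f0]
  obtain B where B: "\<And>t. 0 \<le> t \<Longrightarrow> t \<le> 1 \<Longrightarrow> \<bar>f t - t * f 1\<bar> \<le> B"
    using continuous_on_interval_bounded[OF num] by blast
  have "grid_conv (\<lambda>n k. (V n k - real k / real n * V n n)\<^sup>2 / (dbridge_sq (V n) k / real n + dbridge_sq (rev_seq n (V n)) (n - k) / real n))
      (\<lambda>t. (f t - t * f 1)\<^sup>2 / (bridge_int f t + bridge_int (reversal f) (1 - t)))"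
  proof (rule grid_conv_divide[OF _ grid_conv_denominators(2)[OF V f f0 V0] num2 den pos])
    show "grid_conv (\<lambda>n k. (V n k - real k / real n * V n n)\<^sup>2) (\<lambda>t. (f t - t * f 1)\<^sup>2)"
      unfolding power2_eq_square by (rule grid_conv_mult[OF grid_conv_numerator[OF V] grid_conv_numerator[OF V] B B])
  qed
  moreover have "continuous_on {0..1} (\<lambda>t. (f t - t * f 1)\<^sup>2 / (bridge_int f t + bridge_int (reversal f) (1 - t)))"
    using pos by (intro continuous_on_divide num2 den) (auto simp: less_imp_neq[THEN not_sym])
  ultimately have "(\<lambda>n. (\<Sum>k=1..n. (V n k - real k / real n * V n n)\<^sup>2 / (dbridge_sq (V n) k / real n + dbridge_sq (rev_seq n (V n)) (n - k) / real n)) / real n)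
      \<longlonglongrightarrow> integral {0..1} (\<lambda>t. (f t - t * f 1)\<^sup>2 / (bridge_int f t + bridge_int (reversal f) (1 - t)))"
    by (rule grid_conv_sum_tendsto_integral)
  \<comment> \<open>\<open>Rstat\<close> has unnormalised sums in its denominators. Dividing them by
    \<open>n\<close> multiplies each summand by \<open>n\<close>, and the mean over \<open>k\<close>
    takes this factor back.\<close>
  moreover have "(\<Sum>k=1..n. (V n k - real k / real n * V n n)\<^sup>2 / (dbridge_sq (V n) k / real n + dbridge_sq (rev_seq n (V n)) (n - k) / real n)) / real n
      = Rstat n (V n)" for n
    unfolding Rstat_alt[of "V n", OF V0] sum_divide_distrib
    by (intro sum.cong) (auto simp: add_divide_distrib[symmetric])
  ultimately show ?thesis using Tfun_alt[OF f] by simp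
qed

section \<open>Partial sums of squared residuals\<close>

definition piecewise_lipschitz :: "(real \<Rightarrow> real) \<Rightarrow> real set \<Rightarrow> real \<Rightarrow> bool" where
  "piecewise_lipschitz w D L \<longleftrightarrow> finite D \<and>
     (\<forall>s t. 0 \<le> s \<and> s \<le> t \<and> t \<le> 1 \<and> {s..t} \<inter> D = {} \<longrightarrow> \<bar>w t - w s\<bar> \<le> L * (t - s))"

lemma piecewise_lipschitzD:
  assumes "piecewise_lipschitz w D L" "0 \<le> s" "s \<le> t" "t \<le> 1" "{s..t} \<inter> D = {}"
  shows "\<bar>w t - w s\<bar> \<le> L * (t - s)"
  using assms unfolding piecewise_lipschitz_def by blast

lemma piecewise_lipschitz_bounded:
  assumes w: "piecewise_lipschitz w D L"
  obtains C where "0 < C" "\<And>t. 0 \<le> t \<Longrightarrow> t \<le> 1 \<Longrightarrow> \<bar>w t\<bar> \<le> C"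
proof -
  have fin: "finite D" using w by (simp add: piecewise_lipschitz_def)
  text \<open>On \<open>[0,1] - D\<close> two points with the same set of elements of \<open>D\<close> to their left are not separated by \<open>D\<close>.\<close>
  define cell where "cell c = {t\<in>{0..1} - D. D \<inter> {..<t} = c}" for c
  have "bounded (w ` cell c)" for c
  proof (cases "cell c = {}")
    case False
    then obtain t0 where t0: "t0 \<in> cell c" by blast
    have "\<bar>w t - w t0\<bar> \<le> \<bar>L\<bar>" if t: "t \<in> cell c" for t
    proof -
      have *: "\<bar>w b - w a\<bar> \<le> \<bar>L\<bar>" if "a \<in> cell c" "b \<in> cell c" "a \<le> b" for a b
      proof -
        have "{a..b} \<inter> D = {}"
        proof (rule equals0I)
          fix d assume "d \<in> {a..b} \<inter> D"
          then have d: "a \<le> d" "d \<le> b" "d \<in> D" by auto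
          have ab: "b \<notin> D" "D \<inter> {..<a} = D \<inter> {..<b}" using that unfolding cell_def by blast+
          have "d \<noteq> b" using d(3) ab(1) by blast
          then have "d \<in> D \<inter> {..<b}" using d by simp
          then have "d \<in> D \<inter> {..<a}" by (simp only: ab(2))
          then show False using d(1) by simp
        qed
        then have "\<bar>w b - w a\<bar> \<le> L * (b - a)"
          using that by (intro piecewise_lipschitzD[OF w]) (auto simp: cell_def)
        also have "\<dots> \<le> \<bar>L\<bar> * 1" using that by (intro mult_mono) (auto simp: cell_def)
        finally show ?thesis by simp
      qed
      show ?thesis using *[OF t t0] *[OF t0 t] by (cases "t \<le> t0") (auto simp: abs_minus_commute)
    qed
    then have "\<bar>w t\<bar> \<le> \<bar>w t0\<bar> + \<bar>L\<bar>" if "t \<in> cell c" for t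
      using that by (smt (verit))
    then show ?thesis unfolding bounded_iff by auto
  qed simp
  then have "bounded (\<Union>c\<in>Pow D. w ` cell c)"
    using fin by (intro bounded_UN) auto
  moreover have "bounded (w ` D)" using fin by (intro finite_imp_bounded) auto
  ultimately have "bounded ((\<Union>c\<in>Pow D. w ` cell c) \<union> w ` D)" by simp
  moreover have "w ` {0..1} \<subseteq> (\<Union>c\<in>Pow D. w ` cell c) \<union> w ` D"
  proof
    fix x assume "x \<in> w ` {0..1}"
    then obtain t where t: "t \<in> {0..1}" "x = w t" by blast
    show "x \<in> (\<Union>c\<in>Pow D. w ` cell c) \<union> w ` D"
    proof (cases "t \<in> D")
      case False
      then have "t \<in> cell (D \<inter> {..<t})" using t by (auto simp: cell_def)
      then show ?thesis using t by blast
    qed (use t in blast)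
  qed
  ultimately have "bounded (w ` {0..1})" by (rule bounded_subset)
  then show ?thesis using that unfolding bounded_pos by auto
qed

lemma piecewise_lipschitz_power2:
  assumes w: "piecewise_lipschitz w D L" and C: "\<And>t. 0 \<le> t \<Longrightarrow> t \<le> 1 \<Longrightarrow> \<bar>w t\<bar> \<le> C"
  shows "piecewise_lipschitz (\<lambda>t. (w t)\<^sup>2) D (L * (2 * C))"
  unfolding piecewise_lipschitz_def
proof (intro conjI allI impI)
  show "finite D" using w by (simp add: piecewise_lipschitz_def)
  fix s t assume st: "0 \<le> s \<and> s \<le> t \<and> t \<le> 1 \<and> {s..t} \<inter> D = {}"
  have 1: "\<bar>w t - w s\<bar> \<le> L * (t - s)" using st by (intro piecewise_lipschitzD[OF w]) auto
  have 2: "\<bar>w t + w s\<bar> \<le> 2 * C" using C[of t] C[of s] st by auto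
  have "\<bar>(w t)\<^sup>2 - (w s)\<^sup>2\<bar> = \<bar>w t - w s\<bar> * \<bar>w t + w s\<bar>"
    by (simp add: abs_mult[symmetric] power2_eq_square algebra_simps)
  also have "\<dots> \<le> (L * (t - s)) * (2 * C)"
    using 1 2 by (intro mult_mono) (auto intro: order_trans[OF abs_ge_zero])
  finally show "\<bar>(w t)\<^sup>2 - (w s)\<^sup>2\<bar> \<le> L * (2 * C) * (t - s)" by (simp add: mult_ac)
qed

text \<open>Bounded variation in discrete form, for Riemann sums and for Abel summation. A cell free
  of \<open>D\<close> oscillates by at most \<open>\<bar>L\<bar> / n\<close>; every point of
  \<open>D\<close> meets at most two closed cells, each oscillating by at most
  \<open>2 * C\<close>.\<close>

lemma piecewise_lipschitz_oscillation:
  assumes w: "piecewise_lipschitz w D L"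
  obtains e K where
    "\<And>n i s. 1 \<le> i \<Longrightarrow> i \<le> n \<Longrightarrow> s \<in> {(real i - 1) / real n..real i / real n} \<Longrightarrow> \<bar>w (real i / real n) - w s\<bar> \<le> e n i"
    "\<And>n i. 0 \<le> e n i" "\<And>n. 0 < n \<Longrightarrow> (\<Sum>i=1..n. e n i) \<le> K"
proof -
  have fin: "finite D" using w by (simp add: piecewise_lipschitz_def)
  obtain C where C: "0 < C" "\<And>t. 0 \<le> t \<Longrightarrow> t \<le> 1 \<Longrightarrow> \<bar>w t\<bar> \<le> C"
    using piecewise_lipschitz_bounded[OF w] by blast
  define bad where "bad n = {i\<in>{1..n}. {(real i - 1) / real n..real i / real n} \<inter> D \<noteq> {}}" for n
  define e where "e n i = (if i \<in> bad n then 2 * C else \<bar>L\<bar> / real n)" for n i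
  show ?thesis
  proof (rule that[of e "2 * C * (2 * real (card D)) + \<bar>L\<bar>"])
    fix n i :: nat and s :: real
    assume i: "1 \<le> i" "i \<le> n" and s: "s \<in> {(real i - 1) / real n..real i / real n}"
    have b: "0 \<le> (real i - 1) / real n" "real i / real n \<le> 1" using i by (auto simp: divide_le_eq_1)
    show "\<bar>w (real i / real n) - w s\<bar> \<le> e n i"
    proof (cases "i \<in> bad n")
      case True
      have "0 \<le> s" "s \<le> 1" using b s unfolding atLeastAtMost_iff by linarith+
      then have "\<bar>w (real i / real n)\<bar> \<le> C" "\<bar>w s\<bar> \<le> C" using b by (auto intro!: C)
      then show ?thesis using True unfolding e_def by (simp add: abs_le_iff)
    next
      case False
      then have "{(real i - 1) / real n..real i / real n} \<inter> D = {}" using i by (auto simp: bad_def)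
      moreover have "{s..real i / real n} \<subseteq> {(real i - 1) / real n..real i / real n}"
        using s by (simp add: atLeastatMost_subset_iff)
      ultimately have "{s..real i / real n} \<inter> D = {}" by blast
      then have "\<bar>w (real i / real n) - w s\<bar> \<le> L * (real i / real n - s)"
        using b s by (intro piecewise_lipschitzD[OF w]) auto
      also have "\<dots> \<le> \<bar>L\<bar> * (1 / real n)"
        using s by (intro mult_mono) (auto simp: diff_divide_distrib)
      finally show ?thesis using False by (simp add: e_def)
    qed
  next
    fix n i :: nat show "0 \<le> e n i" using C(1) by (simp add: e_def)
  next
    fix n :: nat assume n: "0 < n"
    \<comment> \<open>A point \<open>d\<close> lies in the closed cell \<open>i\<close> only if
      \<open>i - 1 \<le> d * n \<le> i\<close>, which leaves these two candidates for
      \<open>i\<close>.\<close>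
    have "bad n \<subseteq> (\<Union>d\<in>D. {nat \<lceil>d * real n\<rceil>, nat (\<lfloor>d * real n\<rfloor> + 1)})"
    proof
      fix i assume "i \<in> bad n"
      then obtain d where d: "1 \<le> i" "d \<in> D" "(real i - 1) / real n \<le> d" "d \<le> real i / real n"
        by (auto simp: bad_def)
      then have "real i - 1 \<le> d * real n" "d * real n \<le> real i" using n by (auto simp: field_simps)
      then have "i = nat \<lceil>d * real n\<rceil> \<or> i = nat (\<lfloor>d * real n\<rfloor> + 1)" using d(1) by linarith
      then show "i \<in> (\<Union>d\<in>D. {nat \<lceil>d * real n\<rceil>, nat (\<lfloor>d * real n\<rfloor> + 1)})" using d(2) by blast
    qed
    then have "card (bad n) \<le> card (\<Union>d\<in>D. {nat \<lceil>d * real n\<rceil>, nat (\<lfloor>d * real n\<rfloor> + 1)})"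
      using fin by (intro card_mono) auto
    also have "\<dots> \<le> (\<Sum>d\<in>D. card {nat \<lceil>d * real n\<rceil>, nat (\<lfloor>d * real n\<rfloor> + 1)})"
      by (rule card_UN_le[OF fin])
    also have "\<dots> \<le> (\<Sum>d\<in>D. 2)" by (intro sum_mono) (simp add: card_insert_if)
    finally have card: "card (bad n) \<le> 2 * card D" by simp
    have "(\<Sum>i=1..n. e n i) \<le> (\<Sum>i=1..n. (if i \<in> bad n then 2 * C else 0) + \<bar>L\<bar> / real n)"
      by (intro sum_mono) (simp add: e_def)
    also have "\<dots> = 2 * C * real (card (bad n)) + \<bar>L\<bar>"
    proof -
      have "{1..n} \<inter> bad n = bad n" by (auto simp: bad_def)
      then show ?thesis using n by (simp add: sum.distrib sum.If_cases)
    qed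
    also have "\<dots> \<le> 2 * C * (2 * real (card D)) + \<bar>L\<bar>"
      using card C(1) by (intro add_mono mult_left_mono) auto
    finally show "(\<Sum>i=1..n. e n i) \<le> 2 * C * (2 * real (card D)) + \<bar>L\<bar>" .
  qed
qed

lemma piecewise_lipschitz_continuous_on:
  assumes w: "piecewise_lipschitz w D L" shows "continuous_on ({0..1} - D) w"
  unfolding continuous_on_iff
proof (intro ballI allI impI)
  fix t e :: real assume t: "t \<in> {0..1} - D" and e: "0 < e"
  have "finite D" using w by (simp add: piecewise_lipschitz_def)
  then have "open (- D)" by (simp add: finite_imp_closed open_Compl)
  then obtain r where r: "0 < r" "ball t r \<subseteq> - D" using t unfolding open_contains_ball by auto
  define d where "d = min r (e / (\<bar>L\<bar> + 1))"
  have d: "0 < d" "d \<le> r" using r e by (auto simp: d_def)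
  have "dist (w s) (w t) < e" if s: "s \<in> {0..1} - D" "dist s t < d" for s
  proof -
    have "x \<in> ball t r" if "x \<in> {min s t..max s t}" for x
      using that s(2) d(2) by (auto simp: dist_real_def min_def max_def split: if_splits)
    then have "{min s t..max s t} \<inter> D = {}" using r(2) by blast
    then have "\<bar>w (max s t) - w (min s t)\<bar> \<le> L * (max s t - min s t)"
      using s t by (intro piecewise_lipschitzD[OF w]) auto
    moreover have "\<bar>w (max s t) - w (min s t)\<bar> = dist (w s) (w t)"
      by (cases "s \<le> t") (auto simp: dist_real_def max_def min_def)
    moreover have "max s t - min s t = dist s t" by (auto simp: dist_real_def max_def min_def)
    ultimately have "dist (w s) (w t) \<le> L * dist s t" by simp
    also have "\<dots> \<le> \<bar>L\<bar> * (e / (\<bar>L\<bar> + 1))"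
      using s(2) by (intro mult_mono) (auto simp: d_def)
    also have "\<dots> < e" using e by (simp add: field_simps)
    finally show ?thesis .
  qed
  then show "\<exists>d>0. \<forall>s\<in>{0..1} - D. dist s t < d \<longrightarrow> dist (w s) (w t) < e" using d by blast
qed

text \<open>The function is bounded, and continuous off the negligible set \<open>D\<close>.\<close>

lemma piecewise_lipschitz_integrable:
  assumes w: "piecewise_lipschitz w D L" shows "w integrable_on {0..1}"
proof -
  have fin: "finite D" using w by (simp add: piecewise_lipschitz_def)
  obtain C where C: "0 < C" "\<And>t. 0 \<le> t \<Longrightarrow> t \<le> 1 \<Longrightarrow> \<bar>w t\<bar> \<le> C"
    using piecewise_lipschitz_bounded[OF w] by blast
  have S: "{0..1::real} - D \<in> sets lebesgue"
    using fin by (intro sets.Diff) (auto simp: finite_imp_closed)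
  have sd: "negligible ({0..1} - D - {0..1})" "negligible ({0..1} - ({0..1} - D))"
    using fin by (auto intro!: negligible_finite finite_subset[of _ D])
  have "w integrable_on ({0..1} - D)"
  proof (rule measurable_bounded_by_integrable_imp_integrable)
    show "w \<in> borel_measurable (lebesgue_on ({0..1} - D))"
      by (rule continuous_imp_measurable_on_sets_lebesgue[OF piecewise_lipschitz_continuous_on[OF w] S])
    have "(\<lambda>_. C) integrable_on {0..1::real}" by auto
    then show "(\<lambda>_. C) integrable_on ({0..1} - D)"
      by (rule integrable_spike_set) (use sd in \<open>auto intro: negligible_subset\<close>)
  qed (use C S in auto)
  then show ?thesis
    by (rule integrable_spike_set) (use sd in \<open>auto intro: negligible_subset\<close>)
qed

lemma grid_conv_riemann_piecewise_lipschitz: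
  assumes w: "piecewise_lipschitz w D L"
  shows "grid_conv (\<lambda>n k. (\<Sum>i=1..k. w (real i / real n)) / real n) (\<lambda>t. integral {0..t} w)"
  unfolding grid_conv_def
proof (intro allI impI)
  fix r :: real assume r: "0 < r"
  obtain e K where e: "\<And>n i s. 1 \<le> i \<Longrightarrow> i \<le> n \<Longrightarrow> s \<in> {(real i - 1) / real n..real i / real n} \<Longrightarrow> \<bar>w (real i / real n) - w s\<bar> \<le> e n i"
    "\<And>n i. 0 \<le> e n i" "\<And>n. 0 < n \<Longrightarrow> (\<Sum>i=1..n. e n i) \<le> K"
    using piecewise_lipschitz_oscillation[OF w] by blast
  have "(\<lambda>n. K * (1 / real n)) \<longlonglongrightarrow> K * 0" by (intro tendsto_intros lim_1_over_n)
  then have "\<forall>\<^sub>F n in sequentially. K * (1 / real n) < r" using r by (intro order_tendstoD) auto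
  then show "\<forall>\<^sub>F n in sequentially. \<forall>k\<le>n. \<bar>(\<Sum>i=1..k. w (real i / real n)) / real n - integral {0..real k / real n} w\<bar> < r"
    using eventually_gt_at_top[of 0]
  proof eventually_elim
    case (elim n)
    show ?case
    proof (intro allI impI)
      fix k assume k: "k \<le> n"
      have "\<bar>(\<Sum>i=1..k. w (real i / real n)) / real n - integral {0..real k / real n} w\<bar> \<le> (\<Sum>i=1..k. e n i) / real n"
        by (rule riemann_sum_bound[OF piecewise_lipschitz_integrable[OF w] elim(2) k]) (use e(1) k in auto)
      also have "(\<Sum>i=1..k. e n i) \<le> (\<Sum>i=1..n. e n i)" using e(2) k by (intro sum_mono2) auto
      also have "\<dots> \<le> K" by (rule e(3)[OF elim(2)])
      finally show "\<bar>(\<Sum>i=1..k. w (real i / real n)) / real n - integral {0..real k / real n} w\<bar> < r"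
        using elim by (simp add: divide_right_mono)
    qed
  qed
qed

text \<open>For large \<open>k\<close> the hypothesis applies to \<open>k\<close> itself; the
  finitely many remaining sums have a common bound \<open>M\<close>, which is eventually below
  \<open>r * n\<close>.\<close>

lemma partial_sums_uniformly_small:
  fixes z :: "nat \<Rightarrow> real"
  assumes z: "(\<lambda>n. (\<Sum>i=1..n. z i) / real n) \<longlonglongrightarrow> 0" and r: "0 < r"
  shows "\<forall>\<^sub>F n in sequentially. \<forall>k\<le>n. \<bar>\<Sum>i=1..k. z i\<bar> \<le> r * real n"
proof -
  obtain N where N: "\<And>n. N \<le> n \<Longrightarrow> \<bar>(\<Sum>i=1..n. z i) / real n\<bar> < r"
    using LIMSEQ_D[OF z r] by auto
  define M where "M = (\<Sum>k\<le>N. \<bar>\<Sum>i=1..k. z i\<bar>)"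
  have M: "\<bar>\<Sum>i=1..k. z i\<bar> \<le> M" if "k \<le> N" for k
    unfolding M_def using that by (intro member_le_sum[of k "{..N}" "\<lambda>k. \<bar>\<Sum>i=1..k. z i\<bar>"]) auto
  have "\<forall>\<^sub>F n in sequentially. M / r \<le> real n"
    using filterlim_real_sequentially unfolding filterlim_at_top by blast
  then show ?thesis
  proof eventually_elim
    case (elim n)
    show ?case
    proof (intro allI impI)
      fix k assume k: "k \<le> n"
      show "\<bar>\<Sum>i=1..k. z i\<bar> \<le> r * real n"
      proof (cases "k \<le> N")
        case True
        then show ?thesis using M[OF True] elim r by (simp add: field_simps)
      next
        case False
        then have "\<bar>(\<Sum>i=1..k. z i) / real k\<bar> < r" using N by auto
        then have "\<bar>\<Sum>i=1..k. z i\<bar> \<le> r * real k" using False by (simp add: field_simps)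
        also have "\<dots> \<le> r * real n" using k r by simp
        finally show ?thesis .
      qed
    qed
  qed
qed

text \<open>Abel summation: passing from \<open>k\<close> to \<open>k + 1\<close> costs the
  increment of the weights times the partial sum up to \<open>k\<close>; the boundary term is kept
  apart.\<close>

lemma weighted_sum_Abel_bound:
  fixes w z :: "nat \<Rightarrow> real"
  assumes "\<And>i. 1 \<le> i \<Longrightarrow> i \<le> n \<Longrightarrow> \<bar>w i - w (i - 1)\<bar> \<le> e i" and "\<And>k. k \<le> n \<Longrightarrow> \<bar>\<Sum>i=1..k. z i\<bar> \<le> M" and "k \<le> n"
  shows "\<bar>(\<Sum>i=1..k. w i * z i) - w k * (\<Sum>i=1..k. z i)\<bar> \<le> (\<Sum>i=1..k. e i) * M"
  using assms(3)
proof (induction k)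
  case 0 then show ?case by simp
next
  case (Suc k)
  have "(\<Sum>i=1..Suc k. w i * z i) - w (Suc k) * (\<Sum>i=1..Suc k. z i)
     = ((\<Sum>i=1..k. w i * z i) - w k * (\<Sum>i=1..k. z i)) - (w (Suc k) - w k) * (\<Sum>i=1..k. z i)"
    by (simp add: algebra_simps)
  moreover have "\<bar>(w (Suc k) - w k) * (\<Sum>i=1..k. z i)\<bar> \<le> e (Suc k) * M"
  proof -
    have a: "\<bar>w (Suc k) - w k\<bar> \<le> e (Suc k)" using assms(1)[of "Suc k"] Suc.prems by simp
    have b: "\<bar>\<Sum>i=1..k. z i\<bar> \<le> M" using assms(2) Suc.prems by simp
    show ?thesis unfolding abs_mult using a b by (intro mult_mono) (auto intro: order_trans[OF abs_ge_zero])
  qed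
  moreover have "(\<Sum>i=1..Suc k. e i) * M = (\<Sum>i=1..k. e i) * M + e (Suc k) * M" by (simp add: algebra_simps)
  ultimately show ?case using Suc by linarith
qed

text \<open>In the Abel bound \<open>K\<close> controls the variation of the weights and
  \<open>C\<close> the boundary term, so the uniform smallness of the partial sums of
  \<open>z\<close> relative to \<open>n\<close> carries over.\<close>

lemma grid_conv_weighted_sum:
  fixes z :: "nat \<Rightarrow> real"
  assumes w: "piecewise_lipschitz w D L"
    and z: "(\<lambda>n. (\<Sum>i=1..n. z i) / real n) \<longlonglongrightarrow> 0"
  shows "grid_conv (\<lambda>n k. (\<Sum>i=1..k. w (real i / real n) * z i) / real n) (\<lambda>_. 0)"
proof -
  obtain e K where e: "\<And>n i s. 1 \<le> i \<Longrightarrow> i \<le> n \<Longrightarrow> s \<in> {(real i - 1) / real n..real i / real n} \<Longrightarrow> \<bar>w (real i / real n) - w s\<bar> \<le> e n i"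
    "\<And>n i. 0 \<le> e n i" "\<And>n. 0 < n \<Longrightarrow> (\<Sum>i=1..n. e n i) \<le> K"
    using piecewise_lipschitz_oscillation[OF w] by blast
  obtain C where C: "0 < C" "\<And>t. 0 \<le> t \<Longrightarrow> t \<le> 1 \<Longrightarrow> \<bar>w t\<bar> \<le> C"
    using piecewise_lipschitz_bounded[OF w] by blast
  show ?thesis
  proof (rule grid_convI')
    have "0 \<le> K" using e(2,3)[of 1] by (rule order_trans[OF sum_nonneg]) auto
    then show "0 \<le> K + C" using C by simp
    fix r :: real assume r: "0 < r"
    from partial_sums_uniformly_small[OF z r] eventually_gt_at_top[of 0]
    show "\<forall>\<^sub>F n in sequentially. \<forall>k\<le>n. \<bar>(\<Sum>i=1..k. w (real i / real n) * z i) / real n - 0\<bar> \<le> (K + C) * r"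
    proof eventually_elim
      case (elim n)
      show ?case
      proof (intro allI impI)
        fix k assume k: "k \<le> n"
        have "\<bar>(\<Sum>i=1..k. w (real i / real n) * z i) - w (real k / real n) * (\<Sum>i=1..k. z i)\<bar>
          \<le> (\<Sum>i=1..k. e n i) * (r * real n)"
        proof (rule weighted_sum_Abel_bound[OF _ _ k, where w = "\<lambda>i. w (real i / real n)"])
          fix i assume "1 \<le> i" "i \<le> n"
          then show "\<bar>w (real i / real n) - w (real (i - 1) / real n)\<bar> \<le> e n i"
            by (intro e(1)) (auto simp: divide_right_mono of_nat_diff)
        qed (use elim in auto)
        also have "\<dots> \<le> K * (r * real n)"
        proof (rule mult_right_mono)
          have "(\<Sum>i=1..k. e n i) \<le> (\<Sum>i=1..n. e n i)" using e(2) k by (intro sum_mono2) auto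
          then show "(\<Sum>i=1..k. e n i) \<le> K" using e(3)[OF elim(2)] by linarith
        qed (use r in simp)
        finally have 1: "\<bar>(\<Sum>i=1..k. w (real i / real n) * z i) - w (real k / real n) * (\<Sum>i=1..k. z i)\<bar> \<le> K * (r * real n)" .
        have "\<bar>w (real k / real n)\<bar> \<le> C" using k by (intro C(2)) (auto simp: divide_le_eq_1)
        then have "\<bar>w (real k / real n) * (\<Sum>i=1..k. z i)\<bar> \<le> C * (r * real n)"
          unfolding abs_mult using elim(1) k C(1) by (intro mult_mono) auto
        with 1 have "\<bar>\<Sum>i=1..k. w (real i / real n) * z i\<bar> \<le> K * (r * real n) + C * (r * real n)" by linarith
        also have "\<dots> = (K + C) * r * real n" by (simp add: algebra_simps)
        finally show "\<bar>(\<Sum>i=1..k. w (real i / real n) * z i) / real n - 0\<bar> \<le> (K + C) * r"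
          using elim(2) by (simp add: divide_le_eq)
      qed
    qed
  qed
qed

text \<open>Off \<open>D\<close> the function is continuous, so it has a positive minimum on a small
  interval inside \<open>{s..t}\<close>.\<close>

lemma integral_pos_piecewise_lipschitz:
  assumes w: "piecewise_lipschitz w D L" and pos: "\<And>t. 0 \<le> t \<Longrightarrow> t \<le> 1 \<Longrightarrow> 0 < w t"
    and st: "0 \<le> s" "s < t" "t \<le> 1"
  shows "0 < integral {s..t} w"
proof -
  have fin: "finite D" using w by (simp add: piecewise_lipschitz_def)
  have "infinite ({s<..<t} - D)" using fin st by (simp add: infinite_Ioo)
  then obtain x where x: "x \<in> {s<..<t} - D" using infinite_imp_nonempty by blast
  have "open ({s<..<t} - D)" using fin by (simp add: finite_imp_closed open_Diff)
  then obtain r where r: "0 < r" "cball x r \<subseteq> {s<..<t} - D" using x unfolding open_contains_cball by blast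
  have sub: "{x - r..x + r} \<subseteq> {s<..<t} - D" using r(2) by (simp add: cball_eq_atLeastAtMost)
  have int: "w integrable_on {s..t}"
    using st by (intro integrable_on_subinterval[OF piecewise_lipschitz_integrable[OF w]]) auto
  have "continuous_on {x - r..x + r} w"
    using sub st by (intro continuous_on_subset[OF piecewise_lipschitz_continuous_on[OF w]]) auto
  then have "\<exists>y\<in>{x - r..x + r}. \<forall>z\<in>{x - r..x + r}. w y \<le> w z"
    using r(1) by (intro continuous_attains_inf) auto
  then obtain y where y: "y \<in> {x - r..x + r}" "\<And>z. z \<in> {x - r..x + r} \<Longrightarrow> w y \<le> w z" by blast
  have wy: "0 < w y" using y(1) sub st by (intro pos) auto
  have ends: "s \<le> x - r" "x + r \<le> t"
    using subsetD[OF sub, of "x - r"] subsetD[OF sub, of "x + r"] r(1) by auto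
  have int': "w integrable_on {x - r..x + r}"
    using ends by (intro integrable_on_subinterval[OF int]) auto
  have "0 < w y * (2 * r)" using wy r(1) by simp
  also have "\<dots> = integral {x - r..x + r} (\<lambda>_. w y)" using r(1) by simp
  also have "\<dots> \<le> integral {x - r..x + r} w"
    using int' y(2) by (intro integral_le) auto
  also have "\<dots> \<le> integral {s..t} w"
    using ends st pos int int' by (intro integral_subset_le) (auto intro!: less_imp_le)
  finally show ?thesis .
qed

section \<open>Squared residuals in the model with a shift\<close>

text \<open>A unit step at \<open>\<theta>\<close>, centred by its mean, equals
  \<open>- (1 - \<theta>)\<close> before and \<open>\<theta>\<close> after the change; this is the
  integral of its square up to \<open>t\<close>. It is also the variance of
  \<open>shift_path\<close> at \<open>t\<close>, with \<open>\<theta>\<close> as its change point,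
  for a Wiener process.\<close>

definition shift_var :: "real \<Rightarrow> real \<Rightarrow> real" where
  "shift_var \<theta> t = (1 - \<theta>)\<^sup>2 * min t \<theta> + \<theta>\<^sup>2 * max (t - \<theta>) 0"

text \<open>For \<open>k \<le> n\<close> this is the variance of \<open>Vstar\<close> at
  \<open>k\<close> given the data.\<close>

definition resid_sq :: "real \<Rightarrow> (nat \<Rightarrow> real) \<Rightarrow> (nat \<Rightarrow> nat) \<Rightarrow> (real \<Rightarrow> real)
     \<Rightarrow> (nat \<Rightarrow> 'a \<Rightarrow> real) \<Rightarrow> 'a \<Rightarrow> nat \<Rightarrow> nat \<Rightarrow> real" where
  "resid_sq \<mu> \<delta> \<tau> \<sigma> \<epsilon> \<omega> n k = (\<Sum>i=1..k. (Yobs \<mu> \<delta> \<tau> \<sigma> \<epsilon> n i \<omega>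
                 - (\<Sum>j=1..n. Yobs \<mu> \<delta> \<tau> \<sigma> \<epsilon> n j \<omega>) / real n)\<^sup>2)"

lemma four_term_bound:
  fixes a b c d :: real
  assumes "\<bar>a\<bar> \<le> a'" "\<bar>b\<bar> \<le> b'" "\<bar>c\<bar> \<le> c'" "\<bar>d\<bar> \<le> d'"
  shows "\<bar>a + 2 * b - 2 * c - 2 * d\<bar> \<le> a' + 2 * b' + 2 * c' + 2 * d'"
  using assms by linarith

lemma sum_if_le:
  fixes x :: "nat \<Rightarrow> real"
  shows "(\<Sum>i=1..k. if m < i then x i else 0) = (\<Sum>i=1..k. x i) - (\<Sum>i=1..min k m. x i)"
proof -
  have "(\<Sum>i=1..k. if m < i then x i else 0) = (\<Sum>i\<in>{1..k} \<inter> {i. m < i}. x i)"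
    by (simp add: sum.inter_restrict)
  moreover have "(\<Sum>i=1..k. x i) = (\<Sum>i=1..min k m. x i) + (\<Sum>i\<in>{1..k} \<inter> {i. m < i}. x i)"
  proof -
    have "{1..k} = {1..min k m} \<union> ({1..k} \<inter> {i. m < i})" by auto
    then show ?thesis by (subst sum.union_disjoint[symmetric]) auto
  qed
  ultimately show ?thesis by simp
qed

text \<open>The identity is exact for every \<open>n\<close>, with \<open>m / n\<close> as the
  change point, so that only the limit of \<open>m / n\<close> remains to be taken.\<close>

lemma shift_contrast_sum_sq:
  assumes n: "0 < n" and m: "m \<le> n" and k: "k \<le> n"
  shows "(\<Sum>i=1..k. (d * ((if m < i then 1 else 0) - (real n - real m) / real n))\<^sup>2) / real n
      = d\<^sup>2 * shift_var (real m / real n) (real k / real n)"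
proof -
  define \<theta> where "\<theta> = real m / real n"
  have q: "(real n - real m) / real n = 1 - \<theta>" using n by (simp add: \<theta>_def diff_divide_distrib)
  have "(d * ((if m < i then 1 else 0) - (real n - real m) / real n))\<^sup>2
      = d\<^sup>2 * (1 - \<theta>)\<^sup>2 + (if m < i then d\<^sup>2 * (\<theta>\<^sup>2 - (1 - \<theta>)\<^sup>2) else 0)" for i
    unfolding q by (simp add: power2_eq_square algebra_simps)
  then have "(\<Sum>i=1..k. (d * ((if m < i then 1 else 0) - (real n - real m) / real n))\<^sup>2)
     = real k * (d\<^sup>2 * (1 - \<theta>)\<^sup>2) + (real k - real (min k m)) * (d\<^sup>2 * (\<theta>\<^sup>2 - (1 - \<theta>)\<^sup>2))"
    by (simp only: sum.distrib sum_if_le) (simp add: left_diff_distrib)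
  also have "\<dots> = d\<^sup>2 * ((1 - \<theta>)\<^sup>2 * real (min k m) + \<theta>\<^sup>2 * (real k - real (min k m)))"
    by (simp add: algebra_simps)
  finally have eq: "(\<Sum>i=1..k. (d * ((if m < i then 1 else 0) - (real n - real m) / real n))\<^sup>2)
     = d\<^sup>2 * ((1 - \<theta>)\<^sup>2 * real (min k m) + \<theta>\<^sup>2 * (real k - real (min k m)))" .
  have mn: "min (real k / real n) \<theta> = real (min k m) / real n"
    using n by (simp add: \<theta>_def min_def divide_le_cancel)
  have mx: "max (real k / real n - \<theta>) 0 = (real k - real (min k m)) / real n"
    using n by (auto simp: \<theta>_def max_def min_def diff_divide_distrib[symmetric] divide_le_0_iff)
  show ?thesis
    unfolding eq shift_var_def \<theta>_def[symmetric] mn mx by (simp add: add_divide_distrib ring_distribs)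
qed

text \<open>Each residual is a centred step \<open>b\<close> plus noise \<open>x\<close> minus the
  noise mean \<open>z\<close>. The squares of \<open>x\<close> and of \<open>b\<close> give the two
  limits; every other term of the expansion contains a partial sum of \<open>x\<close> divided by
  \<open>n\<close>, which is uniformly small.\<close>

lemma grid_conv_resid_sq:
  assumes \<sigma>: "piecewise_lipschitz \<sigma> D L"
    and e1: "(\<lambda>n. (\<Sum>i=1..n. \<epsilon> i \<omega>) / real n) \<longlonglongrightarrow> 0"
    and e2: "(\<lambda>n. (\<Sum>i=1..n. (\<epsilon> i \<omega>)\<^sup>2) / real n) \<longlonglongrightarrow> 1"
    and \<tau>: "\<forall>\<^sub>F n in sequentially. \<tau> n \<le> n" and \<delta>: "\<And>n. \<bar>\<delta> n\<bar> \<le> \<Delta>"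
    and \<Lambda>: "grid_conv (\<lambda>n k. (\<delta> n)\<^sup>2 * shift_var (real (\<tau> n) / real n) (real k / real n)) \<Lambda>"
  shows "grid_conv (\<lambda>n k. resid_sq \<mu> \<delta> \<tau> \<sigma> \<epsilon> \<omega> n k / real n) (\<lambda>t. integral {0..t} (\<lambda>s. (\<sigma> s)\<^sup>2) + \<Lambda> t)"
proof -
  obtain C where C: "0 < C" "\<And>t. 0 \<le> t \<Longrightarrow> t \<le> 1 \<Longrightarrow> \<bar>\<sigma> t\<bar> \<le> C"
    using piecewise_lipschitz_bounded[OF \<sigma>] by blast
  note \<sigma>2 = piecewise_lipschitz_power2[OF \<sigma> C(2)]
  define x where "x n i = \<sigma> (real i / real n) * \<epsilon> i \<omega>" for n i :: nat
  define X where "X n k = (\<Sum>i=1..k. x n i)" for n k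
  define b where "b n i = \<delta> n * ((if \<tau> n < i then 1 else 0) - (real n - real (\<tau> n)) / real n)" for n i
  have X: "grid_conv (\<lambda>n k. X n k / real n) (\<lambda>_. 0)"
    unfolding X_def x_def by (rule grid_conv_weighted_sum[OF \<sigma> e1])
  have X2: "grid_conv (\<lambda>n k. (\<Sum>i=1..k. (x n i)\<^sup>2) / real n) (\<lambda>t. integral {0..t} (\<lambda>s. (\<sigma> s)\<^sup>2))"
  proof -
    have "(\<lambda>n. (\<Sum>i=1..n. (\<epsilon> i \<omega>)\<^sup>2 - 1) / real n) \<longlonglongrightarrow> 0"
    proof (rule Lim_transform_eventually)
      show "(\<lambda>n. (\<Sum>i=1..n. (\<epsilon> i \<omega>)\<^sup>2) / real n - 1) \<longlonglongrightarrow> 0" using tendsto_diff[OF e2 tendsto_const[of 1]] by simp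
      show "\<forall>\<^sub>F n in sequentially. (\<Sum>i=1..n. (\<epsilon> i \<omega>)\<^sup>2) / real n - 1 = (\<Sum>i=1..n. (\<epsilon> i \<omega>)\<^sup>2 - 1) / real n"
        using eventually_gt_at_top[of 0] by eventually_elim (simp add: sum_subtractf diff_divide_distrib)
    qed
    from grid_conv_add[OF grid_conv_weighted_sum[OF \<sigma>2 this] grid_conv_riemann_piecewise_lipschitz[OF \<sigma>2]]
    have "grid_conv (\<lambda>n k. (\<Sum>i=1..k. (\<sigma> (real i / real n))\<^sup>2 * ((\<epsilon> i \<omega>)\<^sup>2 - 1)) / real n
         + (\<Sum>i=1..k. (\<sigma> (real i / real n))\<^sup>2) / real n) (\<lambda>t. integral {0..t} (\<lambda>s. (\<sigma> s)\<^sup>2))" by simp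
    moreover have "(\<Sum>i=1..k. (\<sigma> (real i / real n))\<^sup>2 * ((\<epsilon> i \<omega>)\<^sup>2 - 1)) / real n
         + (\<Sum>i=1..k. (\<sigma> (real i / real n))\<^sup>2) / real n = (\<Sum>i=1..k. (x n i)\<^sup>2) / real n" for n k
      unfolding add_divide_distrib[symmetric] sum.distrib[symmetric]
      by (simp add: x_def power_mult_distrib right_diff_distrib)
    ultimately show ?thesis by simp
  qed
  define rest where "rest n k = resid_sq \<mu> \<delta> \<tau> \<sigma> \<epsilon> \<omega> n k / real n
      - (\<Sum>i=1..k. (x n i)\<^sup>2) / real n - (\<delta> n)\<^sup>2 * shift_var (real (\<tau> n) / real n) (real k / real n)" for n k
  have \<Delta>: "0 \<le> \<Delta>" using \<delta>[of 0] by linarith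
  have "grid_conv rest (\<lambda>_. 0)"
  proof (rule grid_convI')
    \<comment> \<open>The constant collects \<open>1\<close> from \<open>z\<^sup>2\<close>,
      \<open>6 * \<Delta>\<close> from \<open>b * x\<close>, \<open>2 * \<Delta>\<close> from
      \<open>z * b\<close> and \<open>2\<close> from \<open>z * x\<close>.\<close>
    show "0 \<le> 3 + 8 * \<Delta>" using \<Delta> by simp
    fix r' :: real assume r': "0 < r'"
    define r where "r = min r' 1"
    have r: "0 < r" "r \<le> 1" "r \<le> r'" using r' by (auto simp: r_def)
    from grid_convD[OF X r(1)] \<tau> eventually_gt_at_top[of 0]
    show "\<forall>\<^sub>F n in sequentially. \<forall>k\<le>n. \<bar>rest n k - 0\<bar> \<le> (3 + 8 * \<Delta>) * r'"
    proof eventually_elim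
      case (elim n)
      define z where "z = X n n / real n"
      define p where "p = (real n - real (\<tau> n)) / real n"
      have p: "0 \<le> p" "p \<le> 1" using elim by (auto simp: p_def field_simps)
      have Xr: "\<bar>X n k / real n\<bar> \<le> r" if "k \<le> n" for k using elim(1) that by (simp add: less_imp_le)
      have zr: "\<bar>z\<bar> \<le> r" unfolding z_def by (rule Xr) simp
      have mean: "(\<Sum>j=1..n. Yobs \<mu> \<delta> \<tau> \<sigma> \<epsilon> n j \<omega>) / real n = \<mu> + \<delta> n * p + z"
      proof -
        have "(\<Sum>j=1..n. Yobs \<mu> \<delta> \<tau> \<sigma> \<epsilon> n j \<omega>) = real n * \<mu> + (\<Sum>j=1..n. if \<tau> n < j then \<delta> n else 0) + X n n"
          by (simp add: Yobs_def X_def x_def sum.distrib)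
        also have "(\<Sum>j=1..n. if \<tau> n < j then \<delta> n else 0) = (real n - real (\<tau> n)) * \<delta> n"
          using elim(2) unfolding sum_if_le by (simp add: min_absorb2 left_diff_distrib)
        finally show ?thesis using elim(3) by (simp add: z_def p_def add_divide_distrib mult.commute)
      qed
      have res: "Yobs \<mu> \<delta> \<tau> \<sigma> \<epsilon> n i \<omega> - (\<Sum>j=1..n. Yobs \<mu> \<delta> \<tau> \<sigma> \<epsilon> n j \<omega>) / real n = b n i + x n i - z" for i
        unfolding mean by (simp add: Yobs_def b_def x_def p_def algebra_simps)
      show ?case
      proof (intro allI impI)
        fix k assume k: "k \<le> n"
        \<comment> \<open>Since \<open>b\<close> takes only two values, the cross term is a
          combination of the partial sums of \<open>x\<close> at \<open>k\<close> and at
          \<open>min k (\<tau> n)\<close>.\<close>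
        have bx: "(\<Sum>i=1..k. b n i * x n i) = \<delta> n * (X n k - X n (min k (\<tau> n)) - p * X n k)"
        proof -
          have "b n i * x n i = \<delta> n * ((if \<tau> n < i then x n i else 0) - p * x n i)" for i
            by (simp add: b_def p_def algebra_simps)
          then show ?thesis
            by (simp only: sum_distrib_left[symmetric] sum_subtractf sum_if_le X_def)
        qed
        have sb: "(\<Sum>i=1..k. b n i) = \<delta> n * (real k - real (min k (\<tau> n)) - p * real k)"
        proof -
          have "b n i = \<delta> n * ((if \<tau> n < i then 1 else 0) - p)" for i
            by (simp add: b_def p_def)
          then have "(\<Sum>i=1..k. b n i) = \<delta> n * ((\<Sum>i=1..k. 1) - (\<Sum>i=1..min k (\<tau> n). 1) - (\<Sum>i=1..k. p))"
            by (simp only: sum_distrib_left[symmetric] sum_subtractf sum_if_le)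
          then show ?thesis by (simp add: mult.commute)
        qed
        have "resid_sq \<mu> \<delta> \<tau> \<sigma> \<epsilon> \<omega> n k
          = (\<Sum>i=1..k. (b n i)\<^sup>2 + (x n i)\<^sup>2 + z\<^sup>2 + 2 * (b n i * x n i) - 2 * z * b n i - 2 * z * x n i)"
          unfolding resid_sq_def res by (intro sum.cong) (simp_all add: power2_eq_square algebra_simps)
        also have "\<dots> = (\<Sum>i=1..k. (b n i)\<^sup>2) + (\<Sum>i=1..k. (x n i)\<^sup>2) + real k * z\<^sup>2 + 2 * (\<Sum>i=1..k. b n i * x n i)
            - 2 * z * (\<Sum>i=1..k. b n i) - 2 * z * X n k"
          by (simp add: sum.distrib sum_subtractf sum_distrib_left X_def)
        finally have "resid_sq \<mu> \<delta> \<tau> \<sigma> \<epsilon> \<omega> n k / real n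
          = (\<Sum>i=1..k. (b n i)\<^sup>2) / real n + (\<Sum>i=1..k. (x n i)\<^sup>2) / real n + real k / real n * z\<^sup>2
            + 2 * ((\<Sum>i=1..k. b n i * x n i) / real n)
            - 2 * z * ((\<Sum>i=1..k. b n i) / real n) - 2 * z * (X n k / real n)"
          by (simp add: add_divide_distrib diff_divide_distrib)
        moreover have "(\<Sum>i=1..k. (b n i)\<^sup>2) / real n = (\<delta> n)\<^sup>2 * shift_var (real (\<tau> n) / real n) (real k / real n)"
          unfolding b_def by (rule shift_contrast_sum_sq[OF elim(3,2) k])
        ultimately have rest: "rest n k = real k / real n * z\<^sup>2 + 2 * ((\<Sum>i=1..k. b n i * x n i) / real n)
            - 2 * z * ((\<Sum>i=1..k. b n i) / real n) - 2 * z * (X n k / real n)"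
          unfolding rest_def by simp
        have t: "0 \<le> real k / real n" "real k / real n \<le> 1" using k by (auto simp: divide_le_eq_1)
        have "\<bar>real k / real n * z\<^sup>2\<bar> \<le> 1 * r"
          unfolding abs_mult
        proof (intro mult_mono)
          have "\<bar>z\<^sup>2\<bar> = \<bar>z\<bar> * \<bar>z\<bar>" by (simp add: power2_eq_square)
          also have "\<dots> \<le> r * 1" using zr r by (intro mult_mono) auto
          finally show "\<bar>z\<^sup>2\<bar> \<le> r" by simp
        qed (use t in auto)
        moreover have "\<bar>(\<Sum>i=1..k. b n i * x n i) / real n\<bar> \<le> \<Delta> * (3 * r)"
        proof -
          have "\<bar>p * (X n k / real n)\<bar> \<le> 1 * r"
            unfolding abs_mult using Xr[OF k] p by (intro mult_mono) auto
          then have "\<bar>X n k / real n - X n (min k (\<tau> n)) / real n - p * (X n k / real n)\<bar> \<le> 3 * r"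
            using Xr[OF k] Xr[of "min k (\<tau> n)"] k by (smt (verit) min.coboundedI1)
          then have "\<bar>\<delta> n\<bar> * \<bar>X n k / real n - X n (min k (\<tau> n)) / real n - p * (X n k / real n)\<bar> \<le> \<Delta> * (3 * r)"
            using \<delta>[of n] \<Delta> by (intro mult_mono) auto
          moreover have "(\<Sum>i=1..k. b n i * x n i) / real n
              = \<delta> n * (X n k / real n - X n (min k (\<tau> n)) / real n - p * (X n k / real n))"
            unfolding bx by (simp add: right_diff_distrib diff_divide_distrib)
          ultimately show ?thesis by (simp add: abs_mult)
        qed
        moreover have "\<bar>z * ((\<Sum>i=1..k. b n i) / real n)\<bar> \<le> r * \<Delta>"
        proof -
          have "\<bar>(real k - real (min k (\<tau> n))) / real n - p * (real k / real n)\<bar> \<le> 1"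
          proof -
            have "0 \<le> p * (real k / real n)" using p t by simp
            moreover have "p * (real k / real n) \<le> 1" by (rule mult_le_one) (use p t in auto)
            moreover have "0 \<le> (real k - real (min k (\<tau> n))) / real n" "(real k - real (min k (\<tau> n))) / real n \<le> 1"
              using k elim(3) by (auto simp: divide_le_eq_1 min_def)
            ultimately show ?thesis by linarith
          qed
          then have "\<bar>\<delta> n\<bar> * \<bar>(real k - real (min k (\<tau> n))) / real n - p * (real k / real n)\<bar> \<le> \<Delta> * 1"
            using \<delta>[of n] \<Delta> by (intro mult_mono) auto
          moreover have "(\<Sum>i=1..k. b n i) / real n
              = \<delta> n * ((real k - real (min k (\<tau> n))) / real n - p * (real k / real n))"
            unfolding sb by (simp add: right_diff_distrib diff_divide_distrib)
          ultimately have "\<bar>(\<Sum>i=1..k. b n i) / real n\<bar> \<le> \<Delta>"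
            by (simp only: abs_mult mult_1_right)
          then show ?thesis unfolding abs_mult using zr r by (intro mult_mono) auto
        qed
        moreover have "\<bar>z * (X n k / real n)\<bar> \<le> r * 1"
          unfolding abs_mult using zr Xr[OF k] r by (intro mult_mono) auto
        ultimately have "\<bar>rest n k - 0\<bar> \<le> 1 * r + 2 * (\<Delta> * (3 * r)) + 2 * (r * \<Delta>) + 2 * (r * 1)"
          unfolding rest mult.assoc diff_0_right by (intro four_term_bound)
        also have "\<dots> = (3 + 8 * \<Delta>) * r" by (simp add: algebra_simps)
        also have "\<dots> \<le> (3 + 8 * \<Delta>) * r'" using r \<Delta> by (intro mult_left_mono) auto
        finally show "\<bar>rest n k - 0\<bar> \<le> (3 + 8 * \<Delta>) * r'" .
      qed
    qed
  qed
  from grid_conv_add[OF grid_conv_add[OF this X2] \<Lambda>] show ?thesis unfolding rest_def by simp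
qed

lemma shift_var_0: "0 \<le> \<theta> \<Longrightarrow> shift_var \<theta> 0 = 0"
  by (simp add: shift_var_def)

lemma shift_var_bounds:
  assumes "0 \<le> \<theta>" "\<theta> \<le> 1" "0 \<le> t" "t \<le> 1" shows "0 \<le> shift_var \<theta> t" "shift_var \<theta> t \<le> 2"
proof -
  have "0 \<le> (1 - \<theta>)\<^sup>2 * min t \<theta>" "0 \<le> \<theta>\<^sup>2 * max (t - \<theta>) 0"
    using assms by auto
  moreover have "(1 - \<theta>)\<^sup>2 * min t \<theta> \<le> 1 * 1" "\<theta>\<^sup>2 * max (t - \<theta>) 0 \<le> 1 * 1"
    by (rule mult_mono; use assms in \<open>auto simp: power_le_one\<close>)+
  ultimately
  show "0 \<le> shift_var \<theta> t" "shift_var \<theta> t \<le> 2" unfolding shift_var_def by linarith+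
qed

lemma grid_conv_shift_var:
  assumes m: "\<And>n. m n = nat \<lfloor>real n * \<zeta>\<rfloor>" and \<zeta>: "0 < \<zeta>" "\<zeta> < 1"
  shows "grid_conv (\<lambda>n k. shift_var (real (m n) / real n) (real k / real n)) (shift_var \<zeta>)"
proof -
  have gc: "grid_conv (\<lambda>n k. real (m n) / real n) (\<lambda>_. \<zeta>)"
    unfolding grid_conv_def
  proof (intro allI impI)
    fix e :: real assume e: "0 < e"
    have "\<forall>\<^sub>F n in sequentially. 1 / real n < e" using lim_1_over_n e by (rule order_tendstoD)
    then show "\<forall>\<^sub>F n in sequentially. \<forall>k\<le>n. \<bar>real (m n) / real n - \<zeta>\<bar> < e"
      using eventually_gt_at_top[of 0]
    proof eventually_elim
      case (elim n)
      have "0 \<le> real n * \<zeta>" using \<zeta> by simp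
      then have "\<bar>real (m n) - real n * \<zeta>\<bar> \<le> 1" unfolding m by linarith
      then have "\<bar>real (m n) - real n * \<zeta>\<bar> / real n \<le> 1 / real n" by (rule divide_right_mono) simp
      moreover have "real (m n) / real n - \<zeta> = (real (m n) - real n * \<zeta>) / real n" using elim by (simp add: diff_divide_distrib)
      ultimately show ?case using elim by simp
    qed
  qed
  have id: "grid_conv (\<lambda>n k. real k / real n) (\<lambda>t. t)" by (rule grid_conv_grid)
  \<comment> \<open>Minimum and maximum are expressed by absolute values, for which
    \<open>grid_conv\<close> has a closure rule.\<close>
  have max: "max x y = (x + y + \<bar>x - y\<bar>) / 2" and min: "min x y = (x + y - \<bar>x - y\<bar>) / 2" for x y :: real
    by (auto simp: max_def min_def)
  have half: "grid_conv (\<lambda>n k. a n k / 2) (\<lambda>t. g t / 2)" if "grid_conv a g" for a g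
    unfolding grid_conv_def
  proof (intro allI impI)
    fix e :: real assume "0 < e"
    from grid_convD[OF that this] show "\<forall>\<^sub>F n in sequentially. \<forall>k\<le>n. \<bar>a n k / 2 - g (real k / real n) / 2\<bar> < e"
      by (rule eventually_mono) (auto simp: diff_divide_distrib[symmetric] intro: le_less_trans[rotated])
  qed
  have mn: "grid_conv (\<lambda>n k. min (real k / real n) (real (m n) / real n)) (\<lambda>t. min t \<zeta>)"
    unfolding min by (intro half grid_conv_add grid_conv_diff grid_conv_abs gc id)
  have mx: "grid_conv (\<lambda>n k. max (real k / real n - real (m n) / real n) 0) (\<lambda>t. max (t - \<zeta>) 0)"
    unfolding max by (intro half grid_conv_add grid_conv_diff grid_conv_abs gc id grid_conv_grid[of "\<lambda>_. 0"])
  have sq: "grid_conv (\<lambda>n k. (real (m n) / real n)\<^sup>2) (\<lambda>_. \<zeta>\<^sup>2)"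
    unfolding power2_eq_square by (rule grid_conv_mult[OF gc gc, of 1 1]) (use \<zeta> in auto)
  have gc': "grid_conv (\<lambda>n k. 1 - real (m n) / real n) (\<lambda>_. 1 - \<zeta>)"
    by (intro grid_conv_diff gc grid_conv_grid[of "\<lambda>_. 1"])
  have sq': "grid_conv (\<lambda>n k. (1 - real (m n) / real n)\<^sup>2) (\<lambda>_. (1 - \<zeta>)\<^sup>2)"
    unfolding power2_eq_square by (rule grid_conv_mult[OF gc' gc', of 1 1]) (use \<zeta> in auto)
  show ?thesis
    unfolding shift_var_def[abs_def]
  proof (intro grid_conv_add)
    show "grid_conv (\<lambda>n k. (1 - real (m n) / real n)\<^sup>2 * min (real k / real n) (real (m n) / real n)) (\<lambda>t. (1 - \<zeta>)\<^sup>2 * min t \<zeta>)"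
      by (rule grid_conv_mult[OF sq' mn, of 1 1]) (use \<zeta> in \<open>auto simp: power_le_one min_def\<close>)
    show "grid_conv (\<lambda>n k. (real (m n) / real n)\<^sup>2 * max (real k / real n - real (m n) / real n) 0) (\<lambda>t. \<zeta>\<^sup>2 * max (t - \<zeta>) 0)"
      by (rule grid_conv_mult[OF sq mx, of 1 1]) (use \<zeta> in \<open>auto simp: power_le_one max_def\<close>)
  qed
qed

lemma grid_conv_vanishing_shift:
  assumes "\<delta> \<longlonglongrightarrow> 0" and "\<forall>\<^sub>F n in sequentially. \<tau> n \<le> n"
  shows "grid_conv (\<lambda>n k. (\<delta> n)\<^sup>2 * shift_var (real (\<tau> n) / real n) (real k / real n)) (\<lambda>_. 0)"
  unfolding grid_conv_def
proof (intro allI impI)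
  fix e :: real assume e: "0 < e"
  have "(\<lambda>n. (\<delta> n)\<^sup>2 * 2) \<longlonglongrightarrow> 0\<^sup>2 * 2" by (intro tendsto_intros assms)
  then have "\<forall>\<^sub>F n in sequentially. (\<delta> n)\<^sup>2 * 2 < e" using e by (intro order_tendstoD) auto
  then show "\<forall>\<^sub>F n in sequentially. \<forall>k\<le>n. \<bar>(\<delta> n)\<^sup>2 * shift_var (real (\<tau> n) / real n) (real k / real n) - 0\<bar> < e"
    using assms(2)
  proof eventually_elim
    case (elim n)
    show ?case
    proof (intro allI impI)
      fix k assume "k \<le> n"
      then have b: "0 \<le> shift_var (real (\<tau> n) / real n) (real k / real n)" "shift_var (real (\<tau> n) / real n) (real k / real n) \<le> 2"
        using elim(2) by (auto intro!: shift_var_bounds simp: divide_le_eq_1)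
      then have "(\<delta> n)\<^sup>2 * shift_var (real (\<tau> n) / real n) (real k / real n) \<le> (\<delta> n)\<^sup>2 * 2"
        by (intro mult_left_mono) auto
      then show "\<bar>(\<delta> n)\<^sup>2 * shift_var (real (\<tau> n) / real n) (real k / real n) - 0\<bar> < e"
        using elim(1) b(1) by simp
    qed
  qed
qed

section \<open>Measurability of the limit functionals\<close>

text \<open>The law \<open>distr N borel\<close> of a functional is meaningful only if the
  functional is measurable. The properties collected here suffice for this, and the limit processes
  inherit them from \<open>wiener\<close>.\<close>

definition continuous_process :: "'b measure \<Rightarrow> ('b \<Rightarrow> real \<Rightarrow> real) \<Rightarrow> bool" where
  "continuous_process N G \<longleftrightarrow> (\<forall>t\<in>{0..1}. (\<lambda>\<nu>. G \<nu> t) \<in> borel_measurable N) \<and>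
     (\<forall>\<nu>\<in>space N. continuous_on {0..1} (G \<nu>) \<and> G \<nu> 0 = 0)"

lemma continuous_processD:
  assumes "continuous_process N G"
  shows "0 \<le> t \<Longrightarrow> t \<le> 1 \<Longrightarrow> (\<lambda>\<nu>. G \<nu> t) \<in> borel_measurable N"
    and "\<nu> \<in> space N \<Longrightarrow> continuous_on {0..1} (G \<nu>)" and "\<nu> \<in> space N \<Longrightarrow> G \<nu> 0 = 0"
  using assms unfolding continuous_process_def by auto

lemma continuous_process_reversal:
  assumes G: "continuous_process N G" shows "continuous_process N (\<lambda>\<nu>. reversal (G \<nu>))"
  unfolding continuous_process_def
proof (intro conjI ballI)
  fix t :: real assume "t \<in> {0..1}"
  then show "(\<lambda>\<nu>. reversal (G \<nu>) t) \<in> borel_measurable N"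
    unfolding reversal_def by (intro borel_measurable_diff continuous_processD(1)[OF G]) auto
next
  fix \<nu> assume "\<nu> \<in> space N"
  then show "continuous_on {0..1} (reversal (G \<nu>))" "reversal (G \<nu>) 0 = 0"
    by (auto intro!: continuous_on_reversal continuous_processD(2)[OF G] simp: reversal_0)
qed

lemma borel_measurable_bridge:
  assumes G: "continuous_process N G" and t: "0 \<le> t" "t \<le> 1" and v: "0 \<le> v" "v \<le> 1"
  shows "(\<lambda>\<nu>. bridge (G \<nu>) t v) \<in> borel_measurable N"
  unfolding bridge_def using t v
  by (intro borel_measurable_diff borel_measurable_times borel_measurable_const continuous_processD(1)[OF G])
     (auto simp: mult_le_one)

lemma continuous_on_bridge:
  assumes f: "continuous_on {0..1} f" and t: "0 \<le> t" "t \<le> 1"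
  shows "continuous_on {0..1} (bridge f t)"
proof -
  have "continuous_on {0..1} (\<lambda>v. f (v * t))"
    by (rule continuous_on_compose2[OF f]) (use t in \<open>auto intro!: continuous_intros simp: mult_le_one\<close>)
  then show ?thesis unfolding bridge_def[abs_def] by (intro continuous_intros)
qed

lemma borel_measurable_Max_grid:
  fixes a :: "nat \<Rightarrow> 'b \<Rightarrow> real"
  assumes "\<And>k. 1 \<le> k \<Longrightarrow> k \<le> n \<Longrightarrow> a k \<in> borel_measurable N"
  shows "(\<lambda>\<nu>. Max (insert 0 {a k \<nu> |k. 1 \<le> k \<and> k \<le> n})) \<in> borel_measurable N"
proof -
  have "insert 0 {a k \<nu> |k. 1 \<le> k \<and> k \<le> n} = (\<lambda>k. if k = 0 then 0 else a k \<nu>) ` {0..n}" for \<nu>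
  proof (rule set_eqI, rule iffI)
    fix x assume "x \<in> insert 0 {a k \<nu> |k. 1 \<le> k \<and> k \<le> n}"
    then consider "x = 0" | k where "1 \<le> k" "k \<le> n" "x = a k \<nu>" by blast
    then show "x \<in> (\<lambda>k. if k = 0 then 0 else a k \<nu>) ` {0..n}"
    proof cases
      case 1 then show ?thesis by (intro image_eqI[of _ _ 0]) auto
    next
      case (2 k) then show ?thesis by (intro image_eqI[of _ _ k]) auto
    qed
  qed (auto split: if_splits)
  moreover have "(\<lambda>\<nu>. Max ((\<lambda>k. if k = 0 then 0 else a k \<nu>) ` {0..n})) \<in> borel_measurable N"
  proof (rule borel_measurable_Max)
    fix k assume "k \<in> {0..n}"
    then show "(\<lambda>\<nu>. if k = 0 then 0 else a k \<nu>) \<in> borel_measurable N"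
      using assms[of k] by (cases "k = 0") auto
  qed simp
  ultimately show ?thesis by simp
qed

text \<open>A pointwise limit of maxima over finitely many grid points.\<close>

lemma borel_measurable_bridge_sup:
  assumes G: "continuous_process N G" and t: "0 \<le> t" "t \<le> 1"
  shows "(\<lambda>\<nu>. bridge_sup (G \<nu>) t) \<in> borel_measurable N"
proof (rule borel_measurable_LIMSEQ_real)
  fix \<nu> assume \<nu>: "\<nu> \<in> space N"
  have "continuous_on {0..1} (\<lambda>v. \<bar>bridge (G \<nu>) t v\<bar>)"
    by (intro continuous_on_rabs continuous_on_bridge continuous_processD(2)[OF G] \<nu> t)
  from grid_conv_Max_tendsto_SUP[OF grid_conv_grid this]
  show "(\<lambda>n. Max (insert 0 {\<bar>bridge (G \<nu>) t (real k / real n)\<bar> |k. 1 \<le> k \<and> k \<le> n})) \<longlonglongrightarrow> bridge_sup (G \<nu>) t"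
    unfolding bridge_sup_def by simp
next
  fix n
  show "(\<lambda>\<nu>. Max (insert 0 {\<bar>bridge (G \<nu>) t (real k / real n)\<bar> |k. 1 \<le> k \<and> k \<le> n})) \<in> borel_measurable N"
    by (intro borel_measurable_Max_grid borel_measurable_abs borel_measurable_bridge G t) (auto simp: divide_le_eq_1)
qed

lemma borel_measurable_bridge_int:
  assumes G: "continuous_process N G" and t: "0 \<le> t" "t \<le> 1"
  shows "(\<lambda>\<nu>. bridge_int (G \<nu>) t) \<in> borel_measurable N"
proof (rule borel_measurable_LIMSEQ_real)
  fix \<nu> assume \<nu>: "\<nu> \<in> space N"
  have "continuous_on {0..1} (\<lambda>v. (bridge (G \<nu>) t v)\<^sup>2)"
    by (intro continuous_on_power continuous_on_bridge continuous_processD(2)[OF G] \<nu> t)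
  from grid_conv_sum_tendsto_integral[OF grid_conv_grid this]
  have "(\<lambda>n. t * ((\<Sum>k=1..n. (bridge (G \<nu>) t (real k / real n))\<^sup>2) / real n))
      \<longlonglongrightarrow> t * integral {0..1} (\<lambda>v. (bridge (G \<nu>) t v)\<^sup>2)" by (rule tendsto_mult_left)
  then show "(\<lambda>n. t * ((\<Sum>k=1..n. (bridge (G \<nu>) t (real k / real n))\<^sup>2) / real n)) \<longlonglongrightarrow> bridge_int (G \<nu>) t"
    using bridge_int_eq[OF continuous_processD(2,3)[OF G \<nu>] t] by simp
next
  fix n
  show "(\<lambda>\<nu>. t * ((\<Sum>k=1..n. (bridge (G \<nu>) t (real k / real n))\<^sup>2) / real n)) \<in> borel_measurable N"
    by (intro borel_measurable_times borel_measurable_divide borel_measurable_sum borel_measurable_power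
        borel_measurable_bridge G t borel_measurable_const) (auto simp: divide_le_eq_1)
qed

text \<open>\<open>Sup\<close> on the reals is defined as the \<open>LEAST\<close> upper bound, so
  it depends on the set of upper bounds only. This also covers unbounded sets, where that set is
  empty.\<close>

lemma Sup_real_cong_upper_bounds:
  fixes X Y :: "real set"
  assumes "\<And>z. (\<forall>x\<in>X. x \<le> z) \<longleftrightarrow> (\<forall>y\<in>Y. y \<le> z)"
  shows "Sup X = Sup Y"
  using assms unfolding Sup_real_def by simp

text \<open>No boundedness is assumed: the supremum of every unbounded set of reals is the same junk value.\<close>

lemma borel_measurable_countable_Sup:
  fixes h :: "'i \<Rightarrow> 'b \<Rightarrow> real"
  assumes C: "countable C" "C \<noteq> {}" and h[measurable]: "\<And>q. q \<in> C \<Longrightarrow> h q \<in> borel_measurable N"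
  shows "(\<lambda>\<nu>. SUP q\<in>C. h q \<nu>) \<in> borel_measurable N"
proof -
  define B where "B = {\<nu>\<in>space N. \<exists>m::nat. \<forall>q\<in>C. h q \<nu> \<le> real m}"
  have B[measurable]: "B \<in> sets N"
    unfolding B_def using C(1) by measurable
  have bdd: "bdd_above ((\<lambda>q. if \<nu> \<in> B then h q \<nu> else 0) ` C)" for \<nu>
  proof (cases "\<nu> \<in> B")
    case True
    then obtain m :: nat where "\<forall>q\<in>C. h q \<nu> \<le> real m" by (auto simp: B_def)
    then show ?thesis using True by (intro bdd_aboveI2[of _ _ "real m"]) auto
  qed auto
  have m: "(\<lambda>\<nu>. SUP q\<in>C. if \<nu> \<in> B then h q \<nu> else 0) \<in> borel_measurable N"
    by (rule borel_measurable_cSUP[OF C(1) _ bdd]) measurable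
  have "(SUP q\<in>C. h q \<nu>) = (if \<nu> \<in> B then (SUP q\<in>C. if \<nu> \<in> B then h q \<nu> else 0) else Sup UNIV)" if "\<nu> \<in> space N" for \<nu>
  proof (cases "\<nu> \<in> B")
    case False
    have "(SUP q\<in>C. h q \<nu>) = Sup UNIV"
    proof (rule Sup_real_cong_upper_bounds)
      fix z :: real
      have "\<not> (\<forall>x\<in>(\<lambda>q. h q \<nu>) ` C. x \<le> z)"
      proof
        assume *: "\<forall>x\<in>(\<lambda>q. h q \<nu>) ` C. x \<le> z"
        obtain m :: nat where "z \<le> real m" using real_arch_simple by blast
        with * have "\<forall>q\<in>C. h q \<nu> \<le> real m" by auto
        then show False using False that by (auto simp: B_def)
      qed
      moreover have "\<not> (\<forall>y\<in>UNIV. y \<le> z)" using gt_ex[of z] by (auto simp: not_le)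
      ultimately show "(\<forall>x\<in>(\<lambda>q. h q \<nu>) ` C. x \<le> z) \<longleftrightarrow> (\<forall>y\<in>UNIV. y \<le> z)" by blast
    qed
    then show ?thesis using False by simp
  qed simp
  moreover have "(\<lambda>\<nu>. if \<nu> \<in> B then (SUP q\<in>C. if \<nu> \<in> B then h q \<nu> else 0) else Sup UNIV) \<in> borel_measurable N"
    using m by measurable
  ultimately show ?thesis by (simp cong: measurable_cong)
qed

text \<open>The rationals of the unit interval, indexed as the floor approximation of a point
  produces them; \<open>n = 0\<close> yields the point \<open>0\<close>.\<close>

definition unit_grid :: "real set" where
  "unit_grid = (\<lambda>(i, n). real i / real n) ` {(i, n). i \<le> n}"

lemma unit_grid: "countable unit_grid" "unit_grid \<noteq> {}" "unit_grid \<subseteq> {0..1}" "0 \<in> unit_grid"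
  unfolding unit_grid_def by (auto simp: divide_le_eq_1 intro!: image_eqI[of _ _ "(0, 0)"])

lemma unit_grid_approx:
  assumes t: "0 \<le> t" "t \<le> 1"
  shows "real (nat \<lfloor>real n * t\<rfloor>) / real n \<in> unit_grid" "(\<lambda>n. real (nat \<lfloor>real n * t\<rfloor>) / real n) \<longlonglongrightarrow> t"
proof -
  have le: "real n * t \<le> real n" for n using t by (simp add: mult_left_le)
  have "nat \<lfloor>real n * t\<rfloor> \<le> n" for n using le[of n] by linarith
  then show "real (nat \<lfloor>real n * t\<rfloor>) / real n \<in> unit_grid"
    unfolding unit_grid_def by (intro image_eqI[of _ _ "(nat \<lfloor>real n * t\<rfloor>, n)"]) auto
  have "\<forall>\<^sub>F n in sequentially. norm (real (nat \<lfloor>real n * t\<rfloor>) / real n - t) \<le> 1 / real n"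
    using eventually_gt_at_top[of 0]
  proof eventually_elim
    case (elim n)
    have "0 \<le> real n * t" using t by simp
    then have "\<bar>real (nat \<lfloor>real n * t\<rfloor>) - real n * t\<bar> \<le> 1" by linarith
    then have "\<bar>real (nat \<lfloor>real n * t\<rfloor>) - real n * t\<bar> / real n \<le> 1 / real n" by (rule divide_right_mono) simp
    moreover have "real (nat \<lfloor>real n * t\<rfloor>) / real n - t = (real (nat \<lfloor>real n * t\<rfloor>) - real n * t) / real n"
      using elim by (simp add: diff_divide_distrib)
    ultimately show ?case by simp
  qed
  then have "(\<lambda>n. real (nat \<lfloor>real n * t\<rfloor>) / real n - t) \<longlonglongrightarrow> 0"
    by (rule Lim_null_comparison) (rule lim_1_over_n)
  then show "(\<lambda>n. real (nat \<lfloor>real n * t\<rfloor>) / real n) \<longlonglongrightarrow> t" by (rule LIM_zero_cancel)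
qed

lemma continuous_on_unit_grid_tendsto:
  assumes g: "continuous_on {0..1} g" and t: "0 \<le> t" "t \<le> 1"
  shows "(\<lambda>n. g (real (nat \<lfloor>real n * t\<rfloor>) / real n)) \<longlonglongrightarrow> g t"
proof (rule continuous_on_tendsto_compose[OF g unit_grid_approx(2)[OF t]])
  show "\<forall>\<^sub>F n in sequentially. real (nat \<lfloor>real n * t\<rfloor>) / real n \<in> {0..1}"
    by (intro always_eventually allI subsetD[OF unit_grid(3)] unit_grid_approx(1)[OF t])
qed (use t in simp)

text \<open>The denominator may vanish on a null set of paths, where the functionals still have to be measurable;
  there the quotient is \<open>0\<close> by convention, which does not affect the supremum.\<close>

lemma Sfun_eq_Sup_unit_grid:
  assumes f: "continuous_on {0..1} f" and f0: "f 0 = 0"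
  shows "Sfun f = (SUP t\<in>unit_grid. \<bar>(f t - t * f 1) / (bridge_sup f t + bridge_sup (reversal f) (1 - t))\<bar>)"
proof -
  define num where "num t = f t - t * f 1" for t
  define den where "den t = bridge_sup f t + bridge_sup (reversal f) (1 - t)" for t
  have num: "continuous_on {0..1} num" unfolding num_def by (intro continuous_intros f)
  have den: "continuous_on {0..1} den" unfolding den_def by (rule continuous_on_denominators(1)[OF f f0])
  have "(SUP t\<in>{0..1}. \<bar>num t / den t\<bar>) = (SUP t\<in>unit_grid. \<bar>num t / den t\<bar>)"
  proof (rule Sup_real_cong_upper_bounds, rule iffI)
    fix z assume "\<forall>x\<in>(\<lambda>t. \<bar>num t / den t\<bar>) ` {0..1}. x \<le> z"
    then show "\<forall>x\<in>(\<lambda>t. \<bar>num t / den t\<bar>) ` unit_grid. x \<le> z" using unit_grid(3) by blast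
  next
    fix z assume z: "\<forall>x\<in>(\<lambda>t. \<bar>num t / den t\<bar>) ` unit_grid. x \<le> z"
    have "\<bar>num t / den t\<bar> \<le> z" if t: "0 \<le> t" "t \<le> 1" for t
    proof (cases "den t = 0")
      case True
      have "0 \<le> \<bar>num 0 / den 0\<bar>" by simp
      also have "\<dots> \<le> z" using z unit_grid(4) by blast
      finally show ?thesis using True by simp
    next
      case False
      let ?q = "\<lambda>n. real (nat \<lfloor>real n * t\<rfloor>) / real n"
      have "(\<lambda>n. \<bar>num (?q n) / den (?q n)\<bar>) \<longlonglongrightarrow> \<bar>num t / den t\<bar>"
        by (intro tendsto_rabs tendsto_divide continuous_on_unit_grid_tendsto num den t False)
      then show ?thesis
        by (rule LIMSEQ_le_const2) (use z unit_grid_approx(1)[OF t] in blast)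
    qed
    then show "\<forall>x\<in>(\<lambda>t. \<bar>num t / den t\<bar>) ` {0..1}. x \<le> z" by auto
  qed
  then show ?thesis using Sfun_alt[of f, OF f0] by (simp add: num_def den_def)
qed

lemma borel_measurable_Sfun:
  assumes G: "continuous_process N G"
  shows "(\<lambda>\<nu>. Sfun (G \<nu>)) \<in> borel_measurable N"
proof -
  have "(\<lambda>\<nu>. SUP t\<in>unit_grid. \<bar>(G \<nu> t - t * G \<nu> 1) / (bridge_sup (G \<nu>) t + bridge_sup (reversal (G \<nu>)) (1 - t))\<bar>)
      \<in> borel_measurable N"
    using unit_grid
    by (intro borel_measurable_countable_Sup borel_measurable_abs borel_measurable_divide borel_measurable_diff
        borel_measurable_add borel_measurable_times borel_measurable_const borel_measurable_bridge_sup
        continuous_process_reversal G continuous_processD(1)[OF G]) auto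
  moreover have "Sfun (G \<nu>) = (SUP t\<in>unit_grid. \<bar>(G \<nu> t - t * G \<nu> 1) / (bridge_sup (G \<nu>) t + bridge_sup (reversal (G \<nu>)) (1 - t))\<bar>)"
    if "\<nu> \<in> space N" for \<nu>
    by (rule Sfun_eq_Sup_unit_grid[OF continuous_processD(2,3)[OF G that]])
  ultimately show ?thesis by (simp cong: measurable_cong)
qed

text \<open>A function measurable in \<open>\<nu>\<close> and continuous in \<open>t\<close> is a
  limit of functions that are steps in \<open>t\<close>, hence jointly measurable. The second
  argument is clamped to the unit interval to obtain a function on the whole line.\<close>

lemma borel_measurable_caratheodory:
  fixes H :: "'b \<Rightarrow> real \<Rightarrow> real"
  assumes m: "\<And>t. 0 \<le> t \<Longrightarrow> t \<le> 1 \<Longrightarrow> (\<lambda>\<nu>. H \<nu> t) \<in> borel_measurable N"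
    and c: "\<And>\<nu>. \<nu> \<in> space N \<Longrightarrow> continuous_on {0..1} (H \<nu>)"
  shows "(\<lambda>(\<nu>, t). H \<nu> (max 0 (min 1 t))) \<in> borel_measurable (N \<Otimes>\<^sub>M borel)"
proof (rule borel_measurable_LIMSEQ_real)
  let ?c = "\<lambda>t::real. max 0 (min 1 t)"
  fix x assume x: "x \<in> space (N \<Otimes>\<^sub>M (borel :: real measure))"
  show "(\<lambda>n. H (fst x) (real (nat \<lfloor>real n * ?c (snd x)\<rfloor>) / real n)) \<longlonglongrightarrow> (case x of (\<nu>, t) \<Rightarrow> H \<nu> (?c t))"
    unfolding case_prod_beta
    by (rule continuous_on_unit_grid_tendsto) (use x c in \<open>auto simp: space_pair_measure\<close>)
next
  let ?c = "\<lambda>t::real. max 0 (min 1 t)"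
  fix n
  have *: "(\<lambda>x. H (fst x) (real k / real n)) \<in> borel_measurable (N \<Otimes>\<^sub>M (borel :: real measure))" if "k \<le> n" for k
  proof -
    have "(\<lambda>\<nu>. H \<nu> (real k / real n)) \<in> borel_measurable N"
      using that by (intro m) (auto simp: divide_le_eq_1)
    from measurable_compose[OF measurable_fst this] show ?thesis .
  qed
  \<comment> \<open>Splitting by the finitely many values of the floor makes the step function a
    finite sum of measurable terms.\<close>
  have "(\<lambda>x. \<Sum>k\<le>n. (if nat \<lfloor>real n * ?c (snd x)\<rfloor> = k then H (fst x) (real k / real n) else 0))
      \<in> borel_measurable (N \<Otimes>\<^sub>M (borel :: real measure))"
    using * by (intro borel_measurable_sum measurable_If) auto
  moreover have "(\<Sum>k\<le>n. (if nat \<lfloor>real n * ?c t\<rfloor> = k then H \<nu> (real k / real n) else 0))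
      = H \<nu> (real (nat \<lfloor>real n * ?c t\<rfloor>) / real n)" for \<nu> t
  proof -
    have "real n * ?c t \<le> real n" by (simp add: mult_left_le)
    then have "nat \<lfloor>real n * ?c t\<rfloor> \<le> n" by linarith
    then show ?thesis by (simp add: sum.delta)
  qed
  ultimately show "(\<lambda>x. H (fst x) (real (nat \<lfloor>real n * ?c (snd x)\<rfloor>) / real n)) \<in> borel_measurable (N \<Otimes>\<^sub>M borel)"
    by simp
qed

text \<open>For nonnegative Borel functions gauge and Lebesgue integrability coincide, and otherwise
  both integrals are \<open>0\<close> by convention. So paths with vanishing denominators need no
  separate treatment.\<close>

lemma integral_eq_lebesgue_integral_nonneg:
  fixes r :: "real \<Rightarrow> real"
  assumes r: "set_borel_measurable lborel {0..1} r" and nn: "\<And>t. t \<in> {0..1} \<Longrightarrow> 0 \<le> r t"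
  shows "integral {0..1} r = (LINT t:{0..1}|lborel. r t)"
proof (cases "set_integrable lborel {0..1} r")
  case True
  then show ?thesis by (simp add: set_borel_integral_eq_integral)
next
  case False
  have "\<not> r integrable_on {0..1}"
  proof
    assume "r integrable_on {0..1}"
    then have "r absolutely_integrable_on {0..1}" using nn by (rule nonnegative_absolutely_integrable_1)
    then have "set_integrable lborel {0..1} r"
      using r unfolding set_integrable_def set_borel_measurable_def by (simp add: integrable_completion)
    then show False using False by simp
  qed
  then show ?thesis using False
    by (simp add: not_integrable_integral set_lebesgue_integral_def set_integrable_def not_integrable_integral_eq)
qed

text \<open>Numerator and denominator are jointly measurable in path and time, so the quotient is,
  with \<open>0\<close> for a vanishing denominator; integrating out the time keeps
  measurability.\<close>

lemma borel_measurable_Tfun: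
  assumes G: "continuous_process N G"
  shows "(\<lambda>\<nu>. Tfun (G \<nu>)) \<in> borel_measurable N"
proof -
  let ?c = "\<lambda>t::real. max 0 (min 1 t)"
  define R where "R \<nu> t = (G \<nu> t - t * G \<nu> 1)\<^sup>2 / (bridge_int (G \<nu>) t + bridge_int (reversal (G \<nu>)) (1 - t))" for \<nu> t
  note Gr = continuous_process_reversal[OF G]
  have 1: "(\<lambda>(\<nu>, t). (\<lambda>\<nu> t. (G \<nu> t - t * G \<nu> 1)\<^sup>2) \<nu> (?c t)) \<in> borel_measurable (N \<Otimes>\<^sub>M borel)"
    by (rule borel_measurable_caratheodory)
       (intro borel_measurable_power borel_measurable_diff borel_measurable_times borel_measurable_const
        continuous_processD(1)[OF G] continuous_intros continuous_processD(2)[OF G]; simp)+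
  have 2: "(\<lambda>(\<nu>, t). (\<lambda>\<nu> t. bridge_int (G \<nu>) t + bridge_int (reversal (G \<nu>)) (1 - t)) \<nu> (?c t)) \<in> borel_measurable (N \<Otimes>\<^sub>M borel)"
  proof (rule borel_measurable_caratheodory)
    fix t :: real assume "0 \<le> t" "t \<le> 1"
    then show "(\<lambda>\<nu>. bridge_int (G \<nu>) t + bridge_int (reversal (G \<nu>)) (1 - t)) \<in> borel_measurable N"
      by (intro borel_measurable_add borel_measurable_bridge_int G Gr) auto
  next
    fix \<nu> assume "\<nu> \<in> space N"
    from continuous_on_denominators(2)[OF continuous_processD(2,3)[OF G this]]
    show "continuous_on {0..1} (\<lambda>t. bridge_int (G \<nu>) t + bridge_int (reversal (G \<nu>)) (1 - t))" .
  qed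
  have R: "(\<lambda>(\<nu>, t). R \<nu> (?c t)) \<in> borel_measurable (N \<Otimes>\<^sub>M borel)"
    using borel_measurable_divide[OF 1 2] unfolding R_def by (simp add: case_prod_beta)
  have I: "(\<lambda>(\<nu>, t). indicator {0..1} t *\<^sub>R R \<nu> (?c t)) \<in> borel_measurable (N \<Otimes>\<^sub>M lborel)"
    using R by (auto simp: case_prod_beta intro!: borel_measurable_scaleR measurable_compose[OF measurable_snd] cong: measurable_cong_sets)
  have "(\<lambda>\<nu>. LINT t|lborel. indicator {0..1} t *\<^sub>R R \<nu> (?c t)) \<in> borel_measurable N"
    using lborel.borel_measurable_lebesgue_integral[OF I] by simp
  moreover have "Tfun (G \<nu>) = (LINT t|lborel. indicator {0..1} t *\<^sub>R R \<nu> (?c t))" if \<nu>: "\<nu> \<in> space N" for \<nu>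
  proof -
    have ind: "indicator {0..1} t *\<^sub>R R \<nu> (?c t) = indicator {0..1} t *\<^sub>R R \<nu> t" for t
      by (auto simp: indicator_def)
    have "(\<lambda>t. indicator {0..1} t *\<^sub>R R \<nu> (?c t)) \<in> borel_measurable lborel"
      using measurable_compose_Pair1[OF \<nu> I] by simp
    then have "set_borel_measurable lborel {0..1} (R \<nu>)"
      unfolding set_borel_measurable_def ind .
    moreover have "0 \<le> R \<nu> t" if "t \<in> {0..1}" for t
      unfolding R_def using that \<nu>
      by (intro divide_nonneg_nonneg add_nonneg_nonneg bridge_int_nonneg continuous_processD(2)[OF G] continuous_processD(2)[OF Gr]) auto
    ultimately have "integral {0..1} (R \<nu>) = (LINT t:{0..1}|lborel. R \<nu> t)"
      by (rule integral_eq_lebesgue_integral_nonneg)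
    also have "\<dots> = (LINT t|lborel. indicator {0..1} t *\<^sub>R R \<nu> (?c t))"
      unfolding set_lebesgue_integral_def ind ..
    finally show ?thesis
      unfolding Tfun_alt[OF continuous_processD(2)[OF G \<nu>]] R_def[symmetric] .
  qed
  ultimately show ?thesis by (simp cong: measurable_cong)
qed

section \<open>Weighted Gaussian sums and Gaussian processes with independent increments\<close>

text \<open>The clauses of \<open>wiener\<close> on increments, with a variance clock
  \<open>K\<close> in place of the identity.\<close>

definition gaussian_increments :: "'b measure \<Rightarrow> (real \<Rightarrow> real) \<Rightarrow> ('b \<Rightarrow> real \<Rightarrow> real) \<Rightarrow> bool" where
  "gaussian_increments N K G \<longleftrightarrow>
     (\<forall>s t. 0 \<le> s \<and> s < t \<and> t \<le> 1 \<longrightarrow>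
        distributed N lborel (\<lambda>\<nu>. G \<nu> t - G \<nu> s) (normal_density 0 (sqrt (K t - K s)))) \<and>
     (\<forall>(ts :: nat \<Rightarrow> real) m. 0 \<le> ts 0 \<and> ts m \<le> 1 \<and> (\<forall>i<m. ts i < ts (Suc i)) \<longrightarrow>
        prob_space.indep_vars N (\<lambda>_. borel) (\<lambda>i \<nu>. G \<nu> (ts (Suc i)) - G \<nu> (ts i)) {..<m})"

lemma gaussian_incrementsD:
  assumes "gaussian_increments N K G"
  shows "0 \<le> s \<Longrightarrow> s < t \<Longrightarrow> t \<le> 1 \<Longrightarrow>
        distributed N lborel (\<lambda>\<nu>. G \<nu> t - G \<nu> s) (normal_density 0 (sqrt (K t - K s)))"
    and "0 \<le> ts 0 \<Longrightarrow> ts m \<le> 1 \<Longrightarrow> (\<And>i. i < m \<Longrightarrow> ts i < ts (Suc i)) \<Longrightarrow>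
        prob_space.indep_vars N (\<lambda>_. borel) (\<lambda>i \<nu>. G \<nu> (ts (Suc i)) - G \<nu> (ts i)) {..<m}"
  using assms unfolding gaussian_increments_def by blast+

text \<open>A law with a Lebesgue density has no atoms.\<close>

lemma AE_distributed_lborel_nonzero:
  assumes "distributed N lborel X f"
  shows "AE \<nu> in N. X \<nu> \<noteq> (0::real)"
proof -
  have X: "X \<in> measurable N lborel" and f: "f \<in> borel_measurable lborel"
    using assms by (auto simp: distributed_def)
  have "AE x in density lborel f. x \<noteq> 0"
    using AE_lborel_singleton[of "0::real"] f by (auto simp: AE_density)
  then have "AE x in distr N lborel X. x \<noteq> 0" by (simp only: distributed_distr_eq_density[OF assms])
  then show ?thesis using X by (simp add: AE_distr_iff)
qed

text \<open>Increments over different quarters are independent and nondegenerate normal, so their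
  difference has a normal density and is almost surely nonzero.\<close>

lemma AE_nonlinear_halves:
  assumes N: "prob_space N" and G: "gaussian_increments N K G" and K: "strict_mono_on {0..1} K"
  shows "AE \<nu> in N. nonlinear_halves (G \<nu>)"
proof -
  interpret prob_space N by fact
  define ts where "ts i = real i / 4" for i :: nat
  have ind: "indep_vars (\<lambda>_. borel) (\<lambda>i \<nu>. G \<nu> (ts (Suc i)) - G \<nu> (ts i)) {..<4}"
    by (rule gaussian_incrementsD(2)[OF G]) (auto simp: ts_def)
  have nz: "AE \<nu> in N. (G \<nu> (ts (Suc i)) - G \<nu> (ts i)) - (G \<nu> (ts (Suc j)) - G \<nu> (ts j)) \<noteq> 0"
    if ij: "i < 4" "j < 4" "i \<noteq> j" for i j
  proof -
    \<comment> \<open>Pairwise independence is extracted as independence of one variable from a sum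
      over a singleton.\<close>
    have "indep_var borel (\<lambda>\<nu>. G \<nu> (ts (Suc i)) - G \<nu> (ts i)) borel (\<lambda>\<nu>. G \<nu> (ts (Suc j)) - G \<nu> (ts j))"
      using indep_vars_sum[of "{j}" i, OF _ _ indep_vars_subset[OF ind]] ij by simp
    moreover have "0 < sqrt (K (ts (Suc l)) - K (ts l))" if "l < 4" for l
      using strict_mono_onD[OF K, of "ts l" "ts (Suc l)"] that by (simp add: ts_def)
    moreover have "distributed N lborel (\<lambda>\<nu>. G \<nu> (ts (Suc l)) - G \<nu> (ts l)) (normal_density 0 (sqrt (K (ts (Suc l)) - K (ts l))))"
      if "l < 4" for l
      using that by (intro gaussian_incrementsD(1)[OF G]) (auto simp: ts_def)
    ultimately show ?thesis using ij
      by (intro AE_distributed_lborel_nonzero[OF diff_indep_normal]) auto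
  qed
  have "AE \<nu> in N. (G \<nu> (ts (Suc 0)) - G \<nu> (ts 0)) - (G \<nu> (ts (Suc 1)) - G \<nu> (ts 1)) \<noteq> 0"
    by (rule nz) simp_all
  moreover have "AE \<nu> in N. (G \<nu> (ts (Suc 2)) - G \<nu> (ts 2)) - (G \<nu> (ts (Suc 3)) - G \<nu> (ts 3)) \<noteq> 0"
    by (rule nz) simp_all
  ultimately show ?thesis
    by eventually_elim (auto simp: ts_def nonlinear_halves_def)
qed

lemma strict_mono_continuous_inverse:
  fixes K :: "real \<Rightarrow> real"
  assumes K: "strict_mono_on {0..1} K" "continuous_on {0..1} K" "K 0 = 0"
  obtains J where "continuous_on {0..K 1} J" "\<And>t. 0 \<le> t \<Longrightarrow> t \<le> 1 \<Longrightarrow> J (K t) = t"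
    "\<And>y. 0 \<le> y \<Longrightarrow> y \<le> K 1 \<Longrightarrow> K (J y) = y" "\<And>y. 0 \<le> y \<Longrightarrow> y \<le> K 1 \<Longrightarrow> J y \<in> {0..1}"
proof -
  have inj: "inj_on K {0..1}" using K(1) by (rule strict_mono_on_imp_inj_on)
  have im: "K ` {0..1} = {0..K 1}"
  proof
    show "K ` {0..1} \<subseteq> {0..K 1}"
      using strict_mono_on_leD[OF K(1)] K(3) by fastforce
    show "{0..K 1} \<subseteq> K ` {0..1}"
    proof
      fix y assume "y \<in> {0..K 1}"
      then have "\<exists>x. 0 \<le> x \<and> x \<le> 1 \<and> K x = y" using K by (intro IVT') auto
      then show "y \<in> K ` {0..1}" by auto
    qed
  qed
  show ?thesis
  proof (rule that[of "the_inv_into {0..1} K"])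
    show "continuous_on {0..K 1} (the_inv_into {0..1} K)"
      using continuous_on_inv_into[OF K(2) _ inj] im by simp
    show "the_inv_into {0..1} K (K t) = t" if "0 \<le> t" "t \<le> 1" for t
      using that by (intro the_inv_into_f_f[OF inj]) auto
    show "K (the_inv_into {0..1} K y) = y" if "0 \<le> y" "y \<le> K 1" for y
      using that im by (intro f_the_inv_into_f[OF inj]) auto
    show "the_inv_into {0..1} K y \<in> {0..1}" if "0 \<le> y" "y \<le> K 1" for y
      using that im by (intro the_inv_into_into[OF inj]) auto
  qed
qed

lemma downward_closed_initial_segment:
  fixes A :: "nat set"
  assumes "A \<subseteq> {..<m}" and down: "\<And>l l'. l \<in> A \<Longrightarrow> l' < l \<Longrightarrow> l' \<in> A"
  obtains c where "c \<le> m" "A = {..<c}"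
proof -
  define c where "c = (LEAST l. l \<notin> A)"
  have "m \<notin> A" using assms(1) by auto
  then have "c \<notin> A" "c \<le> m" unfolding c_def by (rule LeastI, rule Least_le)
  moreover have "l \<in> A" if "l < c" for l using that not_less_Least unfolding c_def by blast
  moreover have "l < c" if "l \<in> A" for l
    using down[OF that, of c] that \<open>c \<notin> A\<close> by (metis linorder_neqE_nat)
  ultimately show ?thesis by (intro that[of c]) auto
qed

text \<open>\<open>r\<close> lists the indices with nonzero \<open>c\<close> in increasing order and
  \<open>cnt k\<close> counts those up to \<open>k\<close>. Sums up to \<open>k\<close> of terms
  that vanish with \<open>c\<close> thus become sums over an initial segment.\<close>

lemma enumerate_support:
  fixes c :: "nat \<Rightarrow> real"
  obtains m :: nat and r cnt :: "nat \<Rightarrow> nat" where "\<And>l. l < m \<Longrightarrow> r l \<in> {1..n} \<and> c (r l) \<noteq> 0" "inj_on r {..<m}" "\<And>k. cnt k \<le> m"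
    "\<And>k h. k \<le> n \<Longrightarrow> (\<And>i. c i = 0 \<Longrightarrow> h i = 0) \<Longrightarrow> (\<Sum>i=1..k. h i :: real) = (\<Sum>l<cnt k. h (r l))"
proof -
  define J where "J = {i\<in>{1..n}. c i \<noteq> 0}"
  have fin: "finite J" by (simp add: J_def)
  obtain r where r: "strict_mono_on {..<card J} r" "\<And>l. l < card J \<Longrightarrow> r l \<in> J"
    using finite_enumerate[OF fin] by blast
  have inj: "inj_on r {..<card J}" using r(1) by (rule strict_mono_on_imp_inj_on)
  have im: "r ` {..<card J} = J"
    using r(2) fin by (intro card_subset_eq) (auto simp: card_image[OF inj])
  have "\<exists>d. d \<le> card J \<and> {l\<in>{..<card J}. r l \<le> k} = {..<d}" for k
  proof (rule downward_closed_initial_segment[of "{l\<in>{..<card J}. r l \<le> k}" "card J"])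
    fix l l' assume "l \<in> {l\<in>{..<card J}. r l \<le> k}" "l' < l"
    then show "l' \<in> {l\<in>{..<card J}. r l \<le> k}"
      using strict_mono_onD[OF r(1), of l' l] by auto
  qed auto
  then obtain cnt where cnt: "\<And>k. cnt k \<le> card J" "\<And>k. {l\<in>{..<card J}. r l \<le> k} = {..<cnt k}" by metis
  show ?thesis
  proof (rule that[of "card J" r cnt])
    show "r l \<in> {1..n} \<and> c (r l) \<noteq> 0" if "l < card J" for l using r(2)[OF that] by (simp add: J_def)
    show "(\<Sum>i=1..k. h i :: real) = (\<Sum>l<cnt k. h (r l))" if k: "k \<le> n" and h: "\<And>i. c i = 0 \<Longrightarrow> h i = 0" for k h
    proof -
      have "(\<Sum>i=1..k. h i) = sum h (J \<inter> {..k})"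
        using k h by (intro sum.mono_neutral_right) (auto simp: J_def)
      also have "J \<inter> {..k} = r ` {..<cnt k}"
      proof -
        have "r ` {..<cnt k} = {i \<in> r ` {..<card J}. i \<le> k}" unfolding cnt(2)[symmetric] by blast
        then show ?thesis unfolding im by blast
      qed
      also have "sum h \<dots> = (\<Sum>l<cnt k. h (r l))"
        using cnt(1)[of k] by (subst sum.reindex) (auto intro: inj_on_subset[OF inj])
      finally show ?thesis .
    qed
  qed (use inj cnt in auto)
qed

lemma prob_space_std_normal: "prob_space (density lborel std_normal_density)"
  by (rule prob_space_normal_density) simp

text \<open>Nonzero increments of the two processes are both independent centred normal and agree in variance;
  indices with \<open>c i = 0\<close> have to be skipped because the process property speaks of strictly increasing times.\<close>

lemma distr_gaussian_partial_sums:
  fixes F :: "(nat \<Rightarrow> real) \<Rightarrow> real"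
  assumes N: "prob_space N" and cp: "continuous_process N G" and G: "gaussian_increments N K G"
    and K: "strict_mono_on {0..1} K" "K 0 = 0"
    and J: "\<And>t. 0 \<le> t \<Longrightarrow> t \<le> 1 \<Longrightarrow> J (K t) = t" "\<And>y. 0 \<le> y \<Longrightarrow> y \<le> K 1 \<Longrightarrow> K (J y) = y"
      "\<And>y. 0 \<le> y \<Longrightarrow> y \<le> K 1 \<Longrightarrow> J y \<in> {0..1}"
    and S: "0 < (\<Sum>i=1..n. (c i)\<^sup>2)"
    and F: "\<And>V V'. (\<And>k. k \<le> n \<Longrightarrow> V k = V' k) \<Longrightarrow> F V = F V'"
    and meas: "\<And>(P :: (nat \<Rightarrow> real) measure) V. (\<And>k. k \<le> n \<Longrightarrow> (\<lambda>x. V x k) \<in> borel_measurable P) \<Longrightarrow>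
        (\<And>x. V x 0 = 0) \<Longrightarrow> (\<lambda>x. F (V x)) \<in> borel_measurable P"
  defines "S \<equiv> \<Sum>i=1..n. (c i)\<^sup>2"
  shows "distr (boot_law n) borel (\<lambda>x. F (\<lambda>k. sqrt (K 1 / S) * (\<Sum>i=1..k. c i * x i)))
       = distr N borel (\<lambda>\<nu>. F (\<lambda>k. G \<nu> (J (K 1 * (\<Sum>i=1..k. (c i)\<^sup>2) / S))))"
proof -
  interpret prob_space N by fact
  have S0: "0 < S" using S by (simp add: S_def)
  have K1: "0 < K 1" using strict_mono_onD[OF K(1), of 0 1] K(2) by simp
  \<comment> \<open>The factor that brings the total variance \<open>S\<close> of the walk to
    \<open>K 1\<close>, the variance of \<open>G\<close> over the unit interval.\<close>
  define s where "s = sqrt (K 1 / S)"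
  have s: "0 < s" "s\<^sup>2 = K 1 / S" using S0 K1 by (auto simp: s_def)
  obtain m :: nat and r cnt :: "nat \<Rightarrow> nat" where r: "\<And>l. l < m \<Longrightarrow> r l \<in> {1..n} \<and> c (r l) \<noteq> 0" "inj_on r {..<m}" "\<And>k. cnt k \<le> m"
    and sums: "\<And>k h. k \<le> n \<Longrightarrow> (\<And>i. c i = 0 \<Longrightarrow> h i = 0) \<Longrightarrow> (\<Sum>i=1..k. h i :: real) = (\<Sum>l<cnt k. h (r l))"
    using enumerate_support[of n c] by blast
  have Sm: "S = (\<Sum>l<cnt n. (c (r l))\<^sup>2)" unfolding S_def by (rule sums) auto
  have "m \<noteq> 0" using r(3)[of n] S0 Sm by (cases "m = 0") auto
  then have ne: "{..<m} \<noteq> {}" by auto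
  \<comment> \<open>The time at which the clock \<open>K\<close> has run through the rescaled
    variances of the first \<open>l\<close> nonzero steps.\<close>
  define ts where "ts l = J (K 1 * (\<Sum>l'<l. (c (r l'))\<^sup>2) / S)" for l
  have le_S: "(\<Sum>l'<l. (c (r l'))\<^sup>2) \<le> S" if "l \<le> m" for l
  proof -
    have "(\<Sum>l'<l. (c (r l'))\<^sup>2) \<le> (\<Sum>l'<m. (c (r l'))\<^sup>2)" using that by (intro sum_mono2) auto
    also have "\<dots> = (\<Sum>i\<in>r ` {..<m}. (c i)\<^sup>2)" using r(2) by (simp add: sum.reindex)
    also have "\<dots> \<le> S" unfolding S_def using r(1) by (intro sum_mono2) auto
    finally show ?thesis .
  qed
  have arg: "0 \<le> K 1 * (\<Sum>l'<l. (c (r l'))\<^sup>2) / S" "K 1 * (\<Sum>l'<l. (c (r l'))\<^sup>2) / S \<le> K 1" if "l \<le> m" for l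
    using le_S[OF that] K1 S0 by (auto simp: divide_le_eq intro!: divide_nonneg_nonneg mult_nonneg_nonneg sum_nonneg)
  have ts01: "ts l \<in> {0..1}" if "l \<le> m" for l unfolding ts_def by (rule J(3)[OF arg[OF that]])
  have Kts: "K (ts l) = K 1 * (\<Sum>l'<l. (c (r l'))\<^sup>2) / S" if "l \<le> m" for l unfolding ts_def by (rule J(2)[OF arg[OF that]])
  have Kdiff: "K (ts (Suc l)) - K (ts l) = (s * \<bar>c (r l)\<bar>)\<^sup>2" if "l < m" for l
    using that Kts[of l] Kts[of "Suc l"] s(2) S0
    by (simp add: power_mult_distrib distrib_left add_divide_distrib)
  have inc: "ts l < ts (Suc l)" if "l < m" for l
  proof -
    have "0 < (s * \<bar>c (r l)\<bar>)\<^sup>2" using s(1) r(1)[OF that] by simp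
    then have "K (ts l) < K (ts (Suc l))" using Kdiff[OF that] by linarith
    then show ?thesis using strict_mono_on_less[OF K(1)] ts01[of l] ts01[of "Suc l"] that by simp
  qed
  have ts0: "ts 0 = 0" using J(1)[of 0] K(2) by (simp add: ts_def)
  define D where "D l \<nu> = G \<nu> (ts (Suc l)) - G \<nu> (ts l)" for l \<nu>
  have indD: "indep_vars (\<lambda>_. borel) D {..<m}"
    unfolding D_def using ts01 inc by (intro gaussian_incrementsD(2)[OF G]) auto
  \<comment> \<open>The standardised increment of \<open>G\<close>. Division by the signed
    coefficient makes \<open>s * c (r l) * Z l\<close> the increment itself; the sign does not
    affect the symmetric normal law.\<close>
  define Z where "Z l \<nu> = 1 / (s * c (r l)) * D l \<nu>" for l \<nu>
  have indZ: "indep_vars (\<lambda>_. borel) Z {..<m}"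
    unfolding Z_def by (rule indep_vars_compose2[OF indD]) simp
  have Zd: "distr N borel (Z l) = density lborel std_normal_density" if l: "l < m" for l
  proof -
    have c: "c (r l) \<noteq> 0" using r(1)[OF l] by simp
    have "distributed N lborel (D l) (normal_density 0 (sqrt (K (ts (Suc l)) - K (ts l))))"
      unfolding D_def using ts01[of l] ts01[of "Suc l"] inc[OF l] l by (intro gaussian_incrementsD(1)[OF G]) auto
    then have "distributed N lborel (D l) (normal_density 0 (s * \<bar>c (r l)\<bar>))"
      unfolding Kdiff[OF l] using s(1) by simp
    from normal_density_affine[OF this, of "1 / (s * c (r l))" 0] s(1) c
    have "distributed N lborel (Z l) (normal_density 0 1)"
      by (simp add: Z_def[abs_def] abs_mult)
    then have "distr N lborel (Z l) = density lborel std_normal_density" by (simp add: distributed_def)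
    moreover have "distr N borel (Z l) = distr N lborel (Z l)" by (rule distr_cong) auto
    ultimately show ?thesis by simp
  qed
  let ?P = "Pi\<^sub>M {..<m} (\<lambda>_. borel :: real measure)"
  have Zm: "Z l \<in> borel_measurable N" if "l < m" for l
    using indZ that by (auto simp: indep_vars_def)
  have Zvec: "(\<lambda>\<nu>. \<lambda>l\<in>{..<m}. Z l \<nu>) \<in> measurable N ?P"
    using Zm by (intro measurable_restrict) auto
  have lawZ: "distr N ?P (\<lambda>\<nu>. \<lambda>l\<in>{..<m}. Z l \<nu>) = Pi\<^sub>M {..<m} (\<lambda>_. density lborel std_normal_density)"
  proof -
    have "distr N ?P (\<lambda>\<nu>. \<lambda>l\<in>{..<m}. Z l \<nu>) = Pi\<^sub>M {..<m} (\<lambda>l. distr N borel (Z l))"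
      using indZ by (subst (asm) indep_vars_iff_distr_eq_PiM'[OF ne]) (use Zm in auto)
    also have "\<dots> = Pi\<^sub>M {..<m} (\<lambda>_. density lborel std_normal_density)"
      using Zd by (intro PiM_cong) auto
    finally show ?thesis .
  qed
  have bootvec: "(\<lambda>x. \<lambda>l\<in>{..<m}. x (r l)) \<in> measurable (boot_law n) ?P"
    unfolding boot_law_def
  proof (rule measurable_restrict)
    fix l assume "l \<in> {..<m}"
    then have "r l \<in> {1..n}" using r(1) by simp
    then show "(\<lambda>x. x (r l)) \<in> borel_measurable (Pi\<^sub>M {1..n} (\<lambda>_. density lborel std_normal_density))"
      using measurable_component_singleton[of "r l" "{1..n}" "\<lambda>_. density lborel std_normal_density"]
      by (simp cong: measurable_cong_sets)
  qed
  have lawB: "distr (boot_law n) ?P (\<lambda>x. \<lambda>l\<in>{..<m}. x (r l)) = Pi\<^sub>M {..<m} (\<lambda>_. density lborel std_normal_density)"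
  proof -
    have "distr (boot_law n) (Pi\<^sub>M {..<m} (\<lambda>_. density lborel std_normal_density)) (\<lambda>x. \<lambda>l\<in>{..<m}. x (r l))
        = Pi\<^sub>M {..<m} (\<lambda>_. density lborel std_normal_density)"
      unfolding boot_law_def
      using distr_PiM_reindex[of "{1..n}" "\<lambda>_. density lborel std_normal_density" r "{..<m}"] r prob_space_std_normal by auto
    moreover have "sets (Pi\<^sub>M {..<m} (\<lambda>_. density lborel std_normal_density)) = sets ?P"
      by (rule sets_PiM_cong) auto
    ultimately show ?thesis by (metis distr_cong)
  qed
  \<comment> \<open>Both sides are \<open>F (V z)\<close> for a vector \<open>z\<close> of
    \<open>m\<close> independent standard normal variables; that the two vectors have this law is
    \<open>lawZ\<close> and \<open>lawB\<close>.\<close>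
  define V where "V z k = s * (\<Sum>l<cnt k. c (r l) * z l)" for z :: "nat \<Rightarrow> real" and k
  \<comment> \<open>\<open>meas\<close> applies only to sequences that start at \<open>0\<close>. If
    \<open>cnt 0\<close> were positive, a positive sum of squares would equal an empty sum.\<close>
  have V0: "V z 0 = 0" for z
  proof -
    have "cnt 0 = 0"
    proof (rule ccontr)
      assume "cnt 0 \<noteq> 0"
      then have "0 < (\<Sum>l<cnt 0. (c (r l))\<^sup>2)" using r(1)[of 0] r(3)[of 0]
        by (intro sum_pos2[of _ 0]) auto
      then show False using sums[of 0 "\<lambda>i. (c i)\<^sup>2"] by simp
    qed
    then show ?thesis by (simp add: V_def)
  qed
  have FV: "(\<lambda>z. F (V z)) \<in> borel_measurable ?P"
  proof (rule meas)
    fix k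
    show "(\<lambda>z. V z k) \<in> borel_measurable ?P"
      unfolding V_def using r(3)[of k]
      by (intro borel_measurable_times borel_measurable_sum borel_measurable_const measurable_component_singleton) auto
  qed (rule V0)
  have boot: "F (\<lambda>k. sqrt (K 1 / S) * (\<Sum>i=1..k. c i * x i)) = F (V (\<lambda>l\<in>{..<m}. x (r l)))" for x
  proof (rule F)
    fix k assume k: "k \<le> n"
    have "(\<Sum>i=1..k. c i * x i) = (\<Sum>l<cnt k. c (r l) * x (r l))" by (rule sums[OF k]) simp
    also have "\<dots> = (\<Sum>l<cnt k. c (r l) * (\<lambda>l\<in>{..<m}. x (r l)) l)"
      using r(3)[of k] by (intro sum.cong) auto
    finally show "sqrt (K 1 / S) * (\<Sum>i=1..k. c i * x i) = V (\<lambda>l\<in>{..<m}. x (r l)) k"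
      by (simp add: V_def s_def)
  qed
  have proc: "F (\<lambda>k. G \<nu> (J (K 1 * (\<Sum>i=1..k. (c i)\<^sup>2) / S))) = F (V (\<lambda>l\<in>{..<m}. Z l \<nu>))" if \<nu>: "\<nu> \<in> space N" for \<nu>
  proof (rule F)
    fix k assume k: "k \<le> n"
    have "(\<Sum>i=1..k. (c i)\<^sup>2) = (\<Sum>l<cnt k. (c (r l))\<^sup>2)" by (rule sums[OF k]) simp
    then have "G \<nu> (J (K 1 * (\<Sum>i=1..k. (c i)\<^sup>2) / S)) = G \<nu> (ts (cnt k)) - G \<nu> (ts 0)"
      using ts0 continuous_processD(3)[OF cp \<nu>] by (simp add: ts_def)
    also have "\<dots> = (\<Sum>l<cnt k. D l \<nu>)" unfolding D_def by (rule sum_lessThan_telescope[symmetric])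
    also have "\<dots> = (\<Sum>l<cnt k. s * (c (r l) * (\<lambda>l\<in>{..<m}. Z l \<nu>) l))"
      using r(1) r(3)[of k] s(1) by (intro sum.cong) (auto simp: Z_def)
    finally show "G \<nu> (J (K 1 * (\<Sum>i=1..k. (c i)\<^sup>2) / S)) = V (\<lambda>l\<in>{..<m}. Z l \<nu>) k"
      by (simp add: V_def sum_distrib_left)
  qed
  have "distr (boot_law n) borel (\<lambda>x. F (\<lambda>k. sqrt (K 1 / S) * (\<Sum>i=1..k. c i * x i)))
      = distr (distr (boot_law n) ?P (\<lambda>x. \<lambda>l\<in>{..<m}. x (r l))) borel (\<lambda>z. F (V z))"
    unfolding boot using distr_distr[OF FV bootvec] by (simp add: comp_def)
  also have "\<dots> = distr (distr N ?P (\<lambda>\<nu>. \<lambda>l\<in>{..<m}. Z l \<nu>)) borel (\<lambda>z. F (V z))"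
    unfolding lawB lawZ ..
  also have "\<dots> = distr N borel (\<lambda>\<nu>. F (V (\<lambda>l\<in>{..<m}. Z l \<nu>)))"
    using distr_distr[OF FV Zvec] by (simp add: comp_def)
  also have "\<dots> = distr N borel (\<lambda>\<nu>. F (\<lambda>k. G \<nu> (J (K 1 * (\<Sum>i=1..k. (c i)\<^sup>2) / S))))"
    by (rule distr_cong) (simp_all only: proc)
  finally show ?thesis .
qed

section \<open>Scaling and measurability of the statistics\<close>

lemma Max_insert_0_scale:
  fixes a :: "nat \<Rightarrow> real"
  assumes s: "0 \<le> s"
  shows "Max (insert 0 {s * a i |i. 1 \<le> i \<and> i \<le> k}) = s * Max (insert 0 {a i |i. 1 \<le> i \<and> i \<le> k})"
proof -
  have "insert 0 {s * a i |i. 1 \<le> i \<and> i \<le> k} = (*) s ` insert 0 {a i |i. 1 \<le> i \<and> i \<le> k}" by auto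
  moreover have "(*) s (Max (insert 0 {a i |i. 1 \<le> i \<and> i \<le> k})) = Max ((*) s ` insert 0 {a i |i. 1 \<le> i \<and> i \<le> k})"
    by (rule mono_Max_commute) (auto intro!: monoI mult_left_mono s)
  ultimately show ?thesis by simp
qed

lemma dbridge_scale:
  assumes s: "0 \<le> s"
  shows "dbridge_max (\<lambda>k. s * V k) k = s * dbridge_max V k"
    and "dbridge_sq (\<lambda>k. s * V k) k = s\<^sup>2 * dbridge_sq V k"
    and "rev_seq n (\<lambda>k. s * V k) = (\<lambda>k. s * rev_seq n V k)"
proof -
  have "s * V i - real i / real k * (s * V k) = s * (V i - real i / real k * V k)" for i
    by (simp add: algebra_simps)
  then have eq: "\<bar>s * V i - real i / real k * (s * V k)\<bar> = s * \<bar>V i - real i / real k * V k\<bar>"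
    "(s * V i - real i / real k * (s * V k))\<^sup>2 = s\<^sup>2 * (V i - real i / real k * V k)\<^sup>2" for i
    using s by (simp_all add: abs_mult power_mult_distrib)
  show "dbridge_max (\<lambda>k. s * V k) k = s * dbridge_max V k"
    unfolding dbridge_max_def eq(1) by (rule Max_insert_0_scale[OF s])
  show "dbridge_sq (\<lambda>k. s * V k) k = s\<^sup>2 * dbridge_sq V k"
    unfolding dbridge_sq_def eq(2) by (simp add: sum_distrib_left)
  show "rev_seq n (\<lambda>k. s * V k) = (\<lambda>k. s * rev_seq n V k)"
    by (auto simp: rev_seq_def algebra_simps)
qed

lemma statistics_scale:
  assumes s: "0 < s" and V0: "V 0 = 0"
  shows "Qstat n (\<lambda>k. s * V k) = Qstat n V" and "Rstat n (\<lambda>k. s * V k) = Rstat n V"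
proof -
  have sV0: "s * V 0 = 0" using V0 by simp
  have num: "s * V k - real k / real n * (s * V n) = s * (V k - real k / real n * V n)" for k
    by (simp add: algebra_simps)
  have "(s * x) / (s * y + s * z) = x / (y + z)" for x y z
    using s by (simp add: distrib_left[symmetric])
  then show "Qstat n (\<lambda>k. s * V k) = Qstat n V"
    unfolding Qstat_alt[of "\<lambda>k. s * V k", OF sV0] Qstat_alt[of V, OF V0] dbridge_scale(1,3)[OF less_imp_le[OF s]] num by simp
  have "(s * x)\<^sup>2 / (s\<^sup>2 * y + s\<^sup>2 * z) = x\<^sup>2 / (y + z)" for x y z
    using s by (simp add: distrib_left[symmetric] power_mult_distrib)
  then show "Rstat n (\<lambda>k. s * V k) = Rstat n V"
    unfolding Rstat_alt[of "\<lambda>k. s * V k", OF sV0] Rstat_alt[of V, OF V0] dbridge_scale(2,3)[OF less_imp_le[OF s]] num by simp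
qed

lemma dbridge_cong:
  assumes "\<And>j. j \<le> k \<Longrightarrow> V j = V' j"
  shows "dbridge_max V k = dbridge_max V' k" "dbridge_sq V k = dbridge_sq V' k"
proof -
  have "{\<bar>V i - real i / real k * V k\<bar> |i. 1 \<le> i \<and> i \<le> k} = {\<bar>V' i - real i / real k * V' k\<bar> |i. 1 \<le> i \<and> i \<le> k}"
    using assms by (intro Collect_cong ex_cong1 rev_conj_cong refl) simp
  then show "dbridge_max V k = dbridge_max V' k" by (simp add: dbridge_max_def)
  show "dbridge_sq V k = dbridge_sq V' k"
    unfolding dbridge_sq_def using assms by (intro sum.cong) auto
qed

lemma statistics_cong:
  assumes eq: "\<And>k. k \<le> n \<Longrightarrow> V k = V' k" and V0: "V 0 = 0"
  shows "Qstat n V = Qstat n V'" and "Rstat n V = Rstat n V'"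
proof -
  have V0': "V' 0 = 0" using eq[of 0] V0 by simp
  have d: "dbridge_max V k = dbridge_max V' k" "dbridge_sq V k = dbridge_sq V' k"
    "dbridge_max (rev_seq n V) (n - k) = dbridge_max (rev_seq n V') (n - k)"
    "dbridge_sq (rev_seq n V) (n - k) = dbridge_sq (rev_seq n V') (n - k)" if "k \<le> n" for k
    using that eq by (auto intro!: dbridge_cong simp: rev_seq_def)
  have "{\<bar>(V k - real k / real n * V n) / (dbridge_max V k + dbridge_max (rev_seq n V) (n - k))\<bar> |k. 1 \<le> k \<and> k \<le> n}
      = {\<bar>(V' k - real k / real n * V' n) / (dbridge_max V' k + dbridge_max (rev_seq n V') (n - k))\<bar> |k. 1 \<le> k \<and> k \<le> n}"
    using d eq by (intro Collect_cong ex_cong1 rev_conj_cong refl) simp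
  then show "Qstat n V = Qstat n V'" unfolding Qstat_alt[of V, OF V0] Qstat_alt[of V', OF V0'] by simp
  show "Rstat n V = Rstat n V'"
    unfolding Rstat_alt[of V, OF V0] Rstat_alt[of V', OF V0'] using d eq by (intro sum.cong) auto
qed

lemma borel_measurable_statistics:
  assumes V: "\<And>k. k \<le> n \<Longrightarrow> (\<lambda>x. V x k) \<in> borel_measurable P" and V0: "\<And>x. V x 0 = 0"
  shows "(\<lambda>x. Qstat n (V x)) \<in> borel_measurable P" and "(\<lambda>x. Rstat n (V x)) \<in> borel_measurable P"
proof -
  have dm: "(\<lambda>x. dbridge_max (U x) k) \<in> borel_measurable P" "(\<lambda>x. dbridge_sq (U x) k) \<in> borel_measurable P"
    if "\<And>j. j \<le> k \<Longrightarrow> (\<lambda>x. U x j) \<in> borel_measurable P" for U k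
    unfolding dbridge_max_def dbridge_sq_def
    by (intro borel_measurable_Max_grid borel_measurable_sum borel_measurable_abs borel_measurable_power
        borel_measurable_diff borel_measurable_times borel_measurable_const that; simp)+
  have d: "(\<lambda>x. dbridge_max (V x) k) \<in> borel_measurable P" "(\<lambda>x. dbridge_sq (V x) k) \<in> borel_measurable P"
    "(\<lambda>x. dbridge_max (rev_seq n (V x)) (n - k)) \<in> borel_measurable P"
    "(\<lambda>x. dbridge_sq (rev_seq n (V x)) (n - k)) \<in> borel_measurable P" if "k \<le> n" for k
    using that V by (auto intro!: dm borel_measurable_diff simp: rev_seq_def)
  show "(\<lambda>x. Qstat n (V x)) \<in> borel_measurable P"
    unfolding Qstat_alt[where V = "V x" for x, OF V0]
    by (intro borel_measurable_Max_grid borel_measurable_abs borel_measurable_divide borel_measurable_diff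
        borel_measurable_add borel_measurable_times borel_measurable_const V d) auto
  show "(\<lambda>x. Rstat n (V x)) \<in> borel_measurable P"
    unfolding Rstat_alt[where V = "V x" for x, OF V0]
    by (intro borel_measurable_sum borel_measurable_divide borel_measurable_diff
        borel_measurable_add borel_measurable_times borel_measurable_const borel_measurable_power V d) auto
qed

lemma prob_space_boot_law: "prob_space (boot_law n)"
  unfolding boot_law_def by (intro prob_space_PiM prob_space_std_normal)

lemma borel_measurable_boot_component:
  assumes "i \<in> {1..n}" shows "(\<lambda>x. x i) \<in> borel_measurable (boot_law n)"
  unfolding boot_law_def
  using measurable_component_singleton[OF assms, of "\<lambda>_. density lborel std_normal_density"]
  by (simp cong: measurable_cong_sets)

section \<open>Weak convergence by almost sure convergence on the space of the limit\<close>

text \<open>Only laws have to agree, and only eventually: the \<open>D n\<close> come from the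
  bootstrap space, the \<open>X n\<close> from the space of the limit. Dominated convergence for
  continuous step functions then suffices.\<close>

lemma weak_conv_m_of_AE_tendsto:
  fixes X :: "nat \<Rightarrow> 'b \<Rightarrow> real" and Y :: "'b \<Rightarrow> real"
  assumes N: "prob_space N" and D: "\<And>n. real_distribution (D n)"
    and Y: "Y \<in> borel_measurable N" and X: "\<And>n. X n \<in> borel_measurable N"
    and D_eq: "\<forall>\<^sub>F n in sequentially. D n = distr N borel (X n)"
    and lim: "AE \<nu> in N. (\<lambda>n. X n \<nu>) \<longlonglongrightarrow> Y \<nu>"
  shows "weak_conv_m D (distr N borel Y)"
proof (rule integral_cts_step_conv_imp_weak_conv)
  interpret prob_space N by fact
  show "real_distribution (distr N borel Y)" "real_distribution (D n)" for n using Y D by auto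
  fix x y :: real assume xy: "x < y"
  have cont: "continuous_on UNIV (cts_step x y)"
    by (rule uniformly_continuous_imp_continuous[OF cts_step_uniformly_continuous[OF xy]])
  then have cm: "cts_step x y \<in> borel_measurable borel" by (rule borel_measurable_continuous_onI)
  have bnd: "\<bar>cts_step x y z\<bar> \<le> 1" for z using xy by (auto simp: cts_step_def)
  have "(\<lambda>n. expectation (\<lambda>\<nu>. cts_step x y (X n \<nu>))) \<longlonglongrightarrow> expectation (\<lambda>\<nu>. cts_step x y (Y \<nu>))"
  proof (rule integral_dominated_convergence[where w = "\<lambda>_. 1"])
    show "AE \<nu> in N. (\<lambda>n. cts_step x y (X n \<nu>)) \<longlonglongrightarrow> cts_step x y (Y \<nu>)"
      using lim by eventually_elim (auto intro!: continuous_on_tendsto_compose[OF cont])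
    show "AE \<nu> in N. norm (cts_step x y (X n \<nu>)) \<le> 1" for n using bnd by simp
  qed (use measurable_compose[OF Y cm] measurable_compose[OF X cm] in auto)
  moreover have "\<forall>\<^sub>F n in sequentially. expectation (\<lambda>\<nu>. cts_step x y (X n \<nu>)) = integral\<^sup>L (D n) (cts_step x y)"
    using D_eq by eventually_elim (simp add: integral_distr[OF X cm])
  ultimately have "(\<lambda>n. integral\<^sup>L (D n) (cts_step x y)) \<longlonglongrightarrow> expectation (\<lambda>\<nu>. cts_step x y (Y \<nu>))"
    by (rule Lim_transform_eventually)
  then show "(\<lambda>n. integral\<^sup>L (D n) (cts_step x y)) \<longlonglongrightarrow> integral\<^sup>L (distr N borel Y) (cts_step x y)"
    by (simp add: integral_distr[OF Y cm])
qed

text \<open>By scale invariance only the profile of the variances relative to their total matters,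
  so the factor \<open>h\<close> drops out. The walk is realised in law as \<open>G\<close> at times
  \<open>g n k\<close> close to \<open>k / n\<close>, where the pathwise convergence
  applies.\<close>

theorem weak_conv_weighted_gaussian_sums:
  assumes N: "prob_space N" and cp: "continuous_process N G" and G: "gaussian_increments N K G"
    and K: "strict_mono_on {0..1} K" "continuous_on {0..1} K" "K 0 = 0" and h: "0 < h"
    and c: "grid_conv (\<lambda>n k. (\<Sum>i=1..k. (c n i)\<^sup>2) / real n) (\<lambda>t. h * K t)"
  shows "weak_conv_m (\<lambda>n. distr (boot_law n) borel (\<lambda>x. Qstat n (\<lambda>k. \<Sum>i=1..k. c n i * x i)))
      (distr N borel (\<lambda>\<nu>. Sfun (G \<nu>)))"
    and "weak_conv_m (\<lambda>n. distr (boot_law n) borel (\<lambda>x. Rstat n (\<lambda>k. \<Sum>i=1..k. c n i * x i)))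
      (distr N borel (\<lambda>\<nu>. Tfun (G \<nu>)))"
proof -
  interpret prob_space N by fact
  have K1: "0 < K 1" using strict_mono_onD[OF K(1), of 0 1] K(3) by simp
  obtain J where J: "continuous_on {0..K 1} J" "\<And>t. 0 \<le> t \<Longrightarrow> t \<le> 1 \<Longrightarrow> J (K t) = t"
    "\<And>y. 0 \<le> y \<Longrightarrow> y \<le> K 1 \<Longrightarrow> K (J y) = y" "\<And>y. 0 \<le> y \<Longrightarrow> y \<le> K 1 \<Longrightarrow> J y \<in> {0..1}"
    using strict_mono_continuous_inverse[OF K] by blast
  define S where "S n = (\<Sum>i=1..n. (c n i)\<^sup>2)" for n
  define a where "a n k = (\<Sum>i=1..k. (c n i)\<^sup>2) / S n" for n k
  have S_nn: "0 \<le> S n" for n unfolding S_def by (rule sum_nonneg) simp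
  have a01: "a n k \<in> {0..1}" if "k \<le> n" for n k
  proof -
    have "(\<Sum>i=1..k. (c n i)\<^sup>2) \<le> S n" unfolding S_def using that by (intro sum_mono2) auto
    then show ?thesis unfolding a_def using S_nn[of n] by (auto simp: divide_le_eq_1 intro!: divide_nonneg_nonneg sum_nonneg)
  qed
  have Kb: "\<bar>h * K t\<bar> \<le> h * K 1" if "0 \<le> t" "t \<le> 1" for t
    using strict_mono_on_leD[OF K(1), of 0 t] strict_mono_on_leD[OF K(1), of t 1] that K(3) h by auto
  \<comment> \<open>The time change divides by the total variance, which can vanish for finitely
    many \<open>n\<close> only.\<close>
  have S_pos: "\<forall>\<^sub>F n in sequentially. 0 < S n"
  proof -
    have "\<forall>\<^sub>F n in sequentially. \<forall>k\<le>n. \<bar>S n / real n - h * K 1\<bar> < h * K 1"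
      using grid_convD[OF grid_conv_last[OF c], of "h * K 1"] h K1 by (simp add: S_def)
    then show ?thesis
    proof eventually_elim
      case (elim n)
      then have "0 < S n / real n" by (auto simp: abs_less_iff)
      then show ?case using S_nn[of n] by (cases "S n = 0") auto
    qed
  qed
  have a: "grid_conv a (\<lambda>t. K t / K 1)"
  proof (rule grid_conv_cong)
    show "grid_conv (\<lambda>n k. (\<Sum>i=1..k. (c n i)\<^sup>2) / real n * inverse (S n / real n)) (\<lambda>t. h * K t * inverse (h * K 1))"
      unfolding S_def
      by (rule grid_conv_mult[OF c grid_conv_inverse[OF grid_conv_last[OF c], of "h * K 1"] Kb, of "inverse (h * K 1)"])
         (use h K1 in auto)
    show "\<forall>\<^sub>F n in sequentially. \<forall>k\<le>n. a n k = (\<Sum>i=1..k. (c n i)\<^sup>2) / real n * inverse (S n / real n)"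
      using eventually_gt_at_top[of 0] by eventually_elim (simp add: a_def field_simps)
    show "K t / K 1 = h * K t * inverse (h * K 1)" for t using h by (simp add: field_simps)
  qed
  \<comment> \<open>Chosen such that \<open>K (g n k)\<close> is the fraction \<open>a n k\<close>
    of \<open>K 1\<close>. As \<open>a n k\<close> is close to \<open>K (k / n) / K 1\<close>,
    inverting the clock gives nearly \<open>k / n\<close>.\<close>
  define g where "g n k = J (K 1 * a n k)" for n k
  have g01: "g n k \<in> {0..1}" if "k \<le> n" for n k
    unfolding g_def using a01[OF that] K1 by (intro J(4)) (auto simp: mult_left_le)
  have g: "grid_conv g (\<lambda>t. t)"
  proof (rule grid_conv_cong)
    have J': "continuous_on {0..1} (\<lambda>u. J (K 1 * u))"
      by (rule continuous_on_compose2[OF J(1)]) (use K1 in \<open>auto intro!: continuous_intros simp: mult_left_le\<close>)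
    have "K t / K 1 \<in> {0..1}" if "0 \<le> t" "t \<le> 1" for t
      using strict_mono_on_leD[OF K(1), of 0 t] strict_mono_on_leD[OF K(1), of t 1] that K(3) K1 by auto
    from grid_conv_compose[OF a J' this a01]
    show "grid_conv (\<lambda>n k. J (K 1 * a n k)) (\<lambda>t. J (K 1 * (K t / K 1)))" .
    show "t = J (K 1 * (K t / K 1))" if "0 \<le> t" "t \<le> 1" for t using J(2)[OF that] K1 by simp
  qed (simp add: g_def)
  \<comment> \<open>The value at \<open>k = 0\<close> is set to \<open>0\<close> also outside
    \<open>space N\<close>, because the measurability lemma asks for it at every argument.\<close>
  define V where "V \<nu> n k = (if k = 0 then 0 else G \<nu> (g n k))" for \<nu> n k
  have g0: "g n 0 = 0" for n using J(2)[of 0] K(3) by (simp add: g_def a_def)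
  have V_eq: "V \<nu> n k = G \<nu> (g n k)" if "\<nu> \<in> space N" for \<nu> n k
    using g0 continuous_processD(3)[OF cp that] by (simp add: V_def)
  have V: "grid_conv (V \<nu>) (G \<nu>)" if \<nu>: "\<nu> \<in> space N" for \<nu>
  proof -
    have "grid_conv (\<lambda>n k. G \<nu> (g n k)) (G \<nu>)"
      by (rule grid_conv_compose[OF g continuous_processD(2)[OF cp \<nu>] _ g01]) auto
    then show ?thesis unfolding V_eq[OF \<nu>, abs_def] .
  qed
  have Vm: "(\<lambda>\<nu>. V \<nu> n k) \<in> borel_measurable N" if "k \<le> n" for n k
    unfolding V_def using g01[OF that] continuous_processD(1)[OF cp, of "g n k"] by (cases "k = 0") auto
  have nl: "AE \<nu> in N. nonlinear_halves (G \<nu>)" by (rule AE_nonlinear_halves[OF N G K(1)])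
  have boot_meas: "(\<lambda>x. \<Sum>i=1..k. c n i * x i) \<in> borel_measurable (boot_law n)" if "k \<le> n" for n k
    using that by (intro borel_measurable_sum borel_measurable_times borel_measurable_const borel_measurable_boot_component) auto
  have rd: "real_distribution (distr (boot_law n) borel X)" if "X \<in> borel_measurable (boot_law n)" for n X
    using prob_space.real_distribution_distr[OF prob_space_boot_law that] .
  have law: "\<forall>\<^sub>F n in sequentially. distr (boot_law n) borel (\<lambda>x. F n (\<lambda>k. \<Sum>i=1..k. c n i * x i)) = distr N borel (\<lambda>\<nu>. F n (V \<nu> n))"
    if F: "\<And>n V V'. (\<And>k. k \<le> n \<Longrightarrow> V k = V' k) \<Longrightarrow> V 0 = 0 \<Longrightarrow> F n V = F n V'"
      and meas: "\<And>(P :: (nat \<Rightarrow> real) measure) n V. (\<And>k. k \<le> n \<Longrightarrow> (\<lambda>x. V x k) \<in> borel_measurable P) \<Longrightarrow>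
        (\<And>x. V x 0 = 0) \<Longrightarrow> (\<lambda>x. F n (V x)) \<in> borel_measurable P"
      and scale: "\<And>n s V. 0 < s \<Longrightarrow> V 0 = 0 \<Longrightarrow> F n (\<lambda>k. s * V k) = F n V"
    for F :: "nat \<Rightarrow> (nat \<Rightarrow> real) \<Rightarrow> real"
    using S_pos
  proof eventually_elim
    case (elim n)
    \<comment> \<open>\<open>distr_gaussian_partial_sums\<close> asks for a functional that depends
      only on the values up to \<open>n\<close> for every sequence, whereas the statistics are known
      to do so only for sequences that start at \<open>0\<close>.\<close>
    define F' where "F' U = (if U 0 = 0 then F n U else 0)" for U :: "nat \<Rightarrow> real"
    have "distr (boot_law n) borel (\<lambda>x. F' (\<lambda>k. sqrt (K 1 / S n) * (\<Sum>i=1..k. c n i * x i)))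
       = distr N borel (\<lambda>\<nu>. F' (\<lambda>k. G \<nu> (J (K 1 * (\<Sum>i=1..k. (c n i)\<^sup>2) / S n))))"
      unfolding S_def
    proof (rule distr_gaussian_partial_sums[OF N cp G K(1,3) J(2,3,4)])
      show "0 < (\<Sum>i=1..n. (c n i)\<^sup>2)" using elim by (simp add: S_def)
      show "F' U = F' U'" if "\<And>k. k \<le> n \<Longrightarrow> U k = U' k" for U U'
        using that F[of n U U'] by (simp add: F'_def)
      show "(\<lambda>x. F' (U x)) \<in> borel_measurable P" if "\<And>k. k \<le> n \<Longrightarrow> (\<lambda>x. U x k) \<in> borel_measurable P" "\<And>x. U x 0 = 0"
        for U and P :: "(nat \<Rightarrow> real) measure"
      proof -
        have "(\<lambda>x. F n (U x)) \<in> borel_measurable P" by (rule meas) (simp_all add: that)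
        then show ?thesis using that(2) by (simp add: F'_def)
      qed
    qed
    moreover have "F' (\<lambda>k. sqrt (K 1 / S n) * (\<Sum>i=1..k. c n i * x i)) = F n (\<lambda>k. \<Sum>i=1..k. c n i * x i)" for x
      unfolding F'_def using scale[of "sqrt (K 1 / S n)" "\<lambda>k. \<Sum>i=1..k. c n i * x i" n] elim K1 by simp
    moreover have "F' (\<lambda>k. G \<nu> (J (K 1 * (\<Sum>i=1..k. (c n i)\<^sup>2) / S n))) = F n (V \<nu> n)" if "\<nu> \<in> space N" for \<nu>
    proof -
      have "(\<lambda>k. G \<nu> (J (K 1 * (\<Sum>i=1..k. (c n i)\<^sup>2) / S n))) = V \<nu> n"
        unfolding V_eq[OF that, abs_def] g_def a_def by simp
      then show ?thesis by (simp add: F'_def V_def)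
    qed
    then have "distr N borel (\<lambda>\<nu>. F' (\<lambda>k. G \<nu> (J (K 1 * (\<Sum>i=1..k. (c n i)\<^sup>2) / S n)))) = distr N borel (\<lambda>\<nu>. F n (V \<nu> n))"
      by (intro distr_cong refl)
    ultimately show ?case by simp
  qed
  show "weak_conv_m (\<lambda>n. distr (boot_law n) borel (\<lambda>x. Qstat n (\<lambda>k. \<Sum>i=1..k. c n i * x i)))
      (distr N borel (\<lambda>\<nu>. Sfun (G \<nu>)))"
  proof (rule weak_conv_m_of_AE_tendsto[OF N, where X = "\<lambda>n \<nu>. Qstat n (V \<nu> n)"])
    show "AE \<nu> in N. (\<lambda>n. Qstat n (V \<nu> n)) \<longlonglongrightarrow> Sfun (G \<nu>)"
      using nl AE_space
    proof eventually_elim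
      case (elim \<nu>)
      show ?case
        by (rule Qstat_tendsto_Sfun[OF V[OF elim(2)] continuous_processD(2,3)[OF cp elim(2)] _ elim(1)]) (simp add: V_def)
    qed
    show "\<forall>\<^sub>F n in sequentially. distr (boot_law n) borel (\<lambda>x. Qstat n (\<lambda>k. \<Sum>i=1..k. c n i * x i)) = distr N borel (\<lambda>\<nu>. Qstat n (V \<nu> n))"
      by (rule law) (rule statistics_cong borel_measurable_statistics statistics_scale; assumption)+
    show "(\<lambda>\<nu>. Qstat n (V \<nu> n)) \<in> borel_measurable N" for n
      by (rule borel_measurable_statistics(1)[OF Vm]) (simp_all add: V_def)
    show "real_distribution (distr (boot_law n) borel (\<lambda>x. Qstat n (\<lambda>k. \<Sum>i=1..k. c n i * x i)))" for n
      by (rule rd, rule borel_measurable_statistics(1)[OF boot_meas]) simp_all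
  qed (rule borel_measurable_Sfun[OF cp])
  show "weak_conv_m (\<lambda>n. distr (boot_law n) borel (\<lambda>x. Rstat n (\<lambda>k. \<Sum>i=1..k. c n i * x i)))
      (distr N borel (\<lambda>\<nu>. Tfun (G \<nu>)))"
  proof (rule weak_conv_m_of_AE_tendsto[OF N, where X = "\<lambda>n \<nu>. Rstat n (V \<nu> n)"])
    show "AE \<nu> in N. (\<lambda>n. Rstat n (V \<nu> n)) \<longlonglongrightarrow> Tfun (G \<nu>)"
      using nl AE_space
    proof eventually_elim
      case (elim \<nu>)
      show ?case
        by (rule Rstat_tendsto_Tfun[OF V[OF elim(2)] continuous_processD(2,3)[OF cp elim(2)] _ elim(1)]) (simp add: V_def)
    qed
    show "\<forall>\<^sub>F n in sequentially. distr (boot_law n) borel (\<lambda>x. Rstat n (\<lambda>k. \<Sum>i=1..k. c n i * x i)) = distr N borel (\<lambda>\<nu>. Rstat n (V \<nu> n))"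
      by (rule law) (rule statistics_cong borel_measurable_statistics statistics_scale; assumption)+
    show "(\<lambda>\<nu>. Rstat n (V \<nu> n)) \<in> borel_measurable N" for n
      by (rule borel_measurable_statistics(2)[OF Vm]) (simp_all add: V_def)
    show "real_distribution (distr (boot_law n) borel (\<lambda>x. Rstat n (\<lambda>k. \<Sum>i=1..k. c n i * x i)))" for n
      by (rule rd, rule borel_measurable_statistics(2)[OF boot_meas]) simp_all
  qed (rule borel_measurable_Tfun[OF cp])
qed

section \<open>The limit processes\<close>

text \<open>The probability of a rectangle factors first across the two families, by independence of
  the vectors, and then inside each. The increments of \<open>W\<close> and \<open>B\<close> become
  one independent family in this way.\<close>

lemma (in prob_space) indep_vars_case_sum:
  fixes A :: "'i \<Rightarrow> 'a \<Rightarrow> real" and B :: "'i \<Rightarrow> 'a \<Rightarrow> real"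
  assumes A: "indep_vars (\<lambda>_. borel) A I" and B: "indep_vars (\<lambda>_. borel) B J"
    and I: "finite I" "I \<noteq> {}" and J: "finite J" "J \<noteq> {}"
    and AB: "indep_var (Pi\<^sub>M I (\<lambda>_. borel)) (\<lambda>\<omega>. \<lambda>i\<in>I. A i \<omega>) (Pi\<^sub>M J (\<lambda>_. borel)) (\<lambda>\<omega>. \<lambda>j\<in>J. B j \<omega>)"
  shows "indep_vars (\<lambda>_. borel) (case_sum A B) (Inl ` I \<union> Inr ` J)"
proof -
  have Am: "A i \<in> borel_measurable M" if "i \<in> I" for i using A that by (auto simp: indep_vars_def)
  have Bm: "B j \<in> borel_measurable M" if "j \<in> J" for j using B that by (auto simp: indep_vars_def)
  have Xm: "case_sum A B l \<in> borel_measurable M" if "l \<in> Inl ` I \<union> Inr ` J" for l using that Am Bm by auto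
  have ne: "Inl ` I \<union> Inr ` J \<noteq> {}" "finite (Inl ` I \<union> Inr ` J)" using I J by auto
  let ?F = "\<lambda>l. {case_sum A B l -` S \<inter> space M |S. S \<in> sets borel}"
  \<comment> \<open>Each of the set systems contains \<open>space M\<close>, so it suffices to test
    intersections over the whole finite index set.\<close>
  have "indep_sets ?F (Inl ` I \<union> Inr ` J)"
  proof (subst indep_sets_finite[OF ne])
    show "?F l \<subseteq> events" if "l \<in> Inl ` I \<union> Inr ` J" for l
      using measurable_sets[OF Xm[OF that]] by auto
    show "space M \<in> ?F l" if "l \<in> Inl ` I \<union> Inr ` J" for l
      by (rule CollectI, rule exI[of _ UNIV]) auto
    show "\<forall>T\<in>Pi (Inl ` I \<union> Inr ` J) ?F. prob (\<Inter>l\<in>Inl ` I \<union> Inr ` J. T l) = (\<Prod>l\<in>Inl ` I \<union> Inr ` J. prob (T l))"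
    proof
      fix T assume T: "T \<in> Pi (Inl ` I \<union> Inr ` J) ?F"
      then have "\<forall>l\<in>Inl ` I \<union> Inr ` J. \<exists>S. S \<in> sets borel \<and> T l = case_sum A B l -` S \<inter> space M" by blast
      then obtain S where S: "\<And>l. l \<in> Inl ` I \<union> Inr ` J \<Longrightarrow> S l \<in> sets borel"
        "\<And>l. l \<in> Inl ` I \<union> Inr ` J \<Longrightarrow> T l = case_sum A B l -` S l \<inter> space M" by metis
      have TA: "T (Inl i) = A i -` S (Inl i) \<inter> space M" if "i \<in> I" for i using S(2)[of "Inl i"] that by auto
      have TB: "T (Inr j) = B j -` S (Inr j) \<inter> space M" if "j \<in> J" for j using S(2)[of "Inr j"] that by auto
      have SA: "S (Inl i) \<in> sets borel" if "i \<in> I" for i using S(1)[of "Inl i"] that by auto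
      have SB: "S (Inr j) \<in> sets borel" if "j \<in> J" for j using S(1)[of "Inr j"] that by auto
      let ?RA = "\<lambda>\<omega>. \<lambda>i\<in>I. A i \<omega>" and ?RB = "\<lambda>\<omega>. \<lambda>j\<in>J. B j \<omega>"
      let ?PA = "Pi\<^sub>E I (\<lambda>i. S (Inl i))" and ?PB = "Pi\<^sub>E J (\<lambda>j. S (Inr j))"
      have IA: "(\<Inter>i\<in>I. T (Inl i)) = ?RA -` ?PA \<inter> space M" using I(2) TA by (auto simp: PiE_iff)
      have IB: "(\<Inter>j\<in>J. T (Inr j)) = ?RB -` ?PB \<inter> space M" using J(2) TB by (auto simp: PiE_iff)
      have PA: "?PA \<in> sets (Pi\<^sub>M I (\<lambda>_. borel))" using SA I(1) by (intro sets_PiM_I_finite) auto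
      have PB: "?PB \<in> sets (Pi\<^sub>M J (\<lambda>_. borel))" using SB J(1) by (intro sets_PiM_I_finite) auto
      have "(\<Inter>l\<in>Inl ` I \<union> Inr ` J. T l) = (\<lambda>\<omega>. (?RA \<omega>, ?RB \<omega>)) -` (?PA \<times> ?PB) \<inter> space M"
        using IA IB by (auto simp: INT_Un)
      then have "prob (\<Inter>l\<in>Inl ` I \<union> Inr ` J. T l) = prob (\<Inter>i\<in>I. T (Inl i)) * prob (\<Inter>j\<in>J. T (Inr j))"
        unfolding IA IB using indep_varD[OF AB PA PB] by simp
      also have "prob (\<Inter>i\<in>I. T (Inl i)) = (\<Prod>i\<in>I. prob (T (Inl i)))"
        using indep_varsD[OF A I(2) I(1) subset_refl SA] TA by simp
      also have "prob (\<Inter>j\<in>J. T (Inr j)) = (\<Prod>j\<in>J. prob (T (Inr j)))"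
        using indep_varsD[OF B J(2) J(1) subset_refl SB] TB by simp
      also have "(\<Prod>i\<in>I. prob (T (Inl i))) * (\<Prod>j\<in>J. prob (T (Inr j))) = (\<Prod>l\<in>Inl ` I \<union> Inr ` J. prob (T l))"
        using I(1) J(1) by (subst prod.union_disjoint) (auto simp: prod.reindex)
      finally show "prob (\<Inter>l\<in>Inl ` I \<union> Inr ` J. T l) = (\<Prod>l\<in>Inl ` I \<union> Inr ` J. prob (T l))" .
    qed
  qed
  then show ?thesis unfolding indep_vars_def2 using Xm by auto
qed

lemma (in prob_space) indep_vars_block_sums:
  fixes X :: "'i \<Rightarrow> 'a \<Rightarrow> real"
  assumes X: "indep_vars (\<lambda>_. borel) X I" and K: "\<And>j. j \<in> L \<Longrightarrow> K j \<subseteq> I" "disjoint_family_on K L"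
  shows "indep_vars (\<lambda>_. borel) (\<lambda>j \<omega>. \<Sum>i\<in>K j. X i \<omega>) L"
proof -
  have "indep_vars (\<lambda>_. borel) (\<lambda>j \<omega>. (\<lambda>z. \<Sum>i\<in>K j. z i) (restrict (\<lambda>i. X i \<omega>) (K j))) L"
    by (rule indep_vars_compose2[OF indep_vars_restrict[OF X K]])
       (auto intro!: borel_measurable_sum measurable_component_singleton)
  moreover have "(\<lambda>z. \<Sum>i\<in>K j. z i) (restrict (\<lambda>i. X i \<omega>) (K j)) = (\<Sum>i\<in>K j. X i \<omega>)" for j \<omega>
    by (intro sum.cong) auto
  ultimately show ?thesis by simp
qed

lemma wienerD:
  assumes "wiener N W"
  shows "prob_space N" "W t \<in> borel_measurable N" "\<omega> \<in> space N \<Longrightarrow> W 0 \<omega> = 0"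
    "\<omega> \<in> space N \<Longrightarrow> continuous_on {0..1} (\<lambda>t. W t \<omega>)"
    "0 \<le> s \<Longrightarrow> s < u \<Longrightarrow> u \<le> 1 \<Longrightarrow> distributed N lborel (\<lambda>\<omega>. W u \<omega> - W s \<omega>) (normal_density 0 (sqrt (u - s)))"
    "0 \<le> ts 0 \<Longrightarrow> ts m \<le> 1 \<Longrightarrow> (\<And>i. i < m \<Longrightarrow> ts i < ts (Suc i)) \<Longrightarrow>
        prob_space.indep_vars N (\<lambda>_. borel) (\<lambda>i \<omega>. W (ts (Suc i)) \<omega> - W (ts i) \<omega>) {..<m}"
  using assms unfolding wiener_def by blast+

lemma increasing_sequence_bounds:
  fixes ts :: "nat \<Rightarrow> real"
  assumes "0 \<le> ts 0" "ts m \<le> 1" "\<And>i. i < m \<Longrightarrow> ts i < ts (Suc i)" "i \<le> m"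
  shows "0 \<le> ts i" "ts i \<le> 1"
proof -
  have mono: "ts a \<le> ts b" if "a \<le> b" "b \<le> m" for a b
    using that
  proof (induction b)
    case (Suc b)
    then show ?case using assms(3)[of b] by (cases "a = Suc b") auto
  qed simp
  show "0 \<le> ts i" "ts i \<le> 1" using mono[of 0 i] mono[of i m] assms by auto
qed

text \<open>\<open>vs2\<close> and \<open>\<eta>\<close> are parameters with defining equations, so
  that the locale can be interpreted with the quantities defined in the final theorem.\<close>

locale variance_profile =
  fixes \<sigma> :: "real \<Rightarrow> real" and D L vs2 \<eta>
  assumes pl: "piecewise_lipschitz \<sigma> D L" and pos: "\<And>t. 0 \<le> t \<Longrightarrow> t \<le> 1 \<Longrightarrow> 0 < \<sigma> t"
    and vs2_def: "vs2 = integral {0..1} (\<lambda>t. (\<sigma> t)\<^sup>2)"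
    and \<eta>_def: "\<eta> = (\<lambda>t. integral {0..t} (\<lambda>s. (\<sigma> s)\<^sup>2) / vs2)"
begin

lemma integral_increment:
  assumes "0 \<le> s" "s < t" "t \<le> 1"
  shows "integral {0..s} (\<lambda>s. (\<sigma> s)\<^sup>2) < integral {0..t} (\<lambda>s. (\<sigma> s)\<^sup>2)"
proof -
  obtain C where C: "\<And>t. 0 \<le> t \<Longrightarrow> t \<le> 1 \<Longrightarrow> \<bar>\<sigma> t\<bar> \<le> C" using piecewise_lipschitz_bounded[OF pl] by blast
  note pl2 = piecewise_lipschitz_power2[OF pl C]
  have "0 < (\<sigma> x)\<^sup>2" if "0 \<le> x" "x \<le> 1" for x using pos[OF that] by simp
  then have "0 < integral {s..t} (\<lambda>s. (\<sigma> s)\<^sup>2)"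
    using assms by (intro integral_pos_piecewise_lipschitz[OF pl2])
  moreover have "integral {0..s} (\<lambda>s. (\<sigma> s)\<^sup>2) + integral {s..t} (\<lambda>s. (\<sigma> s)\<^sup>2) = integral {0..t} (\<lambda>s. (\<sigma> s)\<^sup>2)"
    using assms
    by (intro Henstock_Kurzweil_Integration.integral_combine integrable_on_subinterval[OF piecewise_lipschitz_integrable[OF pl2]]) auto
  ultimately show ?thesis by simp
qed

lemma vs2_pos: "0 < vs2"
  using integral_increment[of 0 1] by (simp add: vs2_def)

lemma \<eta>_0: "\<eta> 0 = 0" and \<eta>_1: "\<eta> 1 = 1"
  using vs2_pos by (simp_all add: \<eta>_def vs2_def)

lemma \<eta>_strict_mono: "strict_mono_on {0..1} \<eta>"
  by (rule strict_mono_onI) (use integral_increment vs2_pos in \<open>auto simp: \<eta>_def divide_strict_right_mono\<close>)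

lemma \<eta>_range: "0 \<le> t \<Longrightarrow> t \<le> 1 \<Longrightarrow> \<eta> t \<in> {0..1}"
  using strict_mono_on_leD[OF \<eta>_strict_mono, of 0 t] strict_mono_on_leD[OF \<eta>_strict_mono, of t 1] \<eta>_0 \<eta>_1 by auto

lemma \<eta>_continuous: "continuous_on {0..1} \<eta>"
proof -
  obtain C where C: "\<And>t. 0 \<le> t \<Longrightarrow> t \<le> 1 \<Longrightarrow> \<bar>\<sigma> t\<bar> \<le> C" using piecewise_lipschitz_bounded[OF pl] by blast
  note pl2 = piecewise_lipschitz_power2[OF pl C]
  have "continuous_on {0..1} (\<lambda>t. integral {0..t} (\<lambda>s. (\<sigma> s)\<^sup>2))"
    by (rule indefinite_integral_continuous_1[OF piecewise_lipschitz_integrable[OF pl2]])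
  then show ?thesis unfolding \<eta>_def using vs2_pos by (intro continuous_intros) auto
qed

lemma \<eta>_partition:
  assumes "0 \<le> ts 0" "ts m \<le> 1" "\<And>i. i < m \<Longrightarrow> ts i < ts (Suc i)"
  shows "0 \<le> \<eta> (ts 0)" "\<eta> (ts m) \<le> 1" "\<And>i. i < m \<Longrightarrow> \<eta> (ts i) < \<eta> (ts (Suc i))"
proof -
  have b: "0 \<le> ts i \<and> ts i \<le> 1" if "i \<le> m" for i using increasing_sequence_bounds[OF assms that] by simp
  show "0 \<le> \<eta> (ts 0)" "\<eta> (ts m) \<le> 1" using \<eta>_range b[of 0] b[of m] by auto
  show "\<eta> (ts i) < \<eta> (ts (Suc i))" if "i < m" for i
    using strict_mono_onD[OF \<eta>_strict_mono, of "ts i" "ts (Suc i)"] b[of i] b[of "Suc i"] assms(3)[OF that] that by auto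
qed

lemma continuous_process_time_change:
  assumes W: "wiener N W" shows "continuous_process N (\<lambda>\<nu> t. W (\<eta> t) \<nu>)"
  unfolding continuous_process_def
proof (intro conjI ballI)
  show "(\<lambda>\<nu>. W (\<eta> t) \<nu>) \<in> borel_measurable N" for t using wienerD(2)[OF W] .
  fix \<nu> assume \<nu>: "\<nu> \<in> space N"
  show "continuous_on {0..1} (\<lambda>t. W (\<eta> t) \<nu>)"
    by (rule continuous_on_compose2[OF wienerD(4)[OF W \<nu>] \<eta>_continuous]) (use \<eta>_range in auto)
  show "W (\<eta> 0) \<nu> = 0" using wienerD(3)[OF W \<nu>] \<eta>_0 by simp
qed

lemma gaussian_increments_time_change:
  assumes W: "wiener N W" shows "gaussian_increments N \<eta> (\<lambda>\<nu> t. W (\<eta> t) \<nu>)"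
  unfolding gaussian_increments_def
proof (intro conjI allI impI)
  fix s t :: real assume "0 \<le> s \<and> s < t \<and> t \<le> 1"
  then show "distributed N lborel (\<lambda>\<nu>. W (\<eta> t) \<nu> - W (\<eta> s) \<nu>) (normal_density 0 (sqrt (\<eta> t - \<eta> s)))"
    using \<eta>_range[of s] \<eta>_range[of t] strict_mono_onD[OF \<eta>_strict_mono, of s t] by (intro wienerD(5)[OF W]) auto
next
  fix ts :: "nat \<Rightarrow> real" and m assume "0 \<le> ts 0 \<and> ts m \<le> 1 \<and> (\<forall>i<m. ts i < ts (Suc i))"
  then have "0 \<le> \<eta> (ts 0)" "\<eta> (ts m) \<le> 1" "\<And>i. i < m \<Longrightarrow> \<eta> (ts i) < \<eta> (ts (Suc i))"
    using \<eta>_partition[of ts m] by auto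
  from wienerD(6)[OF W this] 
  show "prob_space.indep_vars N (\<lambda>_. borel) (\<lambda>i \<nu>. W (\<eta> (ts (Suc i))) \<nu> - W (\<eta> (ts i)) \<nu>) {..<m}" .
qed

end

section \<open>The limit process with a shift component\<close>

text \<open>If \<open>\<zeta>\<close> is not strictly inside the interval, the midpoint serves as a
  dummy. Every interval is then cut into exactly two pieces, and the indices of the refined
  partition stay \<open>2 * i\<close> and \<open>2 * i + 1\<close>.\<close>

definition split_point :: "real \<Rightarrow> real \<Rightarrow> real \<Rightarrow> real" where
  "split_point \<zeta> a b = (if a < \<zeta> \<and> \<zeta> < b then \<zeta> else (a + b) / 2)"

definition refine :: "real \<Rightarrow> (nat \<Rightarrow> real) \<Rightarrow> nat \<Rightarrow> real" where
  "refine \<zeta> ts j = (if even j then ts (j div 2) else split_point \<zeta> (ts (j div 2)) (ts (Suc (j div 2))))"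

text \<open>The factor of an increment of the driving path in \<open>shift_path\<close>, on a piece
  with right end \<open>b\<close> that does not have \<open>\<zeta>\<close> in its interior.\<close>

definition shift_coeff :: "real \<Rightarrow> real \<Rightarrow> real" where
  "shift_coeff \<zeta> b = (if b \<le> \<zeta> then 1 - \<zeta> else - \<zeta>)"

lemma refine_simps:
  "refine \<zeta> ts (2 * i) = ts i" "refine \<zeta> ts (Suc (2 * i)) = split_point \<zeta> (ts i) (ts (Suc i))"
  "refine \<zeta> ts (Suc (Suc (2 * i))) = ts (Suc i)"
proof -
  show "refine \<zeta> ts (2 * i) = ts i" "refine \<zeta> ts (Suc (2 * i)) = split_point \<zeta> (ts i) (ts (Suc i))"
    by (simp_all add: refine_def)
  have "Suc (Suc (2 * i)) = 2 * Suc i" by simp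
  then show "refine \<zeta> ts (Suc (Suc (2 * i))) = ts (Suc i)" unfolding refine_def by simp
qed

lemma split_point_between: "a < b \<Longrightarrow> a < split_point \<zeta> a b \<and> split_point \<zeta> a b < b"
  by (auto simp: split_point_def field_simps)

lemma refine_partition:
  assumes "0 \<le> ts 0" "ts m \<le> 1" "\<And>i. i < m \<Longrightarrow> ts i < ts (Suc i)"
  shows "0 \<le> refine \<zeta> ts 0" "refine \<zeta> ts (2 * m) \<le> 1" "\<And>j. j < 2 * m \<Longrightarrow> refine \<zeta> ts j < refine \<zeta> ts (Suc j)"
proof -
  show "0 \<le> refine \<zeta> ts 0" using refine_simps(1)[of \<zeta> ts 0] assms(1) by simp
  show "refine \<zeta> ts (2 * m) \<le> 1" unfolding refine_simps(1) using assms(2) .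
  fix j assume j: "j < 2 * m"
  define i where "i = j div 2"
  have i: "i < m" "j = 2 * i \<or> j = Suc (2 * i)" using j unfolding i_def by presburger+
  have "ts i < ts (Suc i)" using assms(3) i(1) .
  from split_point_between[OF this, of \<zeta>] i(2) show "refine \<zeta> ts j < refine \<zeta> ts (Suc j)"
    by (auto simp: refine_simps)
qed

text \<open>The two branches agree at \<open>t = \<zeta>\<close>, so continuity of \<open>b\<close>
  is inherited.\<close>

definition shift_path :: "real \<Rightarrow> (real \<Rightarrow> real) \<Rightarrow> real \<Rightarrow> real" where
  "shift_path \<zeta> b t = (if t \<le> \<zeta> then (1 - \<zeta>) * b t else b \<zeta> - \<zeta> * b t)"

text \<open>Between neighbouring points of the refined partition \<open>shift_path\<close> has a constant coefficient.\<close>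

lemma shift_increment:
  fixes a b \<zeta> :: real
  assumes "a < b"
  defines "p \<equiv> split_point \<zeta> a b"
  shows "shift_path \<zeta> f b - shift_path \<zeta> f a = shift_coeff \<zeta> p * (f p - f a) + shift_coeff \<zeta> b * (f b - f p)"
    and "shift_var \<zeta> b - shift_var \<zeta> a = (shift_coeff \<zeta> p)\<^sup>2 * (p - a) + (shift_coeff \<zeta> b)\<^sup>2 * (b - p)"
proof -
  have p: "a < p" "p < b" using split_point_between[OF assms(1)] by (auto simp: p_def)
  consider "b \<le> \<zeta>" | "\<zeta> \<le> a" | "a < \<zeta>" "\<zeta> < b" by linarith
  then have "shift_path \<zeta> f b - shift_path \<zeta> f a = shift_coeff \<zeta> p * (f p - f a) + shift_coeff \<zeta> b * (f b - f p) \<and>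
    shift_var \<zeta> b - shift_var \<zeta> a = (shift_coeff \<zeta> p)\<^sup>2 * (p - a) + (shift_coeff \<zeta> b)\<^sup>2 * (b - p)"
  proof cases
    case 1
    then show ?thesis using p by (simp add: shift_path_def shift_coeff_def shift_var_def algebra_simps)
  next
    case 2
    \<comment> \<open>For \<open>a = \<zeta>\<close> the definition takes the first branch, which
      has the same value there.\<close>
    have pa: "shift_path \<zeta> f a = f \<zeta> - \<zeta> * f a" using 2 by (cases "a = \<zeta>") (auto simp: shift_path_def algebra_simps)
    have va: "shift_var \<zeta> a = (1 - \<zeta>)\<^sup>2 * \<zeta> + \<zeta>\<^sup>2 * (a - \<zeta>)" using 2 by (simp add: shift_var_def)
    show ?thesis unfolding pa va using 2 p by (simp add: shift_path_def shift_coeff_def shift_var_def algebra_simps)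
  next
    case 3
    then have "p = \<zeta>" by (simp add: p_def split_point_def)
    then show ?thesis using 3 by (simp add: shift_path_def shift_coeff_def shift_var_def algebra_simps)
  qed
  then show "shift_path \<zeta> f b - shift_path \<zeta> f a = shift_coeff \<zeta> p * (f p - f a) + shift_coeff \<zeta> b * (f b - f p)"
    and "shift_var \<zeta> b - shift_var \<zeta> a = (shift_coeff \<zeta> p)\<^sup>2 * (p - a) + (shift_coeff \<zeta> b)\<^sup>2 * (b - p)" by simp_all
qed

context variance_profile
begin

text \<open>Over one interval the increment of \<open>G\<close> is a sum of three independent normal
  variables: one increment of the time-changed \<open>W\<close> and two of \<open>B\<close>, cut at
  the split point. Different intervals use disjoint blocks of a jointly independent family, and the
  three variances add up to the increment of \<open>K\<close>.\<close>

lemma shifted_increments: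
  assumes W: "wiener N W" and B: "wiener N B"
    and WB: "prob_space.indep_var N (Pi\<^sub>M {0..1} (\<lambda>_. borel)) (wpath W) (Pi\<^sub>M {0..1} (\<lambda>_. borel)) (wpath B)"
    and \<zeta>: "0 < \<zeta>" "\<zeta> < 1" and \<alpha>: "\<alpha> \<noteq> 0"
    and ts: "0 \<le> ts 0" "ts m \<le> 1" "\<And>i. i < m \<Longrightarrow> ts i < ts (Suc i)"
  defines "G \<equiv> \<lambda>\<nu> t. W (\<eta> t) \<nu> - \<alpha> * shift_path \<zeta> (\<lambda>t. B t \<nu>) t"
    and "K \<equiv> \<lambda>t. \<eta> t + \<alpha>\<^sup>2 * shift_var \<zeta> t"
  shows "prob_space.indep_vars N (\<lambda>_. borel) (\<lambda>i \<nu>. G \<nu> (ts (Suc i)) - G \<nu> (ts i)) {..<m}"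
    and "\<And>i. i < m \<Longrightarrow> distributed N lborel (\<lambda>\<nu>. G \<nu> (ts (Suc i)) - G \<nu> (ts i))
        (normal_density 0 (sqrt (K (ts (Suc i)) - K (ts i))))"
proof -
  interpret prob_space N by (rule wienerD(1)[OF W])
  let ?r = "refine \<zeta> ts"
  have r: "0 \<le> ?r 0" "?r (2 * m) \<le> 1" "\<And>j. j < 2 * m \<Longrightarrow> ?r j < ?r (Suc j)"
    using refine_partition[OF ts, where \<zeta> = \<zeta>] by simp_all
  have u: "0 \<le> \<eta> (ts 0)" "\<eta> (ts m) \<le> 1" "\<And>i. i < m \<Longrightarrow> \<eta> (ts i) < \<eta> (ts (Suc i))"
    using \<eta>_partition[OF ts] by simp_all
  have ts01: "0 \<le> ts i" "ts i \<le> 1" if "i \<le> m" for i using increasing_sequence_bounds[OF ts that] by simp_all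
  have r01: "0 \<le> ?r j" "?r j \<le> 1" if "j \<le> 2 * m" for j using increasing_sequence_bounds[OF r that] by simp_all
  define dW where "dW i \<nu> = W (\<eta> (ts (Suc i))) \<nu> - W (\<eta> (ts i)) \<nu>" for i \<nu>
  define dB where "dB j \<nu> = B (?r (Suc j)) \<nu> - B (?r j) \<nu>" for j \<nu>
  define \<kappa> where "\<kappa> j = - \<alpha> * shift_coeff \<zeta> (?r (Suc j))" for j
  \<comment> \<open>The sum rule for independent normal variables asks for positive standard
    deviations; for the parts from \<open>B\<close> this rests on \<open>\<alpha> \<noteq> 0\<close>
    and \<open>0 < \<zeta> < 1\<close>.\<close>
  have \<kappa>: "\<kappa> j \<noteq> 0" for j using \<zeta> \<alpha> by (simp add: \<kappa>_def shift_coeff_def)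
  define X where "X = case_sum dW (\<lambda>j \<nu>. \<kappa> j * dB j \<nu>)"
  have Xi: "indep_vars (\<lambda>_. borel) X (Inl ` {..<m} \<union> Inr ` {..<2 * m})"
  proof (cases "m = 0")
    case True
    then show ?thesis by (simp add: indep_vars_def indep_sets_def)
  next
    case False
    have iW: "indep_vars (\<lambda>_. borel) dW {..<m}"
      unfolding dW_def using wienerD(6)[OF W u] .
    have iB: "indep_vars (\<lambda>_. borel) dB {..<2 * m}"
      unfolding dB_def using wienerD(6)[OF B r] .
    \<comment> \<open>Finitely many increments are a measurable function of the path in the product
      space, so the independence of \<open>wpath W\<close> and \<open>wpath B\<close> passes to the
      vectors of increments.\<close>
    have "indep_var (Pi\<^sub>M {..<m} (\<lambda>_. borel)) ((\<lambda>w. \<lambda>i\<in>{..<m}. w (\<eta> (ts (Suc i))) - w (\<eta> (ts i))) \<circ> wpath W)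
       (Pi\<^sub>M {..<2 * m} (\<lambda>_. borel)) ((\<lambda>w. \<lambda>j\<in>{..<2 * m}. w (?r (Suc j)) - w (?r j)) \<circ> wpath B)"
    proof (rule indep_var_compose[OF WB])
      show "(\<lambda>w. \<lambda>i\<in>{..<m}. w (\<eta> (ts (Suc i))) - w (\<eta> (ts i))) \<in> measurable (Pi\<^sub>M {0..1} (\<lambda>_. borel)) (Pi\<^sub>M {..<m} (\<lambda>_. borel :: real measure))"
        using \<eta>_range ts01
        by (intro measurable_restrict borel_measurable_diff measurable_component_singleton) auto
      show "(\<lambda>w. \<lambda>j\<in>{..<2 * m}. w (?r (Suc j)) - w (?r j)) \<in> measurable (Pi\<^sub>M {0..1} (\<lambda>_. borel)) (Pi\<^sub>M {..<2 * m} (\<lambda>_. borel :: real measure))"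
        using r01
        by (intro measurable_restrict borel_measurable_diff measurable_component_singleton) auto
    qed
    moreover have "(\<lambda>w. \<lambda>i\<in>{..<m}. w (\<eta> (ts (Suc i))) - w (\<eta> (ts i))) \<circ> wpath W = (\<lambda>\<nu>. \<lambda>i\<in>{..<m}. dW i \<nu>)"
      using \<eta>_range ts01 by (auto simp: fun_eq_iff wpath_def dW_def)
    moreover have "(\<lambda>w. \<lambda>j\<in>{..<2 * m}. w (?r (Suc j)) - w (?r j)) \<circ> wpath B = (\<lambda>\<nu>. \<lambda>j\<in>{..<2 * m}. dB j \<nu>)"
      using r01 by (auto simp: fun_eq_iff wpath_def dB_def)
    ultimately have "indep_vars (\<lambda>_. borel) (case_sum dW dB) (Inl ` {..<m} \<union> Inr ` {..<2 * m})"
      using False by (intro indep_vars_case_sum[OF iW iB]) (auto simp: lessThan_empty_iff)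
    then have "indep_vars (\<lambda>_. borel) (\<lambda>l \<nu>. case_sum (\<lambda>_ x. x) (\<lambda>j x. \<kappa> j * x) l (case_sum dW dB l \<nu>)) (Inl ` {..<m} \<union> Inr ` {..<2 * m})"
      by (rule indep_vars_compose2) (auto split: sum.split)
    moreover have "(\<lambda>l \<nu>. case_sum (\<lambda>_ x. x) (\<lambda>j x. \<kappa> j * x) l (case_sum dW dB l \<nu>)) = X"
      by (auto simp: fun_eq_iff X_def split: sum.split)
    ultimately show ?thesis by simp
  qed
  define blk :: "nat \<Rightarrow> (nat + nat) set" where "blk i = {Inl i, Inr (2 * i), Inr (Suc (2 * i))}" for i
  have blk: "blk i \<subseteq> Inl ` {..<m} \<union> Inr ` {..<2 * m}" if "i < m" for i using that by (auto simp: blk_def)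
  have sum_blk: "(\<Sum>l\<in>blk i. f l) = f (Inl i) + f (Inr (2 * i)) + f (Inr (Suc (2 * i)))" for i and f :: "nat + nat \<Rightarrow> real"
    by (simp add: blk_def)
  have inc: "G \<nu> (ts (Suc i)) - G \<nu> (ts i) = (\<Sum>l\<in>blk i. X l \<nu>)" if "i < m" for i \<nu>
  proof -
    have "G \<nu> (ts (Suc i)) - G \<nu> (ts i)
      = dW i \<nu> - \<alpha> * (shift_path \<zeta> (\<lambda>t. B t \<nu>) (ts (Suc i)) - shift_path \<zeta> (\<lambda>t. B t \<nu>) (ts i))"
      by (simp add: G_def dW_def algebra_simps)
    also have "\<dots> = (\<Sum>l\<in>blk i. X l \<nu>)"
      unfolding shift_increment(1)[OF ts(3)[OF that]] sum_blk X_def sum.case \<kappa>_def dB_def refine_simps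
      by (simp add: algebra_simps)
    finally show ?thesis .
  qed
  have "indep_vars (\<lambda>_. borel) (\<lambda>i \<nu>. \<Sum>l\<in>blk i. X l \<nu>) {..<m}"
  proof (rule indep_vars_block_sums[OF Xi])
    show "disjoint_family_on blk {..<m}"
      unfolding disjoint_family_on_def blk_def by (auto; presburger)
  qed (use blk in simp)
  then show "indep_vars (\<lambda>_. borel) (\<lambda>i \<nu>. G \<nu> (ts (Suc i)) - G \<nu> (ts i)) {..<m}"
    by (subst indep_vars_cong[OF refl _ refl]) (use inc in auto)
  fix i assume i: "i < m"
  define sd :: "nat + nat \<Rightarrow> real" where
    "sd l = case_sum (\<lambda>i. sqrt (\<eta> (ts (Suc i)) - \<eta> (ts i))) (\<lambda>j. \<bar>\<kappa> j\<bar> * sqrt (?r (Suc j) - ?r j)) l" for l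
  have ij: "2 * i < 2 * m" "Suc (2 * i) < 2 * m" using i by auto
  have dist: "distributed N lborel (X l) (normal_density 0 (sd l))" and sd_pos: "0 < sd l" if l: "l \<in> blk i" for l
  proof -
    have 1: "distributed N lborel (X (Inl i)) (normal_density 0 (sd (Inl i))) \<and> 0 < sd (Inl i)"
      using wienerD(5)[OF W, of "\<eta> (ts i)" "\<eta> (ts (Suc i))"] u(3)[OF i] \<eta>_range ts01[of i] ts01[of "Suc i"] i
      by (simp add: X_def sd_def dW_def[abs_def])
    have 2: "distributed N lborel (X (Inr j)) (normal_density 0 (sd (Inr j))) \<and> 0 < sd (Inr j)" if j: "j < 2 * m" for j
    proof -
      have lt: "?r j < ?r (Suc j)" by (rule r(3)[OF j])
      have "distributed N lborel (dB j) (normal_density 0 (sqrt (?r (Suc j) - ?r j)))"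
        using wienerD(5)[OF B, of "?r j" "?r (Suc j)"] lt r01[of j] r01[of "Suc j"] j by (simp add: dB_def[abs_def])
      from normal_density_affine[OF this, of "\<kappa> j" 0] lt \<kappa>[of j]
      show ?thesis by (simp add: X_def sd_def)
    qed
    from l 1 2[OF ij(1)] 2[OF ij(2)] show "distributed N lborel (X l) (normal_density 0 (sd l))" "0 < sd l"
      by (auto simp: blk_def)
  qed
  have "distributed N lborel (\<lambda>\<nu>. \<Sum>l\<in>blk i. X l \<nu>) (normal_density (\<Sum>l\<in>blk i. 0) (sqrt (\<Sum>l\<in>blk i. (sd l)\<^sup>2)))"
    by (rule sum_indep_normal[OF _ _ indep_vars_subset[OF Xi blk[OF i]] sd_pos dist]) (auto simp: blk_def)
  moreover have "(\<Sum>l\<in>blk i. (sd l)\<^sup>2) = K (ts (Suc i)) - K (ts i)"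
  proof -
    have "K (ts (Suc i)) - K (ts i) = (\<eta> (ts (Suc i)) - \<eta> (ts i)) + \<alpha>\<^sup>2 * (shift_var \<zeta> (ts (Suc i)) - shift_var \<zeta> (ts i))"
      by (simp add: K_def algebra_simps)
    also have "\<dots> = (\<Sum>l\<in>blk i. (sd l)\<^sup>2)"
      unfolding shift_increment(2)[OF ts(3)[OF i]] sum_blk
      using u(3)[OF i] r(3)[OF ij(1)] r(3)[OF ij(2)]
      by (simp add: sd_def \<kappa>_def power_mult_distrib refine_simps distrib_left)
    finally show ?thesis ..
  qed
  ultimately show "distributed N lborel (\<lambda>\<nu>. G \<nu> (ts (Suc i)) - G \<nu> (ts i))
        (normal_density 0 (sqrt (K (ts (Suc i)) - K (ts i))))"
    using inc[OF i] by simp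
qed

end

section \<open>From the assumptions to the conditional limit laws\<close>

lemma assumption_E_slln:
  assumes E: "assumption_E M \<epsilon>"
  shows "AE \<omega> in M. (\<lambda>n. (\<Sum>i=1..n. \<epsilon> i \<omega>) / real n) \<longlonglongrightarrow> 0 \<and> (\<lambda>n. (\<Sum>i=1..n. (\<epsilon> i \<omega>)\<^sup>2) / real n) \<longlonglongrightarrow> 1"
proof -
  interpret prob_space M using E by (simp add: assumption_E_def)
  have m: "\<epsilon> k \<in> borel_measurable M" for k using E by (simp add: assumption_E_def)
  have stat: "strictly_stationary M \<epsilon>" using E by (simp add: assumption_E_def)
  have sm: "summable (alpha_mix M \<epsilon>)" using E by (intro summable_alpha_mix) (simp add: assumption_E_def)
  have e: "integrable M (\<epsilon> 1)" "expectation (\<epsilon> 1) = 0" "variance (\<epsilon> 1) = 1"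
    using E by (auto simp: assumption_E_def)
  then have sq: "expectation (\<lambda>\<omega>. (\<epsilon> 1 \<omega>)\<^sup>2) = 1" by simp
  \<comment> \<open>A non-integrable function has integral \<open>0\<close> by convention, so the
    value \<open>1\<close> forces integrability.\<close>
  then have "integrable M (\<lambda>\<omega>. (\<epsilon> 1 \<omega>)\<^sup>2)"
    using not_integrable_integral_eq[of M "\<lambda>\<omega>. (\<epsilon> 1 \<omega>)\<^sup>2"] by fastforce
  from slln[OF m stat sm _ this] slln[OF m stat sm, of "\<lambda>x. x"] e(1) show ?thesis
    unfolding sq e(2) by (intro AE_conjI) simp_all
qed

lemma assumption_V_piecewise_lipschitz:
  assumes "assumption_V \<sigma>"
  obtains D L where "piecewise_lipschitz \<sigma> D L" "\<And>t. 0 \<le> t \<Longrightarrow> t \<le> 1 \<Longrightarrow> 0 < \<sigma> t"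
  using assms unfolding assumption_V_def piecewise_lipschitz_def by auto

context variance_profile
begin

text \<open>The data are fixed at an \<open>\<omega>\<close> where both averages converge. With
  \<open>vs2\<close> as the scale factor, \<open>\<eta> + \<Lambda> / vs2\<close> is the profile of
  the squared residuals; \<open>\<Lambda>\<close> is \<open>0\<close> for a vanishing shift and
  \<open>d\<^sup>2 * shift_var \<zeta>\<close> for a fixed one.\<close>

lemma weak_conv_Vstar:
  assumes N: "prob_space N" and cp: "continuous_process N G"
    and G: "gaussian_increments N (\<lambda>t. \<eta> t + \<Lambda> t / vs2) G"
    and \<Lambda>: "\<Lambda> 0 = 0" "continuous_on {0..1} \<Lambda>" "mono_on {0..1} \<Lambda>"
    and e1: "(\<lambda>n. (\<Sum>i=1..n. \<epsilon> i \<omega>) / real n) \<longlonglongrightarrow> 0"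
    and e2: "(\<lambda>n. (\<Sum>i=1..n. (\<epsilon> i \<omega>)\<^sup>2) / real n) \<longlonglongrightarrow> 1"
    and \<tau>: "\<forall>\<^sub>F n in sequentially. \<tau> n \<le> n" and \<delta>: "\<And>n. \<bar>\<delta> n\<bar> \<le> \<Delta>"
    and gc: "grid_conv (\<lambda>n k. (\<delta> n)\<^sup>2 * shift_var (real (\<tau> n) / real n) (real k / real n)) \<Lambda>"
  shows "weak_conv_m (\<lambda>n. distr (boot_law n) borel (\<lambda>x. Qstat n (Vstar \<mu> \<delta> \<tau> \<sigma> \<epsilon> n \<omega> x)))
           (distr N borel (\<lambda>\<nu>. Sfun (G \<nu>)))
       \<and> weak_conv_m (\<lambda>n. distr (boot_law n) borel (\<lambda>x. Rstat n (Vstar \<mu> \<delta> \<tau> \<sigma> \<epsilon> n \<omega> x)))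
           (distr N borel (\<lambda>\<nu>. Tfun (G \<nu>)))"
proof -
  define K where "K t = \<eta> t + \<Lambda> t / vs2" for t
  define c where "c n i = Yobs \<mu> \<delta> \<tau> \<sigma> \<epsilon> n i \<omega> - (\<Sum>j=1..n. Yobs \<mu> \<delta> \<tau> \<sigma> \<epsilon> n j \<omega>) / real n" for n i
  have K0: "K 0 = 0" using \<eta>_0 \<Lambda>(1) by (simp add: K_def)
  have Kc: "continuous_on {0..1} K"
    unfolding K_def using vs2_pos by (intro continuous_intros \<eta>_continuous \<Lambda>(2)) auto
  have Km: "strict_mono_on {0..1} K"
  proof (rule strict_mono_onI)
    fix s t :: real assume st: "s \<in> {0..1}" "t \<in> {0..1}" "s < t"
    have "\<eta> s < \<eta> t" using strict_mono_onD[OF \<eta>_strict_mono] st by blast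
    moreover have "\<Lambda> s \<le> \<Lambda> t" using mono_onD[OF \<Lambda>(3)] st by auto
    ultimately show "K s < K t"
      unfolding K_def using vs2_pos by (intro add_less_le_mono divide_right_mono) auto
  qed
  have "integral {0..t} (\<lambda>s. (\<sigma> s)\<^sup>2) + \<Lambda> t = vs2 * K t" for t
    using vs2_pos by (simp add: K_def \<eta>_def field_simps)
  with grid_conv_resid_sq[where \<epsilon> = \<epsilon> and \<omega> = \<omega> and \<tau> = \<tau> and \<delta> = \<delta> and \<mu> = \<mu>, OF pl e1 e2 \<tau> \<delta> gc]
  have "grid_conv (\<lambda>n k. (\<Sum>i=1..k. (c n i)\<^sup>2) / real n) (\<lambda>t. vs2 * K t)"
    by (simp add: resid_sq_def c_def)
  from weak_conv_weighted_gaussian_sums[OF N cp G[folded K_def] Km Kc K0 vs2_pos this]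
  show ?thesis by (simp add: Vstar_def[abs_def] c_def)
qed

lemma continuous_process_shifted:
  assumes W: "wiener N W" and B: "wiener N B" and \<zeta>: "0 < \<zeta>" "\<zeta> < 1"
  shows "continuous_process N (\<lambda>\<nu> t. W (\<eta> t) \<nu> - \<alpha> * shift_path \<zeta> (\<lambda>t. B t \<nu>) t)"
  unfolding continuous_process_def
proof (intro conjI ballI)
  show "(\<lambda>\<nu>. W (\<eta> t) \<nu> - \<alpha> * shift_path \<zeta> (\<lambda>t. B t \<nu>) t) \<in> borel_measurable N" for t
    unfolding shift_path_def using wienerD(2)[OF W] wienerD(2)[OF B] by (cases "t \<le> \<zeta>") auto
  fix \<nu> assume \<nu>: "\<nu> \<in> space N"
  have Bc: "continuous_on {0..1} (\<lambda>t. B t \<nu>)" by (rule wienerD(4)[OF B \<nu>])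
  have "continuous_on ({0..\<zeta>} \<union> {\<zeta>..1}) (shift_path \<zeta> (\<lambda>t. B t \<nu>))"
    unfolding shift_path_def
    by (rule continuous_on_If)
       (use \<zeta> in \<open>auto intro!: continuous_intros continuous_on_subset[OF Bc] simp: algebra_simps\<close>)
  moreover have "{0..\<zeta>} \<union> {\<zeta>..1} = {0..1}" using \<zeta> by auto
  ultimately have "continuous_on {0..1} (shift_path \<zeta> (\<lambda>t. B t \<nu>))" by simp
  then show "continuous_on {0..1} (\<lambda>t. W (\<eta> t) \<nu> - \<alpha> * shift_path \<zeta> (\<lambda>t. B t \<nu>) t)"
    using continuous_processD(2)[OF continuous_process_time_change[OF W] \<nu>] by (intro continuous_intros)
  show "W (\<eta> 0) \<nu> - \<alpha> * shift_path \<zeta> (\<lambda>t. B t \<nu>) 0 = 0"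
    using wienerD(3)[OF W \<nu>] wienerD(3)[OF B \<nu>] \<eta>_0 \<zeta> by (simp add: shift_path_def)
qed

lemma gaussian_increments_shifted:
  assumes W: "wiener N W" and B: "wiener N B"
    and WB: "prob_space.indep_var N (Pi\<^sub>M {0..1} (\<lambda>_. borel)) (wpath W) (Pi\<^sub>M {0..1} (\<lambda>_. borel)) (wpath B)"
    and \<zeta>: "0 < \<zeta>" "\<zeta> < 1" and \<alpha>: "\<alpha> \<noteq> 0"
  shows "gaussian_increments N (\<lambda>t. \<eta> t + \<alpha>\<^sup>2 * shift_var \<zeta> t) (\<lambda>\<nu> t. W (\<eta> t) \<nu> - \<alpha> * shift_path \<zeta> (\<lambda>t. B t \<nu>) t)"
  unfolding gaussian_increments_def
proof (intro conjI allI impI)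
  fix s t :: real assume st: "0 \<le> s \<and> s < t \<and> t \<le> 1"
  \<comment> \<open>A single interval is a partition with \<open>m = 1\<close>.\<close>
  define ts where "ts i = (if i = 0 then s else t)" for i :: nat
  have ts: "0 \<le> ts 0" "ts 1 \<le> 1" "\<And>i. i < 1 \<Longrightarrow> ts i < ts (Suc i)" using st by (auto simp: ts_def)
  from shifted_increments(2)[OF assms ts, of 0]
  show "distributed N lborel (\<lambda>\<nu>. W (\<eta> t) \<nu> - \<alpha> * shift_path \<zeta> (\<lambda>t. B t \<nu>) t - (W (\<eta> s) \<nu> - \<alpha> * shift_path \<zeta> (\<lambda>t. B t \<nu>) s))
      (normal_density 0 (sqrt (\<eta> t + \<alpha>\<^sup>2 * shift_var \<zeta> t - (\<eta> s + \<alpha>\<^sup>2 * shift_var \<zeta> s))))"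
    by (simp add: ts_def)
next
  fix ts :: "nat \<Rightarrow> real" and m assume ts: "0 \<le> ts 0 \<and> ts m \<le> 1 \<and> (\<forall>i<m. ts i < ts (Suc i))"
  show "prob_space.indep_vars N (\<lambda>_. borel) (\<lambda>i \<nu>. W (\<eta> (ts (Suc i))) \<nu> - \<alpha> * shift_path \<zeta> (\<lambda>t. B t \<nu>) (ts (Suc i)) -
       (W (\<eta> (ts i)) \<nu> - \<alpha> * shift_path \<zeta> (\<lambda>t. B t \<nu>) (ts i))) {..<m}"
    by (rule shifted_increments(1)[OF assms]) (use ts in auto)
qed

end

lemma shift_var_profile:
  assumes \<zeta>: "0 < \<zeta>" "\<zeta> < 1"
  shows "continuous_on {0..1} (shift_var \<zeta>)" "mono_on {0..1} (shift_var \<zeta>)"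
proof -
  show "continuous_on {0..1} (shift_var \<zeta>)" unfolding shift_var_def[abs_def] by (intro continuous_intros)
  show "mono_on {0..1} (shift_var \<zeta>)"
    by (rule mono_onI) (auto simp: shift_var_def intro!: add_mono mult_left_mono)
qed

text \<open>Under the null hypothesis \<open>\<delta>\<close> is arbitrary, possibly unbounded,
  while the limit theorem works with a bounded sequence. As it enters no observation up to
  \<open>n\<close>, it can be set to \<open>0\<close>.\<close>

lemma Vstar_no_shift:
  assumes "\<tau> n = n" "k \<le> n"
  shows "Vstar \<mu> \<delta> \<tau> \<sigma> \<epsilon> n \<omega> x k = Vstar \<mu> (\<lambda>_. 0) \<tau> \<sigma> \<epsilon> n \<omega> x k"
proof -
  have "Yobs \<mu> \<delta> \<tau> \<sigma> \<epsilon> n i \<omega> = Yobs \<mu> (\<lambda>_. 0) \<tau> \<sigma> \<epsilon> n i \<omega>" if "i \<le> n" for i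
    using assms that by (simp add: Yobs_def)
  then show ?thesis unfolding Vstar_def using assms(2) by (intro sum.cong) auto
qed

theorem theorem3:
  fixes M :: "'a measure" and \<epsilon> :: "nat \<Rightarrow> 'a \<Rightarrow> real"
    and \<mu> :: real and \<delta> :: "nat \<Rightarrow> real" and \<tau> :: "nat \<Rightarrow> nat"
    and \<sigma> :: "real \<Rightarrow> real"
  defines "vs2 \<equiv> integral {0..1} (\<lambda>t. (\<sigma> t)\<^sup>2)"
  defines "\<eta> \<equiv> (\<lambda>t. integral {0..t} (\<lambda>s. (\<sigma> s)\<^sup>2) / vs2)"
  assumes E: "assumption_E M \<epsilon>"
    and V: "assumption_V \<sigma>"
  shows
   "(((\<forall>n\<ge>1. \<tau> n = n) \<or>
      ((\<forall>n\<ge>2. 1 \<le> \<tau> n \<and> \<tau> n < n \<and> \<delta> n \<noteq> 0) \<and> \<delta> \<longlonglongrightarrow> 0)) \<longrightarrow>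
     (\<forall>(N :: 'b measure) W. wiener N W \<longrightarrow>
        (AE \<omega> in M.
           weak_conv_m (\<lambda>n. distr (boot_law n) borel
                         (\<lambda>x. Qstat n (Vstar \<mu> \<delta> \<tau> \<sigma> \<epsilon> n \<omega> x)))
                       (distr N borel (\<lambda>\<nu>. Sfun (\<lambda>t. W (\<eta> t) \<nu>)))
         \<and> weak_conv_m (\<lambda>n. distr (boot_law n) borel
                         (\<lambda>x. Rstat n (Vstar \<mu> \<delta> \<tau> \<sigma> \<epsilon> n \<omega> x)))
                       (distr N borel (\<lambda>\<nu>. Tfun (\<lambda>t. W (\<eta> t) \<nu>))))))
    \<and>
    (\<forall>\<zeta> d. 0 < \<zeta> \<and> \<zeta> < 1 \<and> d \<noteq> 0 \<and> (\<forall>n. \<tau> n = nat \<lfloor>real n * \<zeta>\<rfloor>) \<and> (\<forall>n. \<delta> n = d) \<longrightarrow>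
     (\<forall>(N :: 'c measure) W B. wiener N W \<and> wiener N B \<and>
        prob_space.indep_var N (Pi\<^sub>M {0..1} (\<lambda>_. borel)) (wpath W)
                               (Pi\<^sub>M {0..1} (\<lambda>_. borel)) (wpath B) \<longrightarrow>
        (let G = (\<lambda>\<nu> t. W (\<eta> t) \<nu> - d / sqrt vs2 *
                    (if t \<le> \<zeta> then (1 - \<zeta>) * B t \<nu> else B \<zeta> \<nu> - \<zeta> * B t \<nu>))
         in AE \<omega> in M.
           weak_conv_m (\<lambda>n. distr (boot_law n) borel
                         (\<lambda>x. Qstat n (Vstar \<mu> \<delta> \<tau> \<sigma> \<epsilon> n \<omega> x)))
                       (distr N borel (\<lambda>\<nu>. Sfun (G \<nu>)))
         \<and> weak_conv_m (\<lambda>n. distr (boot_law n) borel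
                         (\<lambda>x. Rstat n (Vstar \<mu> \<delta> \<tau> \<sigma> \<epsilon> n \<omega> x)))
                       (distr N borel (\<lambda>\<nu>. Tfun (G \<nu>))))))"
proof -
  obtain D L where pl: "piecewise_lipschitz \<sigma> D L" and pos: "\<And>t. 0 \<le> t \<Longrightarrow> t \<le> 1 \<Longrightarrow> 0 < \<sigma> t"
    using assumption_V_piecewise_lipschitz[OF V] by blast
  interpret variance_profile \<sigma> D L vs2 \<eta>
    by unfold_locales (use pl pos in \<open>auto simp: vs2_def \<eta>_def\<close>)
  note slln = assumption_E_slln[OF E]
  \<comment> \<open>Null hypothesis and local alternatives are one case: a shift sequence that tends
    to \<open>0\<close>, the constant \<open>0\<close> included.\<close>
  have vanishing: "weak_conv_m (\<lambda>n. distr (boot_law n) borel (\<lambda>x. Qstat n (Vstar \<mu> \<delta>' \<tau> \<sigma> \<epsilon> n \<omega> x)))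
           (distr N borel (\<lambda>\<nu>. Sfun (\<lambda>t. W (\<eta> t) \<nu>)))
       \<and> weak_conv_m (\<lambda>n. distr (boot_law n) borel (\<lambda>x. Rstat n (Vstar \<mu> \<delta>' \<tau> \<sigma> \<epsilon> n \<omega> x)))
           (distr N borel (\<lambda>\<nu>. Tfun (\<lambda>t. W (\<eta> t) \<nu>)))"
    if W: "wiener N W" and \<delta>': "\<delta>' \<longlonglongrightarrow> 0" and \<tau>: "\<forall>\<^sub>F n in sequentially. \<tau> n \<le> n"
      and e: "(\<lambda>n. (\<Sum>i=1..n. \<epsilon> i \<omega>) / real n) \<longlonglongrightarrow> 0 \<and> (\<lambda>n. (\<Sum>i=1..n. (\<epsilon> i \<omega>)\<^sup>2) / real n) \<longlonglongrightarrow> 1"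
    for N :: "'b measure" and W \<delta>' \<omega>
  proof -
    obtain \<Delta> where \<Delta>: "\<And>n. \<bar>\<delta>' n\<bar> \<le> \<Delta>"
      using convergent_imp_Bseq[OF convergentI[OF \<delta>']] unfolding Bseq_def by auto
    have G: "gaussian_increments N (\<lambda>t. \<eta> t + (\<lambda>_. 0) t / vs2) (\<lambda>\<nu> t. W (\<eta> t) \<nu>)"
      using gaussian_increments_time_change[OF W] by simp
    show ?thesis
      by (rule weak_conv_Vstar[where \<epsilon> = \<epsilon> and \<omega> = \<omega> and \<tau> = \<tau> and \<delta> = \<delta>' and \<Lambda> = "\<lambda>_. 0"
            and G = "\<lambda>\<nu> t. W (\<eta> t) \<nu>", OF wienerD(1)[OF W] continuous_process_time_change[OF W] G _ _ _ e[THEN conjunct1]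
            e[THEN conjunct2] \<tau> \<Delta> grid_conv_vanishing_shift[OF \<delta>' \<tau>]]) (auto simp: mono_on_def)
  qed
  show ?thesis
  proof (intro conjI impI allI)
    fix N :: "'b measure" and W
    assume H: "(\<forall>n\<ge>1. \<tau> n = n) \<or> ((\<forall>n\<ge>2. 1 \<le> \<tau> n \<and> \<tau> n < n \<and> \<delta> n \<noteq> 0) \<and> \<delta> \<longlonglongrightarrow> 0)"
      and W: "wiener N W"
    show "AE \<omega> in M.
           weak_conv_m (\<lambda>n. distr (boot_law n) borel
                         (\<lambda>x. Qstat n (Vstar \<mu> \<delta> \<tau> \<sigma> \<epsilon> n \<omega> x)))
                       (distr N borel (\<lambda>\<nu>. Sfun (\<lambda>t. W (\<eta> t) \<nu>)))
         \<and> weak_conv_m (\<lambda>n. distr (boot_law n) borel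
                         (\<lambda>x. Rstat n (Vstar \<mu> \<delta> \<tau> \<sigma> \<epsilon> n \<omega> x)))
                       (distr N borel (\<lambda>\<nu>. Tfun (\<lambda>t. W (\<eta> t) \<nu>)))"
      using H
    proof
      assume H0: "\<forall>n\<ge>1. \<tau> n = n"
      have \<tau>: "\<forall>\<^sub>F n in sequentially. \<tau> n \<le> n" using H0 by (intro eventually_sequentiallyI[of 1]) auto
      have eq: "Vstar \<mu> \<delta> \<tau> \<sigma> \<epsilon> n \<omega> x k = Vstar \<mu> (\<lambda>_. 0) \<tau> \<sigma> \<epsilon> n \<omega> x k" if "k \<le> n" for n \<omega> x k
      \<comment> \<open>\<open>\<tau> 0\<close> is unconstrained, but for \<open>n = 0\<close> the
        sums are empty.\<close>
      proof (cases "n = 0")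
        case True then show ?thesis using that by (simp add: Vstar_def)
      next
        case False then show ?thesis using that H0 by (intro Vstar_no_shift) auto
      qed
      have Q: "Qstat n (Vstar \<mu> \<delta> \<tau> \<sigma> \<epsilon> n \<omega> x) = Qstat n (Vstar \<mu> (\<lambda>_. 0) \<tau> \<sigma> \<epsilon> n \<omega> x)"
        and R: "Rstat n (Vstar \<mu> \<delta> \<tau> \<sigma> \<epsilon> n \<omega> x) = Rstat n (Vstar \<mu> (\<lambda>_. 0) \<tau> \<sigma> \<epsilon> n \<omega> x)" for n \<omega> x
        by (rule statistics_cong, erule eq, simp add: Vstar_def)+
      show ?thesis unfolding Q R
        by (rule eventually_mono[OF slln]) (rule vanishing[OF W _ \<tau>], auto)
    next
      assume H1: "(\<forall>n\<ge>2. 1 \<le> \<tau> n \<and> \<tau> n < n \<and> \<delta> n \<noteq> 0) \<and> \<delta> \<longlonglongrightarrow> 0"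
      \<comment> \<open>The bound is available from \<open>n = 2\<close> on; for
        \<open>n = 1\<close> no change point satisfies \<open>1 \<le> \<tau> n < n\<close>.\<close>
      have \<tau>: "\<forall>\<^sub>F n in sequentially. \<tau> n \<le> n"
        using H1 by (intro eventually_sequentiallyI[of 2]) (auto intro: less_imp_le)
      show ?thesis by (rule eventually_mono[OF slln]) (rule vanishing[OF W _ \<tau>], use H1 in auto)
    qed
  next
    fix \<zeta> d and N :: "'c measure" and W B
    assume H: "0 < \<zeta> \<and> \<zeta> < 1 \<and> d \<noteq> 0 \<and> (\<forall>n. \<tau> n = nat \<lfloor>real n * \<zeta>\<rfloor>) \<and> (\<forall>n. \<delta> n = d)"
      and WB: "wiener N W \<and> wiener N B \<and> prob_space.indep_var N (Pi\<^sub>M {0..1} (\<lambda>_. borel)) (wpath W)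
                               (Pi\<^sub>M {0..1} (\<lambda>_. borel)) (wpath B)"
    have \<zeta>: "0 < \<zeta>" "\<zeta> < 1" and d: "d \<noteq> 0" and \<tau>: "\<And>n. \<tau> n = nat \<lfloor>real n * \<zeta>\<rfloor>" and \<delta>: "\<And>n. \<delta> n = d"
      using H by auto
    have W: "wiener N W" and B: "wiener N B" using WB by auto
    \<comment> \<open>By \<open>\<alpha>\<^sup>2 = d\<^sup>2 / vs2\<close> the variance of the shift
      component of \<open>G\<close> is the limit \<open>d\<^sup>2 * shift_var \<zeta>\<close> of the
      squared steps, normalised by \<open>vs2\<close>.\<close>
    define \<alpha> where "\<alpha> = d / sqrt vs2"
    have \<alpha>: "\<alpha> \<noteq> 0" "\<alpha>\<^sup>2 = d\<^sup>2 / vs2" using d vs2_pos by (auto simp: \<alpha>_def power_divide)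
    define G where "G = (\<lambda>\<nu> t. W (\<eta> t) \<nu> - \<alpha> * shift_path \<zeta> (\<lambda>t. B t \<nu>) t)"
    have cp: "continuous_process N G"
      unfolding G_def by (rule continuous_process_shifted[OF W B \<zeta>])
    have gi: "gaussian_increments N (\<lambda>t. \<eta> t + d\<^sup>2 * shift_var \<zeta> t / vs2) G"
      using gaussian_increments_shifted[OF W B _ \<zeta> \<alpha>(1)] WB unfolding G_def \<alpha>(2) by simp
    have le: "\<tau> n \<le> n" for n
    proof -
      have "real n * \<zeta> \<le> real n" using \<zeta> by (simp add: mult_left_le)
      then show ?thesis unfolding \<tau> by linarith
    qed
    have gc: "grid_conv (\<lambda>n k. (\<delta> n)\<^sup>2 * shift_var (real (\<tau> n) / real n) (real k / real n)) (\<lambda>t. d\<^sup>2 * shift_var \<zeta> t)"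
      unfolding \<delta>
      by (rule grid_conv_mult[OF grid_conv_grid[of "\<lambda>_. d\<^sup>2"] grid_conv_shift_var[OF \<tau> \<zeta>], of "d\<^sup>2" 2])
         (use shift_var_bounds[of \<zeta>] \<zeta> in auto)
    have Gd: "(\<lambda>\<nu> t. W (\<eta> t) \<nu> - d / sqrt vs2 * (if t \<le> \<zeta> then (1 - \<zeta>) * B t \<nu> else B \<zeta> \<nu> - \<zeta> * B t \<nu>)) = G"
      by (simp add: G_def \<alpha>_def shift_path_def)
    show "let G = (\<lambda>\<nu> t. W (\<eta> t) \<nu> - d / sqrt vs2 *
                    (if t \<le> \<zeta> then (1 - \<zeta>) * B t \<nu> else B \<zeta> \<nu> - \<zeta> * B t \<nu>))
         in AE \<omega> in M.
           weak_conv_m (\<lambda>n. distr (boot_law n) borel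
                         (\<lambda>x. Qstat n (Vstar \<mu> \<delta> \<tau> \<sigma> \<epsilon> n \<omega> x)))
                       (distr N borel (\<lambda>\<nu>. Sfun (G \<nu>)))
         \<and> weak_conv_m (\<lambda>n. distr (boot_law n) borel
                         (\<lambda>x. Rstat n (Vstar \<mu> \<delta> \<tau> \<sigma> \<epsilon> n \<omega> x)))
                       (distr N borel (\<lambda>\<nu>. Tfun (G \<nu>)))"
      unfolding Gd Let_def
    proof (rule eventually_mono[OF slln])
      fix \<omega>
      assume e: "(\<lambda>n. (\<Sum>i=1..n. \<epsilon> i \<omega>) / real n) \<longlonglongrightarrow> 0 \<and> (\<lambda>n. (\<Sum>i=1..n. (\<epsilon> i \<omega>)\<^sup>2) / real n) \<longlonglongrightarrow> 1"
      show "weak_conv_m (\<lambda>n. distr (boot_law n) borel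
                         (\<lambda>x. Qstat n (Vstar \<mu> \<delta> \<tau> \<sigma> \<epsilon> n \<omega> x)))
                       (distr N borel (\<lambda>\<nu>. Sfun (G \<nu>)))
         \<and> weak_conv_m (\<lambda>n. distr (boot_law n) borel
                         (\<lambda>x. Rstat n (Vstar \<mu> \<delta> \<tau> \<sigma> \<epsilon> n \<omega> x)))
                       (distr N borel (\<lambda>\<nu>. Tfun (G \<nu>)))"
      proof (rule weak_conv_Vstar[where \<epsilon> = \<epsilon> and \<omega> = \<omega> and \<tau> = \<tau> and \<delta> = \<delta> and G = G
            and \<Lambda> = "\<lambda>t. d\<^sup>2 * shift_var \<zeta> t", OF wienerD(1)[OF W] cp gi _ _ _ e[THEN conjunct1] e[THEN conjunct2] _ _ gc])
        show "d\<^sup>2 * shift_var \<zeta> 0 = 0" using \<zeta> by (simp add: shift_var_0)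
        show "continuous_on {0..1} (\<lambda>t. d\<^sup>2 * shift_var \<zeta> t)"
          by (intro continuous_intros shift_var_profile[OF \<zeta>])
        show "mono_on {0..1} (\<lambda>t. d\<^sup>2 * shift_var \<zeta> t)"
          using shift_var_profile(2)[OF \<zeta>] by (auto simp: mono_on_def intro!: mult_left_mono)
        show "\<forall>\<^sub>F n in sequentially. \<tau> n \<le> n" using le by simp
        show "\<bar>\<delta> n\<bar> \<le> \<bar>d\<bar>" for n by (simp add: \<delta>)
      qed
    qed
  qed
qed

end
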